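(* Let $x_0\in\Omega$ be such that $B_d(x_0)$ (with its mesh) is symmetric about $x_0$, with $d=C^*h|\ln h|$ and $C^*$ sufficiently large. If $k-s$ is even, then $$|(u-u_h)^{(s)}(x_0)|\le C h^{k+2-s},$$ where $C$ is independent of $h$ and $\ln h$. Here $0\le s\le\mu$ when $x_0$ is a mesh node, and $0\le s\le k$ when $x_0$ lies in the interior of an element.
   Context: Let $\Omega=(a,b)$, let $f$ be sufficiently smooth, and let $u$ be the solution of $-u''=f$ in $\Omega$, $u(a)=u(b)=0$. Let $a=x_1<\dots<x_{N+1}=b$ be a quasi-uniform family of partitions with mesh size $h=\max_i(x_{i+1}-x_i)$ (arbitrarily small), $I_i=[x_i,x_{i+1}]$. For integers $0\le\mu\le k-1$ let $S_h^{k,\mu}(\Omega)=\{\chi\in C^\mu(\Omega):\ \chi|_{I_i}\in\mathcal P_k(I_i)\ \forall i\}$, where $\mathcal P_k$ denotes polynomials of degree at most $k$, and $V_h=S_h^{k,\mu}(\Omega)\cap H_0^1(\Omega)$. The Galerkin solution $u_h\in V_h$ is defined by $\int_\Omega (u-u_h)'\chi'\,dx=0$ for all $\chi\in V_h$. $B_d(x_0)\subset\Omega$ denotes a subdomain centered at $x_0$, a union of whole mesh elements, whose size is determined by $d=C^*h|\ln h|$, where $C^*>0$ is a sufficiently large constant independent of $h$ and $x_0$. "$B_d(x_0)$ is symmetric about $x_0$" means that the mesh restricted to $B_d(x_0)$ (more precisely, to the slightly larger union of the supports of all spline basis functions meeting $B_d(x_0)$) is invariant under the reflection $x\mapsto 2x_0-x$;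 thus $x_0$ is either a mesh point or the midpoint of a mesh element. $C$ denotes a positive constant independent of $h$ (it may depend on $u,k,\mu$). *)

theory Defs
  imports "HOL-Analysis.Analysis" "HOL-Computational_Algebra.Polynomial"
begin

text \<open>\<open>C\<^sup>n\<close> functions on a set; at an end point of a closed interval the derivatives are
  one-sided.\<close>

fun Cn_on :: "nat \<Rightarrow> real set \<Rightarrow> (real \<Rightarrow> real) \<Rightarrow> bool" where
  "Cn_on 0 S f \<longleftrightarrow> continuous_on S f"
| "Cn_on (Suc n) S f \<longleftrightarrow>
     (\<exists>g. (\<forall>x\<in>S. (f has_real_derivative g x) (at x within S)) \<and> Cn_on n S g)"

definition poisson_solution :: "real \<Rightarrow> real \<Rightarrow> (real \<Rightarrow> real) \<Rightarrow> (real \<Rightarrow> real) \<Rightarrow> bool" where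
  "poisson_solution a b f u \<longleftrightarrow>
     continuous_on {a..b} u \<and> u a = 0 \<and> u b = 0 \<and>
     (\<exists>u'. \<forall>x\<in>{a<..<b}. (u has_real_derivative u' x) (at x) \<and>
                         (u' has_real_derivative - f x) (at x))"

text \<open>A partition is given by \<open>N\<close> and the nodes \<open>x 1 < \<dots> < x (N + 1)\<close>; other values of \<open>x\<close>
  are irrelevant.\<close>

definition mesh :: "real \<Rightarrow> real \<Rightarrow> nat \<Rightarrow> (nat \<Rightarrow> real) \<Rightarrow> bool" where
  "mesh a b N x \<longleftrightarrow>
     1 \<le> N \<and> x 1 = a \<and> x (N + 1) = b \<and> (\<forall>i\<in>{1..N}. x i < x (i + 1))"

definition mesh_elem :: "(nat \<Rightarrow> real) \<Rightarrow> nat \<Rightarrow> real set" where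
  "mesh_elem x i = {x i..x (i + 1)}"

definition mesh_size :: "nat \<Rightarrow> (nat \<Rightarrow> real) \<Rightarrow> real" where
  "mesh_size N x = Max ((\<lambda>i. x (i + 1) - x i) ` {1..N})"

definition quasi_uniform_family ::
    "real \<Rightarrow> real \<Rightarrow> (nat \<times> (nat \<Rightarrow> real)) set \<Rightarrow> bool" where
  "quasi_uniform_family a b F \<longleftrightarrow>
     (\<forall>(N, x)\<in>F. mesh a b N x) \<and>
     (\<exists>\<sigma>>0. \<forall>(N, x)\<in>F. \<forall>i\<in>{1..N}. mesh_size N x \<le> \<sigma> * (x (i + 1) - x i)) \<and>
     (\<forall>\<epsilon>>0. \<exists>(N, x)\<in>F. mesh_size N x < \<epsilon>)"

definition spline_space ::
    "real \<Rightarrow> real \<Rightarrow> nat \<Rightarrow> (nat \<Rightarrow> real) \<Rightarrow> nat \<Rightarrow> nat \<Rightarrow> (real \<Rightarrow> real) set" where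
  "spline_space a b N x k \<mu> =
     {v. Cn_on \<mu> {a<..<b} v \<and>
         (\<forall>i\<in>{1..N}. \<exists>p. degree p \<le> k \<and> (\<forall>y\<in>mesh_elem x i. v y = poly p y))}"

text \<open>\<open>H\<^sub>0\<^sup>1(a, b)\<close> in one dimension, identified with the continuous representatives: primitives
  of square integrable functions that vanish at both end points (at \<open>a\<close> automatically).\<close>

definition H01 :: "real \<Rightarrow> real \<Rightarrow> (real \<Rightarrow> real) set" where
  "H01 a b =
     {v. \<exists>g. set_borel_measurable lborel {a..b} g \<and>
             set_integrable lborel {a..b} (\<lambda>t. (g t)\<^sup>2) \<and>
             (\<forall>y\<in>{a..b}. v y = (LBINT t:{a..y}. g t)) \<and> v b = 0}"

definition V_space ::
    "real \<Rightarrow> real \<Rightarrow> nat \<Rightarrow> (nat \<Rightarrow> real) \<Rightarrow> nat \<Rightarrow> nat \<Rightarrow> (real \<Rightarrow> real) set" where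
  "V_space a b N x k \<mu> = spline_space a b N x k \<mu> \<inter> H01 a b"

text \<open>The pointwise derivatives below exist except possibly at the finitely many nodes, where the
  unspecified value of \<^const>\<open>deriv\<close> does not affect the integral.\<close>

definition galerkin_solution ::
    "real \<Rightarrow> real \<Rightarrow> nat \<Rightarrow> (nat \<Rightarrow> real) \<Rightarrow> nat \<Rightarrow> nat \<Rightarrow> (real \<Rightarrow> real) \<Rightarrow> (real \<Rightarrow> real) \<Rightarrow> bool"
  where
  "galerkin_solution a b N x k \<mu> u uh \<longleftrightarrow>
     uh \<in> V_space a b N x k \<mu> \<and>
     (\<forall>v\<in>V_space a b N x k \<mu>.
        (LBINT y:{a<..<b}. deriv (\<lambda>z. u z - uh z) y * deriv v y) = 0)"

text \<open>Cox--de Boor recursion on the knot list \<open>t\<close>; since \<open>c / 0 = 0\<close>, terms belonging to a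
  vanishing knot interval drop out as usual.\<close>

fun bspline :: "real list \<Rightarrow> nat \<Rightarrow> nat \<Rightarrow> real \<Rightarrow> real" where
  "bspline t 0 j y = (if t ! j \<le> y \<and> y < t ! (j + 1) then 1 else 0)"
| "bspline t (Suc p) j y =
     (y - t ! j) / (t ! (j + p + 1) - t ! j) * bspline t p j y +
     (t ! (j + p + 2) - y) / (t ! (j + p + 2) - t ! (j + 1)) * bspline t p (j + 1) y"

text \<open>Interior nodes of multiplicity \<open>k - \<mu>\<close> correspond to \<open>C\<^sup>\<mu>\<close> continuity for degree \<open>k\<close>.\<close>

definition spline_knots :: "nat \<Rightarrow> (nat \<Rightarrow> real) \<Rightarrow> nat \<Rightarrow> nat \<Rightarrow> real list" where
  "spline_knots N x k \<mu> =
     replicate (k + 1) (x 1) @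
     concat (map (\<lambda>i. replicate (k - \<mu>) (x i)) [2..<N + 1]) @
     replicate (k + 1) (x (N + 1))"

definition spline_basis :: "nat \<Rightarrow> (nat \<Rightarrow> real) \<Rightarrow> nat \<Rightarrow> nat \<Rightarrow> (real \<Rightarrow> real) set" where
  "spline_basis N x k \<mu> =
     {bspline (spline_knots N x k \<mu>) k j |j. j + k + 1 < length (spline_knots N x k \<mu>)}"

text \<open>\<open>B\<^sub>d(x\<^sub>0)\<close>: the union of the mesh elements that meet \<open>[x\<^sub>0 - d, x\<^sub>0 + d]\<close>.\<close>

definition patch :: "nat \<Rightarrow> (nat \<Rightarrow> real) \<Rightarrow> real \<Rightarrow> real \<Rightarrow> real set" where
  "patch N x d x0 =
     \<Union> {mesh_elem x i |i. i \<in> {1..N} \<and> mesh_elem x i \<inter> {x0 - d..x0 + d} \<noteq> {}}"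

definition enlarged_patch ::
    "nat \<Rightarrow> (nat \<Rightarrow> real) \<Rightarrow> nat \<Rightarrow> nat \<Rightarrow> real \<Rightarrow> real \<Rightarrow> real set" where
  "enlarged_patch N x k \<mu> d x0 =
     patch N x d x0 \<union>
     \<Union> {closure {y. \<phi> y \<noteq> 0} |\<phi>. \<phi> \<in> spline_basis N x k \<mu> \<and> (\<exists>y\<in>patch N x d x0. \<phi> y \<noteq> 0)}"

text \<open>The collection of mesh elements making up the enlarged patch is mapped onto itself by
  \<open>y \<mapsto> 2 x\<^sub>0 - y\<close>.\<close>

definition symmetric_patch ::
    "nat \<Rightarrow> (nat \<Rightarrow> real) \<Rightarrow> nat \<Rightarrow> nat \<Rightarrow> real \<Rightarrow> real \<Rightarrow> bool" where
  "symmetric_patch N x k \<mu> d x0 \<longleftrightarrow>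
     (let E = {mesh_elem x i |i. i \<in> {1..N} \<and> mesh_elem x i \<subseteq> enlarged_patch N x k \<mu> d x0}
      in (\<lambda>K. (\<lambda>y. 2 * x0 - y) ` K) ` E = E)"

end

theory Submission
  imports Defs
begin

text \<open>
Let \<open>e = u - u\<^sub>h\<close> and \<open>w = u'\<close>. Since \<open>\<integral> e' = 0\<close>, Galerkin orthogonality says that \<open>e'\<close> is orthogonal
in \<open>L\<^sup>2\<close> to every spline of degree \<open>k - 1\<close> and smoothness \<open>\<mu> - 1\<close>, whatever its mean. The idea is to
fold the error about \<open>x\<^sub>0\<close>, that is, to pass to \<open>g y = e' y - (-1)\<^sup>k e' (2 x\<^sub>0 - y)\<close>. On a symmetric mesh
the folded \<open>u\<^sub>h'\<close> is again a spline, and \<open>g\<close> is still orthogonal to all splines supported in the patch.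
The sign is chosen so that folding kills the Taylor term of degree \<open>k\<close> of \<open>w\<close>: the folded \<open>w\<close> is a
polynomial of degree at most \<open>k - 1\<close>, itself a spline, plus a remainder \<open>\<rho>\<close> with
\<open>\<rho> y = O(\<bar>y - x\<^sub>0\<bar>\<^bsup>k + 1\<^esup>)\<close>, one power better than for \<open>w\<close>. So \<open>g = \<rho> - \<Phi>\<close> with a spline \<open>\<Phi>\<close>, and \<open>\<Phi>\<close> is the
local projection of a remainder that is small near \<open>x\<^sub>0\<close>.

What remains is local. Testing with \<open>\<Phi>\<close> cut off to zero inside the patch (lemma \<open>energy_step\<close>) bounds
the energy of \<open>\<Phi>\<close> on a region by a fraction \<open>\<theta> < 1\<close> of its energy on the region that is \<open>k\<close> cells
wider on each side, plus \<open>\<integral> \<rho>\<^sup>2\<close>. The patch is at least \<open>C\<^sup>* \<bar>ln h\<bar>\<close> cells deep, so the bounded energy at its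
boundary is damped by \<open>\<theta>\<close> raised to a multiple of \<open>\<bar>ln h\<bar>\<close>, a power of \<open>h\<close> as high as desired if \<open>C\<^sup>*\<close>
is large; the remainders, weighted geometrically, sum to \<open>O(h\<^bsup>2k + 3\<^esup>)\<close> without a logarithm. Hence
\<open>\<integral> \<Phi>\<^sup>2 = O(h\<^bsup>2k + 3\<^esup>)\<close> near \<open>x\<^sub>0\<close>, and an inverse estimate gives \<open>\<Phi>\<^bsup>(j)\<^esup> = O(h\<^bsup>k + 1 - j\<^esup>)\<close> there (lemma \<open>fine_bound\<close>).

If \<open>s \<ge> 1\<close> and \<open>k - s\<close> is even, then \<open>-2 e\<^bsup>(s)\<^esup>(x\<^sub>0)\<close> is the derivative of order \<open>s - 1\<close> of \<open>\<Phi>\<close> at \<open>x\<^sub>0\<close>, which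
proves the claim. The value \<open>e x\<^sub>0\<close> (\<open>s = 0\<close>, \<open>k\<close> even) is not determined by \<open>e'\<close> near \<open>x\<^sub>0\<close>; but pairing
\<open>g\<close> with a spline that steps from 0 to 1 near \<open>x\<^sub>0\<close> gives \<open>e z + e (2 x\<^sub>0 - z)\<close> at a nearby node \<open>z\<close>, and the
mean value theorem transports this to \<open>2 e x\<^sub>0\<close>, because \<open>g\<close> is the derivative of \<open>y \<mapsto> e y + e (2 x\<^sub>0 - y)\<close>.
On meshes with \<open>h\<close> bounded below only boundedness of the error is needed (lemma \<open>crude_bound\<close>).

Throughout, a spline is a family of polynomials, one per cell, with divisibility conditions at the
nodes. This turns smoothness into algebra, and reflection into a substitution.
\<close>

abbreviation cell :: "(nat \<Rightarrow> real) \<Rightarrow> nat \<Rightarrow> real set" where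
  "cell x i \<equiv> {x i..x (i + 1)}"

text \<open>The pieces on the two sides of the node \<open>x i\<close> fit together with \<open>m - 1\<close> continuous derivatives.
For \<open>m = 0\<close> the condition is void and a jump is allowed.\<close>

abbreviation joined :: "(nat \<Rightarrow> real) \<Rightarrow> nat \<Rightarrow> (nat \<Rightarrow> real poly) \<Rightarrow> nat \<Rightarrow> bool" where
  "joined x m P i \<equiv> [:- x i, 1:] ^ m dvd P i - P (i - 1)"

abbreviation sqnorm :: "real set \<Rightarrow> real poly \<Rightarrow> real" where
  "sqnorm S p \<equiv> integral S (\<lambda>y. (poly p y)\<^sup>2)"

section \<open>Coefficients of a polynomial and its square integral\<close>

definition lagrange :: "(nat \<Rightarrow> real) \<Rightarrow> nat \<Rightarrow> nat \<Rightarrow> real poly" where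
  "lagrange \<zeta> n j = smult (1 / (\<Prod>i\<in>{..n}-{j}. \<zeta> j - \<zeta> i)) (\<Prod>i\<in>{..n}-{j}. [:- \<zeta> i, 1:])"

lemma degree_lagrange: "j \<le> n \<Longrightarrow> degree (lagrange \<zeta> n j) \<le> n"
proof -
  assume "j \<le> n"
  have "degree (\<Prod>i\<in>{..n}-{j}. [:- \<zeta> i, 1:]) \<le> (\<Sum>i\<in>{..n}-{j}. degree [:- \<zeta> i, 1:])"
    by (rule order_trans[OF degree_prod_sum_le]) auto
  also have "\<dots> = n" using \<open>j \<le> n\<close> by simp
  finally show ?thesis unfolding lagrange_def
    using degree_smult_le order_trans by blast
qed

lemma poly_lagrange:
  assumes "inj_on \<zeta> {..n}" "i \<le> n" "j \<le> n"
  shows "poly (lagrange \<zeta> n j) (\<zeta> i) = (if i = j then 1 else 0)"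
proof -
  have "(\<Prod>l\<in>{..n}-{j}. \<zeta> j - \<zeta> l) \<noteq> 0"
    using assms by (auto simp: inj_on_def)
  moreover have "i \<noteq> j \<Longrightarrow> (\<Prod>l\<in>{..n}-{j}. \<zeta> i - \<zeta> l) = 0"
    using assms by (intro prod_zero) auto
  ultimately show ?thesis by (auto simp: lagrange_def poly_prod)
qed

lemma lagrange_interpolation:
  assumes "inj_on \<zeta> {..n}" "degree p \<le> n"
  shows "p = (\<Sum>j\<le>n. smult (poly p (\<zeta> j)) (lagrange \<zeta> n j))"
proof (rule poly_eqI_degree[where A = "\<zeta> ` {..n}"])
  fix y assume "y \<in> \<zeta> ` {..n}"
  then obtain i where i: "i \<le> n" "y = \<zeta> i" by auto
  have "poly (\<Sum>j\<le>n. smult (poly p (\<zeta> j)) (lagrange \<zeta> n j)) (\<zeta> i)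
      = (\<Sum>j\<le>n. if j = i then poly p (\<zeta> j) else 0)"
    unfolding poly_sum by (intro sum.cong refl) (use assms(1) i in \<open>simp add: poly_lagrange\<close>)
  also have "\<dots> = poly p (\<zeta> i)" using i by simp
  finally show "poly p y = poly (\<Sum>j\<le>n. smult (poly p (\<zeta> j)) (lagrange \<zeta> n j)) y" using i by simp
next
  show "degree p < card (\<zeta> ` {..n})" using assms by (simp add: card_image)
  have "degree (\<Sum>j\<le>n. smult (poly p (\<zeta> j)) (lagrange \<zeta> n j)) \<le> n"
    by (intro degree_sum_le) (auto simp: degree_lagrange)
  thus "degree (\<Sum>j\<le>n. smult (poly p (\<zeta> j)) (lagrange \<zeta> n j)) < card (\<zeta> ` {..n})"
    using assms by (simp add: card_image)
qed

text \<open>Multiplying by a linear factor shifts the coefficients and adds \<open>\<zeta>\<close> times them, which costs at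
most a factor \<open>1 + R\<close>.\<close>

lemma coeff_prod_linear_bound:
  assumes "finite A" "\<And>i. i \<in> A \<Longrightarrow> \<bar>\<zeta> i :: real\<bar> \<le> R" "0 \<le> R"
  shows "\<bar>coeff (\<Prod>i\<in>A. [:- \<zeta> i, 1:]) m\<bar> \<le> (1 + R) ^ card A"
  using assms(1,2)
proof (induction A arbitrary: m rule: finite_induct)
  case empty
  then show ?case by (auto simp: coeff_eq_0 one_pCons coeff_pCons split: nat.split)
next
  case (insert z A)
  let ?p = "\<Prod>i\<in>A. [:- \<zeta> i, 1:]"
  have b: "\<bar>coeff ?p m\<bar> \<le> (1 + R) ^ card A" for m using insert by auto
  have "coeff ([:- \<zeta> z, 1:] * ?p) m = - \<zeta> z * coeff ?p m + (case m of 0 \<Rightarrow> 0 | Suc m' \<Rightarrow> coeff ?p m')"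
    by (simp add: coeff_pCons)
  also have "\<bar>\<dots>\<bar> \<le> \<bar>\<zeta> z\<bar> * \<bar>coeff ?p m\<bar> + \<bar>case m of 0 \<Rightarrow> 0 | Suc m' \<Rightarrow> coeff ?p m'\<bar>"
    by (rule order_trans[OF abs_triangle_ineq]) (simp add: abs_mult)
  also have "\<dots> \<le> R * (1 + R) ^ card A + (1 + R) ^ card A"
    using insert.prems b assms(3) by (intro add_mono mult_mono) (auto split: nat.split)
  finally show ?case using insert by (simp add: algebra_simps)
qed

lemma coeff_lagrange_bound:
  assumes "j \<le> n" "\<And>i. i \<le> n \<Longrightarrow> \<bar>\<zeta> i\<bar> \<le> R" "0 \<le> R" "0 < \<delta>"
    and "\<And>i. i \<le> n \<Longrightarrow> i \<noteq> j \<Longrightarrow> \<delta> \<le> \<bar>\<zeta> j - \<zeta> i\<bar>"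
  shows "\<bar>coeff (lagrange \<zeta> n j) m\<bar> \<le> ((1 + R) / \<delta>) ^ n"
proof -
  have c: "card ({..n}-{j}) = n" using assms(1) by simp
  have "\<delta> ^ n \<le> (\<Prod>i\<in>{..n}-{j}. \<bar>\<zeta> j - \<zeta> i\<bar>)"
  proof -
    have "(\<Prod>i\<in>{..n}-{j}. \<delta>) \<le> (\<Prod>i\<in>{..n}-{j}. \<bar>\<zeta> j - \<zeta> i\<bar>)"
      using assms by (intro prod_mono) auto
    thus ?thesis using c by simp
  qed
  moreover have "\<bar>coeff (\<Prod>i\<in>{..n}-{j}. [:- \<zeta> i, 1:]) m\<bar> \<le> (1 + R) ^ n"
    using coeff_prod_linear_bound[of "{..n}-{j}" \<zeta> R m] assms c by auto
  ultimately show ?thesis using assms(3,4)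
    by (auto simp: lagrange_def abs_mult abs_prod power_divide intro!: frac_le)
qed

lemma integral_ge_at_minimum:
  fixes f :: "real \<Rightarrow> real"
  assumes "a < b" "continuous_on {a..b} f"
  obtains z where "z \<in> {a..b}" "f z * (b - a) \<le> integral {a..b} f"
proof -
  obtain z where z: "z \<in> {a..b}" "\<And>y. y \<in> {a..b} \<Longrightarrow> f z \<le> f y"
    using continuous_attains_inf[of "{a..b}" f] assms by (auto simp: less_imp_le)
  have "integral {a..b} (\<lambda>_. f z) \<le> integral {a..b} f"
    using assms z by (intro integral_le) (auto intro: integrable_continuous_real)
  thus ?thesis using that[of z] z assms by (simp add: mult.commute)
qed

text \<open>All norms on polynomials of bounded degree are equivalent; the constant depends
only on a lower bound for the length of the interval and on how far from the origin it reaches. Choose \<open>n + 1\<close> separated subintervals, in each of them a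
point where the square of the polynomial is at most its mean, and interpolate there: the Lagrange
polynomials have bounded coefficients because the points are separated.\<close>

lemma coeff_le_L2:
  fixes n :: nat and R \<delta> :: real
  assumes "0 < \<delta>" "0 \<le> R"
  shows "\<exists>K>0. \<forall>p \<alpha> \<beta> m. degree p \<le> n \<longrightarrow> -R \<le> \<alpha> \<longrightarrow> \<beta> \<le> R \<longrightarrow> \<delta> \<le> \<beta> - \<alpha> \<longrightarrow>
           (coeff p m)\<^sup>2 \<le> K * sqnorm {\<alpha>..\<beta>} p"
proof -
  \<comment> \<open>\<open>2n + 1\<close> equal subintervals, of which the even ones carry the interpolation points.\<close>
  define N where "N = 2 * real n + 1"
  define B where "B = ((1 + R) / (\<delta> / N)) ^ n"
  define K where "K = (real (n + 1) * B)\<^sup>2 * (N / \<delta>)"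
  have N: "N \<ge> 1" by (simp add: N_def)
  have B: "B > 0" using assms N by (auto simp: B_def intro!: zero_less_power divide_pos_pos)
  have "K > 0" using B N assms by (auto simp: K_def intro!: mult_pos_pos)
  moreover have "(coeff p m)\<^sup>2 \<le> K * sqnorm {\<alpha>..\<beta>} p"
    if p: "degree p \<le> n" and ab: "-R \<le> \<alpha>" "\<beta> \<le> R" "\<delta> \<le> \<beta> - \<alpha>" for p \<alpha> \<beta> m
  proof -
    define I where "I = sqnorm {\<alpha>..\<beta>} p"
    define L where "L = (\<beta> - \<alpha>) / N"
    have L: "L \<ge> \<delta> / N" "L > 0" "\<delta> / N > 0" using ab N assms by (auto simp: L_def divide_right_mono)
    have NL: "N * L = \<beta> - \<alpha>" using N by (simp add: L_def)
    have "\<exists>z. z \<in> {\<alpha> + 2 * real j * L..\<alpha> + (2 * real j + 1) * L} \<and> (poly p z)\<^sup>2 \<le> (N / \<delta>) * I" if "j \<le> n" for j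
    proof -
      let ?l = "\<alpha> + 2 * real j * L" and ?r = "\<alpha> + (2 * real j + 1) * L"
      have lr: "?l < ?r" using L by (simp add: algebra_simps)
      have "(2 * real j + 1) * L \<le> N * L" using that L by (intro mult_right_mono) (auto simp: N_def)
      hence sub: "{?l..?r} \<subseteq> {\<alpha>..\<beta>}" using L NL by auto
      obtain z where z: "z \<in> {?l..?r}" "(poly p z)\<^sup>2 * (?r - ?l) \<le> sqnorm {?l..?r} p"
        by (rule integral_ge_at_minimum[OF lr, of "\<lambda>z. (poly p z)\<^sup>2"]) (auto intro!: continuous_intros)
      have "sqnorm {?l..?r} p \<le> I" unfolding I_def
        using sub by (intro integral_subset_le) (auto intro!: integrable_continuous_real continuous_intros)
      hence "(poly p z)\<^sup>2 * L \<le> I" using z(2) by (simp add: algebra_simps)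
      moreover have "(poly p z)\<^sup>2 * (\<delta> / N) \<le> (poly p z)\<^sup>2 * L" using L by (intro mult_left_mono) auto
      ultimately have "(poly p z)\<^sup>2 * (\<delta> / N) \<le> I" by linarith
      hence "(poly p z)\<^sup>2 \<le> (N / \<delta>) * I" using assms N by (simp add: field_simps)
      thus ?thesis using z by auto
    qed
    then obtain \<zeta> where \<zeta>: "\<And>j. j \<le> n \<Longrightarrow> \<zeta> j \<in> {\<alpha> + 2 * real j * L..\<alpha> + (2 * real j + 1) * L} \<and> (poly p (\<zeta> j))\<^sup>2 \<le> (N / \<delta>) * I"
      by metis
    have less: "L \<le> \<zeta> j - \<zeta> i" if "i < j" "j \<le> n" for i j
    proof -
      have "(2 * real i + 2) * L \<le> 2 * real j * L" using that L by (intro mult_right_mono) auto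
      thus ?thesis using \<zeta>[of i] \<zeta>[of j] that by (simp add: algebra_simps)
    qed
    have sep: "\<delta> / N \<le> \<bar>\<zeta> j - \<zeta> i\<bar>" if "i \<le> n" "i \<noteq> j" "j \<le> n" for i j
      using less[of i j] less[of j i] that L by (cases "i < j") auto
    have inj: "inj_on \<zeta> {..n}" using sep L(3) by (fastforce simp: inj_on_def)
    have bd: "\<bar>\<zeta> j\<bar> \<le> R" if "j \<le> n" for j
    proof -
      have "(2 * real j + 1) * L \<le> N * L" using that L by (intro mult_right_mono) (auto simp: N_def)
      moreover have "0 \<le> 2 * real j * L" using L by simp
      ultimately show ?thesis using \<zeta>[OF that] NL ab
        unfolding abs_le_iff atLeastAtMost_iff by linarith
    qed
    have I0: "I \<ge> 0" unfolding I_def by (intro integral_nonneg integrable_continuous_real continuous_intros) auto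
    define s where "s = sqrt ((N / \<delta>) * I)"
    have s: "\<bar>poly p (\<zeta> j)\<bar> \<le> s" if "j \<le> n" for j
      using \<zeta>[OF that] by (auto simp: s_def intro: real_le_rsqrt)
    have "coeff p m = (\<Sum>j\<le>n. poly p (\<zeta> j) * coeff (lagrange \<zeta> n j) m)"
      by (subst lagrange_interpolation[OF inj p]) (simp add: coeff_sum)
    also have "\<bar>\<dots>\<bar> \<le> (\<Sum>j\<le>n. \<bar>poly p (\<zeta> j)\<bar> * \<bar>coeff (lagrange \<zeta> n j) m\<bar>)"
      by (rule order_trans[OF sum_abs]) (simp add: abs_mult)
    also have "\<dots> \<le> (\<Sum>j\<le>n. s * B)"
    proof (intro sum_mono mult_mono s)
      fix j assume "j \<in> {..n}"
      thus "\<bar>coeff (lagrange \<zeta> n j) m\<bar> \<le> B" unfolding B_def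
        using bd sep L assms by (intro coeff_lagrange_bound) auto
    qed (use I0 assms N in \<open>auto simp: s_def\<close>)
    also have "\<dots> = real (n + 1) * B * s" by simp
    finally have "\<bar>coeff p m\<bar>\<^sup>2 \<le> (real (n + 1) * B * s)\<^sup>2" by (intro power_mono) auto
    also have "\<dots> = K * I" using I0 assms N by (simp add: power_mult_distrib s_def K_def)
    finally show ?thesis by (simp add: I_def)
  qed
  ultimately show ?thesis by blast
qed

section \<open>Inverse estimate and cutting off a spline\<close>

lemma integral_affine_pos:
  fixes f :: "real \<Rightarrow> real"
  assumes "0 < h" "continuous_on {t + h * \<alpha>..t + h * \<beta>} f"
  shows "integral {t + h * \<alpha>..t + h * \<beta>} f = h * integral {\<alpha>..\<beta>} (\<lambda>z. f (t + h * z))"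
proof -
  have "(f has_integral integral {t + h * \<alpha>..t + h * \<beta>} f) (cbox (t + h * \<alpha>) (t + h * \<beta>))"
    using integrable_integral[OF integrable_continuous_real[OF assms(2)]] by simp
  from has_integral_affinity'[OF this, of h t] assms
  have "((\<lambda>z. f (t + h * z)) has_integral integral {t + h * \<alpha>..t + h * \<beta>} f / h) {\<alpha>..\<beta>}"
    by (simp add: field_simps)
  thus ?thesis using assms by (simp add: integral_unique)
qed

lemma integral_reflect_about:
  fixes f :: "real \<Rightarrow> real"
  assumes "continuous_on {\<alpha>..\<beta>} f"
  shows "integral {s - \<beta>..s - \<alpha>} (\<lambda>y. f (s - y)) = integral {\<alpha>..\<beta>} f"
proof -
  have "(f has_integral integral {\<alpha>..\<beta>} f) (cbox \<alpha> \<beta>)"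
    using integrable_integral[OF integrable_continuous_real[OF assms]] by simp
  from has_integral_affinity[OF this, of "-1" s] 
  have "((\<lambda>z. f (s - z)) has_integral integral {\<alpha>..\<beta>} f)
          ((\<lambda>x. s - x) ` cbox \<alpha> \<beta>)" by simp
  thus ?thesis by (simp add: integral_unique)
qed

lemma coeff_scaled_le_L2:
  fixes n :: nat and R \<delta> :: real
  assumes "0 < \<delta>" "0 \<le> R"
  shows "\<exists>K>0. \<forall>p t h \<alpha> \<beta> m. 0 < h \<longrightarrow> degree p \<le> n \<longrightarrow> t - R * h \<le> \<alpha> \<longrightarrow> \<beta> \<le> t + R * h \<longrightarrow>
           \<delta> * h \<le> \<beta> - \<alpha> \<longrightarrow>
           (coeff (pcompose p [:t, h:]) m)\<^sup>2 * h \<le> K * sqnorm {\<alpha>..\<beta>} p"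
proof -
  obtain K where K: "K > 0" "\<And>p \<alpha> \<beta> m. degree p \<le> n \<Longrightarrow> -R \<le> \<alpha> \<Longrightarrow> \<beta> \<le> R \<Longrightarrow> \<delta> \<le> \<beta> - \<alpha> \<Longrightarrow>
           (coeff p m)\<^sup>2 \<le> K * sqnorm {\<alpha>..\<beta>} p"
    using coeff_le_L2[OF assms, of n] by blast
  have "(coeff (pcompose p [:t, h:]) m)\<^sup>2 * h \<le> K * sqnorm {\<alpha>..\<beta>} p"
    if a: "0 < h" "degree p \<le> n" "t - R * h \<le> \<alpha>" "\<beta> \<le> t + R * h" "\<delta> * h \<le> \<beta> - \<alpha>" for p t h \<alpha> \<beta> m
  proof -
    define \<alpha>' where "\<alpha>' = (\<alpha> - t) / h"
    define \<beta>' where "\<beta>' = (\<beta> - t) / h"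
    have ab: "\<alpha> = t + h * \<alpha>'" "\<beta> = t + h * \<beta>'" using a by (auto simp: \<alpha>'_def \<beta>'_def)
    have b: "-R \<le> \<alpha>'" "\<beta>' \<le> R" using a by (auto simp: \<alpha>'_def \<beta>'_def field_simps)
    have "h * \<delta> \<le> h * (\<beta>' - \<alpha>')" using a(5) unfolding ab by (simp add: algebra_simps)
    hence c: "\<delta> \<le> \<beta>' - \<alpha>'" using a(1) by simp
    have d: "degree (pcompose p [:t, h:]) \<le> n" using a(1,2) by (simp add: degree_pcompose)
    have "(coeff (pcompose p [:t, h:]) m)\<^sup>2 \<le> K * integral {\<alpha>'..\<beta>'} (\<lambda>z. (poly p (t + h * z))\<^sup>2)"
      using K(2)[OF d b c] by (simp add: poly_pcompose mult.commute)
    hence "(coeff (pcompose p [:t, h:]) m)\<^sup>2 * h \<le> K * (h * integral {\<alpha>'..\<beta>'} (\<lambda>z. (poly p (t + h * z))\<^sup>2))"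
      using a(1) by (simp add: mult.commute mult.left_commute)
    also have "h * integral {\<alpha>'..\<beta>'} (\<lambda>z. (poly p (t + h * z))\<^sup>2) = sqnorm {\<alpha>..\<beta>} p"
      unfolding ab by (subst integral_affine_pos) (auto intro!: continuous_intros a)
    finally show ?thesis .
  qed
  with K(1) show ?thesis by blast
qed

lemma abs_poly_le_coeffs:
  fixes P :: "real poly"
  assumes "degree P \<le> n" "\<And>m. m \<le> n \<Longrightarrow> \<bar>coeff P m\<bar> \<le> B" "\<bar>z\<bar> \<le> 1"
  shows "\<bar>poly P z\<bar> \<le> real (n + 1) * B"
proof -
  have B: "B \<ge> 0" using assms(2)[of 0] by linarith
  have "poly P z = (\<Sum>m\<le>n. coeff P m * z ^ m)"
    unfolding poly_altdef using assms(1) by (intro sum.mono_neutral_left) (auto simp: coeff_eq_0)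
  also have "\<bar>\<dots>\<bar> \<le> (\<Sum>m\<le>n. \<bar>coeff P m\<bar> * \<bar>z\<bar> ^ m)"
    by (rule order_trans[OF sum_abs]) (simp add: abs_mult power_abs)
  also have "\<dots> \<le> (\<Sum>m\<le>n. B * 1)"
    using assms B by (intro sum_mono mult_mono) (auto simp: power_le_one)
  finally show ?thesis by simp
qed

lemma degree_higher_pderiv_le: "degree ((pderiv ^^ j) p) \<le> degree (p :: real poly)"
  by (induction j) (auto simp: degree_pderiv intro: order_trans)

lemma coeff_higher_pderiv_le:
  fixes P :: "real poly"
  assumes "degree P \<le> n" "\<And>m. \<bar>coeff P m\<bar> \<le> B"
  shows "\<bar>coeff ((pderiv ^^ j) P) m\<bar> \<le> real n ^ j * B"
proof (induction j arbitrary: m)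
  case 0
  then show ?case using assms by simp
next
  case (Suc j)
  have B: "0 \<le> B" using assms(2)[of 0] by linarith
  show ?case
  proof (cases "Suc m \<le> n")
    case True
    have "\<bar>coeff ((pderiv ^^ Suc j) P) m\<bar> = real (Suc m) * \<bar>coeff ((pderiv ^^ j) P) (Suc m)\<bar>"
      by (simp add: coeff_pderiv abs_mult)
    also have "\<dots> \<le> real n * (real n ^ j * B)"
      using True Suc by (intro mult_mono) auto
    finally show ?thesis by simp
  next
    case False
    hence "coeff ((pderiv ^^ j) P) (Suc m) = 0"
      using degree_higher_pderiv_le[of j P] assms(1) by (intro coeff_eq_0) linarith
    then show ?thesis using B by (simp add: coeff_pderiv)
  qed
qed

lemma higher_pderiv_pcompose_linear:
  "(pderiv ^^ j) (pcompose p [:t, h:]) = smult (h ^ j) (pcompose ((pderiv ^^ j) p) [:t, h :: real:])"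
  by (induction j) (auto simp: pderiv_smult pderiv_pcompose pderiv_pCons mult.commute)

definition inverse_constant :: "nat \<Rightarrow> real \<Rightarrow> real \<Rightarrow> bool" where
  "inverse_constant n \<delta> K \<longleftrightarrow>
     (\<forall>p h \<alpha> \<beta> j y. 0 < h \<longrightarrow> degree p \<le> n \<longrightarrow> j \<le> n \<longrightarrow>
        \<delta> * h \<le> \<beta> - \<alpha> \<longrightarrow> \<beta> - \<alpha> \<le> h \<longrightarrow> y \<in> {\<alpha>..\<beta>} \<longrightarrow>
        (poly ((pderiv ^^ j) p) y)\<^sup>2 * h ^ (2 * j + 1) \<le> K * sqnorm {\<alpha>..\<beta>} p)"

lemma inverse_estimate:
  fixes n :: nat and \<delta> :: real
  assumes "0 < \<delta>"
  obtains K where "0 < K" "inverse_constant n \<delta> K"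
proof -
  obtain K where K: "K > 0" "\<And>p t h \<alpha> \<beta> m. 0 < h \<Longrightarrow> degree p \<le> n \<Longrightarrow> t - 1 * h \<le> \<alpha> \<Longrightarrow> \<beta> \<le> t + 1 * h \<Longrightarrow>
           \<delta> * h \<le> \<beta> - \<alpha> \<Longrightarrow>
           (coeff (pcompose p [:t, h:]) m)\<^sup>2 * h \<le> K * sqnorm {\<alpha>..\<beta>} p"
    using coeff_scaled_le_L2[OF assms, of 1 n] by auto
  define M where "M = real (n + 1) * real (n + 1) ^ n"
  have M: "M > 0" by (simp add: M_def)
  have "(poly ((pderiv ^^ j) p) y)\<^sup>2 * h ^ (2 * j + 1) \<le> (M\<^sup>2 * K) * sqnorm {\<alpha>..\<beta>} p"
    if a: "0 < h" "degree p \<le> n" "j \<le> n" "\<delta> * h \<le> \<beta> - \<alpha>" "\<beta> - \<alpha> \<le> h" "y \<in> {\<alpha>..\<beta>}" for p h \<alpha> \<beta> j y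
  proof -
    define I where "I = sqnorm {\<alpha>..\<beta>} p"
    have I0: "I \<ge> 0" unfolding I_def by (intro integral_nonneg integrable_continuous_real continuous_intros) auto
    define P where "P = pcompose p [:\<alpha>, h:]"
    define B where "B = sqrt (K * I / h)"
    have cP: "\<bar>coeff P m\<bar> \<le> B" for m
    proof -
      have "(coeff P m)\<^sup>2 * h \<le> K * I" unfolding P_def I_def using a by (intro K(2)) auto
      hence "(coeff P m)\<^sup>2 \<le> K * I / h" using a(1) by (simp add: field_simps)
      thus ?thesis unfolding B_def by (metis real_sqrt_abs real_sqrt_le_iff)
    qed
    have dP: "degree P \<le> n" using a by (simp add: P_def degree_pcompose)
    have B0: "B \<ge> 0" using cP[of 0] by linarith
    define z where "z = (y - \<alpha>) / h"
    have z: "\<bar>z\<bar> \<le> 1" using a by (auto simp: z_def field_simps)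
    have y: "y = \<alpha> + h * z" using a by (simp add: z_def)
    have "h ^ j * poly ((pderiv ^^ j) p) y = poly ((pderiv ^^ j) P) z"
      by (simp add: P_def higher_pderiv_pcompose_linear poly_pcompose y mult.commute)
    also have "\<bar>\<dots>\<bar> \<le> real (n + 1) * (real n ^ j * B)"
      using dP degree_higher_pderiv_le[of j P] by (intro abs_poly_le_coeffs[OF _ _ z] coeff_higher_pderiv_le cP) auto
    also have "\<dots> \<le> M * B"
    proof -
      have "real n ^ j \<le> real (n + 1) ^ j" by (intro power_mono) auto
      also have "\<dots> \<le> real (n + 1) ^ n" using a(3) by (intro power_increasing) auto
      finally show ?thesis using B0 unfolding M_def mult.assoc by (intro mult_left_mono mult_right_mono) auto
    qed
    finally have "\<bar>h ^ j * poly ((pderiv ^^ j) p) y\<bar>\<^sup>2 \<le> (M * B)\<^sup>2" by (intro power_mono) auto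
    hence "(h ^ j)\<^sup>2 * (poly ((pderiv ^^ j) p) y)\<^sup>2 \<le> M\<^sup>2 * (K * I / h)"
      using K(1) I0 a(1) by (simp add: power_mult_distrib B_def)
    hence "((h ^ j)\<^sup>2 * (poly ((pderiv ^^ j) p) y)\<^sup>2) * h \<le> (M\<^sup>2 * (K * I / h)) * h"
      using a(1) by (intro mult_right_mono) auto
    thus ?thesis using a(1) unfolding I_def[symmetric]
      by (simp add: power_mult[symmetric] mult_ac)
  qed
  moreover have "M\<^sup>2 * K > 0" using M K by simp
  ultimately show ?thesis using that unfolding inverse_constant_def by blast
qed

text \<open>The powers \<open>(y - t\<^sub>j)\<^sup>n\<close> with \<open>n + 1\<close> distinct nodes form a basis of the polynomials of degree at
most \<open>n\<close>. Expanding by the binomial theorem, the coefficients \<open>c\<^sub>j\<close> of a polynomial in this basis solve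
a Vandermonde system for the moments \<open>\<Sum>\<^sub>j c\<^sub>j t\<^sub>j\<^sup>r\<close>, which the coefficients of the Lagrange polynomials
invert. In coordinates scaled by \<open>h\<close> everything is bounded, since the nodes are \<open>\<delta>\<close>-separated.\<close>

lemma truncated_power_coeffs:
  fixes n :: nat and \<delta> :: real
  assumes \<delta>: "0 < \<delta>"
  shows "\<exists>K>0. \<forall>p t h. 0 < h \<longrightarrow> degree p \<le> n \<longrightarrow>
           (\<forall>j\<le>n. \<delta> * h \<le> t (Suc j) - t j \<and> t (Suc j) - t j \<le> h) \<longrightarrow>
           (\<exists>c. p = (\<Sum>j\<le>n. smult (c j) ([:- t j, 1:] ^ n)) \<and>
                (\<forall>j\<le>n. (c j * h ^ n)\<^sup>2 * h \<le> K * sqnorm {t n..t (Suc n)} p))"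
proof -
  obtain K where K: "K > 0" "\<And>p t h \<alpha> \<beta> m. 0 < h \<Longrightarrow> degree p \<le> n \<Longrightarrow> t - real (n + 1) * h \<le> \<alpha> \<Longrightarrow> \<beta> \<le> t + real (n + 1) * h \<Longrightarrow>
           \<delta> * h \<le> \<beta> - \<alpha> \<Longrightarrow>
           (coeff (pcompose p [:t, h:]) m)\<^sup>2 * h \<le> K * sqnorm {\<alpha>..\<beta>} p"
    using coeff_scaled_le_L2[OF assms, of "real (n + 1)" n] by auto
  define M where "M = real (n + 1) * ((1 + real n) / \<delta>) ^ n"
  have M: "M > 0" using \<delta> by (auto simp: M_def)
  have "\<exists>c. p = (\<Sum>j\<le>n. smult (c j) ([:- t j, 1:] ^ n)) \<and>
                (\<forall>j\<le>n. (c j * h ^ n)\<^sup>2 * h \<le> (M\<^sup>2 * K) * sqnorm {t n..t (Suc n)} p)"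
    if h: "0 < h" and p: "degree p \<le> n"
      and t: "\<And>j. j \<le> n \<Longrightarrow> \<delta> * h \<le> t (Suc j) - t j \<and> t (Suc j) - t j \<le> h" for p h and t :: "nat \<Rightarrow> real"
  proof -
    have up: "t j - t 0 \<le> real j * h" if "j \<le> Suc n" for j
      using that
    proof (induction j)
      case (Suc j)
      then show ?case using t[of j] by (simp add: algebra_simps)
    qed simp
    have low: "\<delta> * h \<le> t j - t i" if "i < j" "j \<le> Suc n" for i j
      using that
    proof (induction j)
      case (Suc j)
      have "0 < \<delta> * h" using \<delta> h by simp
      then show ?case using Suc t[of j] by (cases "i = j") auto
    qed simp
    define I where "I = sqnorm {t n..t (Suc n)} p"
    have I0: "I \<ge> 0" unfolding I_def by (intro integral_nonneg integrable_continuous_real continuous_intros) auto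
    define P where "P = pcompose p [:t 0, h:]"
    define B where "B = sqrt (K * I / h)"
    have "0 < \<delta> * h" using \<delta> h by simp
    hence tn: "t n \<ge> t 0" using low[of 0 n] by (cases "n = 0") auto
    have cP: "\<bar>coeff P m\<bar> \<le> B" for m
    proof -
      have "(coeff P m)\<^sup>2 * h \<le> K * I" unfolding P_def I_def
      proof (intro K(2))
        have "0 \<le> real (n + 1) * h" using h by simp
        thus "t 0 - real (n + 1) * h \<le> t n" using tn by linarith
        show "t (Suc n) \<le> t 0 + real (n + 1) * h" using up[of "Suc n"] by simp
      qed (use h p t[of n] in auto)
      hence "(coeff P m)\<^sup>2 \<le> K * I / h" using h by (simp add: field_simps)
      thus ?thesis unfolding B_def by (metis real_sqrt_abs real_sqrt_le_iff)
    qed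
    have B0: "B \<ge> 0" using cP[of 0] by linarith
    have dP: "degree P \<le> n" using p h by (simp add: P_def degree_pcompose)
    define \<zeta> where "\<zeta> j = (t j - t 0) / h" for j
    have t_eq: "t j = t 0 + h * \<zeta> j" for j using h by (simp add: \<zeta>_def)
    have sep1: "\<delta> \<le> \<zeta> j - \<zeta> i" if "i < j" "j \<le> n" for i j
      using low[of i j] that h by (simp add: \<zeta>_def field_simps)
    have sep: "\<delta> \<le> \<bar>\<zeta> j - \<zeta> i\<bar>" if "i \<le> n" "j \<le> n" "i \<noteq> j" for i j
      using sep1[of i j] sep1[of j i] that \<delta> by (cases "i < j") auto
    have inj: "inj_on \<zeta> {..n}" using sep \<delta> by (fastforce simp: inj_on_def)
    have bd: "\<bar>\<zeta> j\<bar> \<le> real n" if "j \<le> n" for j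
    proof -
      have "0 < \<delta> * h" using \<delta> h by simp
      hence "t 0 \<le> t j" using low[of 0 j] that by (cases "j = 0") auto
      hence "0 \<le> \<zeta> j" using h by (simp add: \<zeta>_def)
      moreover have "\<zeta> j \<le> real j" using up[of j] that h by (simp add: \<zeta>_def field_simps)
      ultimately show ?thesis using that by linarith
    qed
    define c' where "c' j = (\<Sum>m\<le>n. (-1) ^ (n - m) * coeff (lagrange \<zeta> n j) (n - m) * (coeff P m / real (n choose m)))" for j
    \<comment> \<open>The Lagrange coefficients are dual to the powers of the nodes: interpolating \<open>z\<^sup>r\<close> is exact.\<close>
    have moment: "(\<Sum>j\<le>n. c' j * \<zeta> j ^ (n - m)) = (-1) ^ (n - m) * (coeff P m / real (n choose m))" if "m \<le> n" for m
    proof -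
      have dual: "(\<Sum>j\<le>n. \<zeta> j ^ (n - m) * coeff (lagrange \<zeta> n j) i) = (if i = n - m then 1 else 0)" for i
      proof -
        have "monom 1 (n - m) = (\<Sum>j\<le>n. smult (poly (monom 1 (n - m)) (\<zeta> j)) (lagrange \<zeta> n j))"
          by (rule lagrange_interpolation[OF inj]) (simp add: degree_monom_eq)
        hence "coeff (monom 1 (n - m)) i = coeff (\<Sum>j\<le>n. smult (poly (monom 1 (n - m)) (\<zeta> j)) (lagrange \<zeta> n j)) i"
          by simp
        thus ?thesis by (auto simp: coeff_sum poly_monom)
      qed
      have "(\<Sum>j\<le>n. c' j * \<zeta> j ^ (n - m)) =
            (\<Sum>j\<le>n. \<Sum>l\<le>n. (-1) ^ (n - l) * (coeff P l / real (n choose l)) * (\<zeta> j ^ (n - m) * coeff (lagrange \<zeta> n j) (n - l)))"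
        unfolding c'_def sum_distrib_right by (intro sum.cong refl) (simp add: mult_ac)
      also have "\<dots> = (\<Sum>l\<le>n. (-1) ^ (n - l) * (coeff P l / real (n choose l)) * (\<Sum>j\<le>n. \<zeta> j ^ (n - m) * coeff (lagrange \<zeta> n j) (n - l)))"
        by (subst sum.swap) (simp add: sum_distrib_left)
      also have "\<dots> = (\<Sum>l\<le>n. if l = m then (-1) ^ (n - l) * (coeff P l / real (n choose l)) else 0)"
        unfolding dual using that by (intro sum.cong) auto
      finally show ?thesis using that by simp
    qed
    have id: "(\<Sum>j\<le>n. c' j * (z - \<zeta> j) ^ n) = poly P z" for z
    proof -
      have "(\<Sum>j\<le>n. c' j * (z - \<zeta> j) ^ n) = (\<Sum>j\<le>n. c' j * (z + - \<zeta> j) ^ n)" by simp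
      also have "\<dots> = (\<Sum>j\<le>n. \<Sum>m\<le>n. real (n choose m) * z ^ m * (-1) ^ (n - m) * (c' j * \<zeta> j ^ (n - m)))"
      proof (rule sum.cong[OF refl])
        fix j
        have "(z + - \<zeta> j) ^ n = (\<Sum>m\<le>n. real (n choose m) * z ^ m * ((-1) ^ (n - m) * \<zeta> j ^ (n - m)))"
          unfolding binomial_ring by (intro sum.cong refl) (metis power_minus)
        thus "c' j * (z + - \<zeta> j) ^ n = (\<Sum>m\<le>n. real (n choose m) * z ^ m * (-1) ^ (n - m) * (c' j * \<zeta> j ^ (n - m)))"
          by (simp add: sum_distrib_left mult_ac)
      qed
      also have "\<dots> = (\<Sum>m\<le>n. real (n choose m) * z ^ m * (-1) ^ (n - m) * (\<Sum>j\<le>n. c' j * \<zeta> j ^ (n - m)))"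
        by (subst sum.swap) (simp add: sum_distrib_left)
      also have "\<dots> = (\<Sum>m\<le>n. coeff P m * z ^ m)"
      proof (intro sum.cong refl)
        fix m assume m: "m \<in> {..n}"
        have "(-1) ^ (n - m) * (-1 :: real) ^ (n - m) = 1" by (simp flip: power_mult_distrib)
        thus "real (n choose m) * z ^ m * (-1) ^ (n - m) * (\<Sum>j\<le>n. c' j * \<zeta> j ^ (n - m)) = coeff P m * z ^ m"
          using m by (subst moment) auto
      qed
      also have "\<dots> = poly P z"
        unfolding poly_altdef using dP by (intro sum.mono_neutral_right) (auto simp: coeff_eq_0)
      finally show ?thesis .
    qed
    have c'_bd: "\<bar>c' j\<bar> \<le> M * B" if "j \<le> n" for j
    proof -
      have "\<bar>c' j\<bar> \<le> (\<Sum>m\<le>n. \<bar>coeff (lagrange \<zeta> n j) (n - m)\<bar> * \<bar>coeff P m / real (n choose m)\<bar>)"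
        unfolding c'_def by (rule order_trans[OF sum_abs]) (simp add: abs_mult power_abs)
      also have "\<dots> \<le> (\<Sum>m\<le>n. ((1 + real n) / \<delta>) ^ n * B)"
      proof (intro sum_mono mult_mono)
        fix m assume "m \<in> {..n}"
        hence "1 \<le> n choose m" by (simp add: Suc_le_eq)
        hence "real 1 \<le> real (n choose m)" by (rule of_nat_mono)
        hence "1 \<le> real (n choose m)" by (simp only: of_nat_1)
        hence "\<bar>coeff P m\<bar> * 1 \<le> \<bar>coeff P m\<bar> * real (n choose m)" by (intro mult_left_mono) auto
        hence "\<bar>coeff P m\<bar> / real (n choose m) \<le> \<bar>coeff P m\<bar>"
          using \<open>1 \<le> real (n choose m)\<close> by (intro mult_imp_div_pos_le) linarith+
        thus "\<bar>coeff P m / real (n choose m)\<bar> \<le> B" using cP[of m] by simp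
        show "\<bar>coeff (lagrange \<zeta> n j) (n - m)\<bar> \<le> ((1 + real n) / \<delta>) ^ n"
          using that bd sep \<delta> by (intro coeff_lagrange_bound) auto
      qed (use \<delta> in auto)
      finally show ?thesis by (simp add: M_def)
    qed
    define c where "c j = c' j / h ^ n" for j
    have "p = (\<Sum>j\<le>n. smult (c j) ([:- t j, 1:] ^ n))"
    proof (rule poly_eq_poly_eq_iff[THEN iffD1], rule ext)
      fix y
      define z where "z = (y - t 0) / h"
      have y: "y = t 0 + h * z" using h by (simp add: z_def)
      have "y - t j = h * (z - \<zeta> j)" for j unfolding y using t_eq[of j] by (simp add: algebra_simps)
      hence "poly (\<Sum>j\<le>n. smult (c j) ([:- t j, 1:] ^ n)) y = (\<Sum>j\<le>n. c' j * (z - \<zeta> j) ^ n)"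
        using h by (simp add: poly_sum poly_power c_def power_mult_distrib)
      also have "\<dots> = poly p y" unfolding id by (simp add: P_def poly_pcompose y mult.commute)
      finally show "poly p y = poly (\<Sum>j\<le>n. smult (c j) ([:- t j, 1:] ^ n)) y" by simp
    qed
    moreover have "(c j * h ^ n)\<^sup>2 * h \<le> (M\<^sup>2 * K) * I" if "j \<le> n" for j
    proof -
      have "\<bar>c' j\<bar>\<^sup>2 \<le> (M * B)\<^sup>2" using c'_bd[OF that] by (intro power_mono) auto
      hence "(c' j)\<^sup>2 \<le> M\<^sup>2 * (K * I / h)" using K(1) I0 h by (simp add: power_mult_distrib B_def)
      hence "(c' j)\<^sup>2 * h \<le> M\<^sup>2 * (K * I)" using h by (simp add: field_simps)
      moreover have "c j * h ^ n = c' j" using h by (simp add: c_def)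
      ultimately show ?thesis by (simp add: mult.assoc)
    qed
    ultimately show ?thesis unfolding I_def by blast
  qed
  moreover have "M\<^sup>2 * K > 0" using M K by simp
  ultimately show ?thesis by blast
qed

text \<open>The bound on the transition cells involves a single cell, on which \<open>\<Psi>\<close> already agrees with \<open>\<Phi>\<close>;
this is what turns the cutoff into an inequality between energies. The order \<open>n\<close> at the transition nodes
is the highest that allows a spline of degree \<open>n\<close> to change its piece, so the cutoff serves every
smoothness \<open>\<mu> \<le> n\<close>.\<close>

definition cutoff_constant :: "nat \<Rightarrow> real \<Rightarrow> real \<Rightarrow> bool" where
  "cutoff_constant n \<delta> K \<longleftrightarrow>
     (\<forall>(x :: nat \<Rightarrow> real) h \<Phi> p. 0 < h \<longrightarrow> 1 \<le> p \<longrightarrow> (\<forall>i. degree (\<Phi> i) \<le> n) \<longrightarrow>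
        (\<forall>i\<in>{p..p + n}. \<delta> * h \<le> x (i + 1) - x i \<and> x (i + 1) - x i \<le> h) \<longrightarrow>
        (\<exists>\<Psi>. (\<forall>i<p. \<Psi> i = 0) \<and> (\<forall>i\<ge>p + n. \<Psi> i = \<Phi> i) \<and> (\<forall>i. degree (\<Psi> i) \<le> n) \<and>
           (\<forall>i\<in>{p..p + n}. joined x n \<Psi> i) \<and>
           (\<forall>i\<in>{p..p + n}. \<forall>y\<in>cell x i.
              (poly (\<Psi> i) y)\<^sup>2 * h \<le>
                K * sqnorm {x (p + n)..x (p + n + 1)} (\<Phi> (p + n)))))"

text \<open>If \<open>\<Sum>\<^sub>j c\<^sub>j (y - t\<^sub>j)\<^sup>n\<close> is the piece of \<open>\<Phi>\<close> on the cell \<open>p + n\<close>, then the sum of the truncated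
powers \<open>c\<^sub>j (y - t\<^sub>j)\<^sub>+\<^sup>n\<close> is zero before the first node and equal to that piece after the last one.\<close>

lemma spline_cutoff:
  fixes n :: nat and \<delta> :: real
  assumes \<delta>: "0 < \<delta>"
  obtains K where "0 < K" "cutoff_constant n \<delta> K"
proof -
  from truncated_power_coeffs[OF assms, of n] obtain K where K': "K > 0 \<and> (\<forall>p t h. 0 < h \<longrightarrow> degree p \<le> n \<longrightarrow>
           (\<forall>j\<le>n. \<delta> * h \<le> t (Suc j) - t j \<and> t (Suc j) - t j \<le> h) \<longrightarrow>
           (\<exists>c. p = (\<Sum>j\<le>n. smult (c j) ([:- t j, 1:] ^ n)) \<and>
                (\<forall>j\<le>n. (c j * h ^ n)\<^sup>2 * h \<le> K * sqnorm {t n..t (Suc n)} p)))" ..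
  note K = conjunct1[OF K'] conjunct2[OF K']
  define M where "M = real (n + 1) * real (n + 1) ^ n"
  have M: "M > 0" by (simp add: M_def)
  have main: "(\<exists>\<Psi>. (\<forall>i<p. \<Psi> i = 0) \<and> (\<forall>i\<ge>p + n. \<Psi> i = \<Phi> i) \<and> (\<forall>i. degree (\<Psi> i) \<le> n) \<and>
              (\<forall>i\<in>{p..p + n}. joined x n \<Psi> i) \<and>
              (\<forall>i\<in>{p..p + n}. \<forall>y\<in>cell x i.
                 (poly (\<Psi> i) y)\<^sup>2 * h \<le>
                   (M\<^sup>2 * K) * sqnorm {x (p + n)..x (p + n + 1)} (\<Phi> (p + n))))"
    if h: "0 < h" and p: "1 \<le> p" and \<Phi>': "\<forall>i. degree (\<Phi> i) \<le> n"
      and x': "\<forall>i\<in>{p..p + n}. \<delta> * h \<le> x (i + 1) - x i \<and> x (i + 1) - x i \<le> h"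
    for x :: "nat \<Rightarrow> real" and h \<Phi> p
  proof -
    note \<Phi> = \<Phi>'[rule_format] and x = x'[rule_format]
    define t where "t j = x (p + j)" for j
    have t: "\<delta> * h \<le> t (Suc j) - t j \<and> t (Suc j) - t j \<le> h" if "j \<le> n" for j
      using x[of "p + j"] that by (simp add: t_def)
    have up: "t j - t i \<le> real (j - i) * h \<and> 0 \<le> t j - t i" if "i \<le> j" "j \<le> Suc n" for i j
      using that
    proof (induction j)
      case (Suc j)
      show ?case
      proof (cases "i = Suc j")
        case False
        hence "real (Suc j - i) * h = real (j - i) * h + h"
          using Suc.prems by (simp add: Suc_diff_le algebra_simps)
        moreover have "t j - t i \<le> real (j - i) * h \<and> 0 \<le> t j - t i" using Suc False by simp
        moreover have "0 < \<delta> * h" "\<delta> * h \<le> t (Suc j) - t j" "t (Suc j) - t j \<le> h"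
          using \<delta> h t[of j] Suc.prems by simp_all
        ultimately show ?thesis by linarith
      qed simp
    qed simp
    define I where "I = sqnorm {t n..t (Suc n)} (\<Phi> (p + n))"
    have I0: "I \<ge> 0" unfolding I_def by (intro integral_nonneg integrable_continuous_real continuous_intros) auto
    obtain c where c: "\<Phi> (p + n) = (\<Sum>j\<le>n. smult (c j) ([:- t j, 1:] ^ n))"
      "\<And>j. j \<le> n \<Longrightarrow> (c j * h ^ n)\<^sup>2 * h \<le> K * I"
    proof -
      have "\<forall>j\<le>n. \<delta> * h \<le> t (Suc j) - t j \<and> t (Suc j) - t j \<le> h" using t by simp
      hence "\<exists>c. \<Phi> (p + n) = (\<Sum>j\<le>n. smult (c j) ([:- t j, 1:] ^ n)) \<and> (\<forall>j\<le>n. (c j * h ^ n)\<^sup>2 * h \<le> K * I)"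
        unfolding I_def by (intro K(2)[THEN spec, THEN spec, THEN spec, THEN mp, THEN mp, THEN mp] h \<Phi>)
      then obtain c where c: "\<Phi> (p + n) = (\<Sum>j\<le>n. smult (c j) ([:- t j, 1:] ^ n))" "\<forall>j\<le>n. (c j * h ^ n)\<^sup>2 * h \<le> K * I"
        by (elim exE conjE) (rule that)
      show ?thesis by (rule that[OF c(1)]) (rule c(2)[rule_format])
    qed
    define G where "G m = (\<Sum>j<m. smult (c j) ([:- t j, 1:] ^ n))" for m
    \<comment> \<open>For \<open>i < p\<close> the truncated difference is 0 and the sum is empty.\<close>
    define \<Psi> where "\<Psi> i = (if i \<le> p + n then G (i + 1 - p) else \<Phi> i)" for i
    have Gn: "G (n + 1) = \<Phi> (p + n)" unfolding G_def c(1) by (simp add: lessThan_Suc_atMost)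
    have degG: "degree (G m) \<le> n" for m unfolding G_def
      by (intro degree_sum_le) (auto simp: degree_linear_power)
    have "\<forall>i<p. \<Psi> i = 0" by (auto simp: \<Psi>_def G_def)
    moreover have "\<forall>i\<ge>p + n. \<Psi> i = \<Phi> i" using Gn by (auto simp: \<Psi>_def)
    moreover have "\<forall>i. degree (\<Psi> i) \<le> n" using \<Phi> degG by (auto simp: \<Psi>_def)
    moreover have "joined x n \<Psi> i" if "i \<in> {p..p + n}" for i
    proof -
      define j where "j = i - p"
      have j: "i = p + j" "j \<le> n" using that by (auto simp: j_def)
      have "\<Psi> i - \<Psi> (i - 1) = G (Suc j) - G j" using p j by (auto simp: \<Psi>_def)
      also have "\<dots> = smult (c j) ([:- x i, 1:] ^ n)" by (simp add: G_def t_def j)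
      finally show ?thesis by (simp add: dvd_smult)
    qed
    moreover have "(poly (\<Psi> i) y)\<^sup>2 * h \<le> (M\<^sup>2 * K) * I" if "i \<in> {p..p + n}" "y \<in> cell x i" for i y
    proof -
      define j where "j = i - p"
      have j: "i = p + j" "j \<le> n" using that by (auto simp: j_def)
      have y: "t j \<le> y" "y \<le> t (Suc j)" using that by (auto simp: t_def j)
      define B where "B = sqrt (K * I / h)"
      have cb: "\<bar>c l\<bar> * h ^ n \<le> B" if "l \<le> n" for l
      proof -
        have "(c l * h ^ n)\<^sup>2 \<le> K * I / h" using c(2)[OF that] h by (simp add: field_simps)
        hence "\<bar>c l * h ^ n\<bar> \<le> B" unfolding B_def by (metis real_sqrt_abs real_sqrt_le_iff)
        thus ?thesis using h by (simp add: abs_mult)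
      qed
      have "poly (\<Psi> i) y = (\<Sum>l<Suc j. c l * (y - t l) ^ n)"
        using j by (simp add: \<Psi>_def G_def poly_sum poly_power)
      also have "\<bar>\<dots>\<bar> \<le> (\<Sum>l<Suc j. \<bar>c l\<bar> * \<bar>y - t l\<bar> ^ n)"
        by (rule order_trans[OF sum_abs]) (simp add: abs_mult power_abs)
      also have "\<dots> \<le> (\<Sum>l<Suc j. \<bar>c l\<bar> * (real (n + 1) * h) ^ n)"
      proof (intro sum_mono mult_left_mono power_mono)
        fix l assume l: "l \<in> {..<Suc j}"
        have "real (Suc j - l) * h \<le> real (n + 1) * h" using h j by (intro mult_right_mono) auto
        moreover have "0 \<le> y - t l" using up[of l j] l j y by auto
        moreover have "t (Suc j) - t l \<le> real (Suc j - l) * h" using up[of l "Suc j"] l j by auto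
        ultimately show "\<bar>y - t l\<bar> \<le> real (n + 1) * h" using y by linarith
      qed auto
      also have "\<dots> = (\<Sum>l<Suc j. (\<bar>c l\<bar> * h ^ n) * real (n + 1) ^ n)"
        by (simp add: power_mult_distrib mult_ac)
      also have "\<dots> \<le> (\<Sum>l<Suc j. B * real (n + 1) ^ n)"
        using cb j by (intro sum_mono mult_right_mono) auto
      also have "\<dots> = real (Suc j) * (B * real (n + 1) ^ n)" by simp
      also have "\<dots> \<le> real (n + 1) * (B * real (n + 1) ^ n)"
      proof (intro mult_right_mono mult_nonneg_nonneg)
        show "0 \<le> B" using K(1) I0 h by (simp add: B_def)
      qed (use j in auto)
      also have "\<dots> = M * B" by (simp add: M_def)
      finally have "\<bar>poly (\<Psi> i) y\<bar>\<^sup>2 \<le> (M * B)\<^sup>2" by (intro power_mono) auto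
      hence "(poly (\<Psi> i) y)\<^sup>2 \<le> M\<^sup>2 * (K * I / h)" using K(1) I0 h by (simp add: power_mult_distrib B_def)
      thus ?thesis using h by (simp add: field_simps)
    qed
    moreover have "t n = x (p + n)" "t (Suc n) = x (p + n + 1)" by (simp_all add: t_def)
    ultimately show ?thesis unfolding I_def by (intro exI[of _ \<Psi>]) simp
  qed
  have "cutoff_constant n \<delta> (M\<^sup>2 * K)"
    unfolding cutoff_constant_def by (intro allI impI; rule main; assumption)
  moreover have "M\<^sup>2 * K > 0" using M K by simp
  ultimately show ?thesis using that by blast
qed

section \<open>Geometric decay of solutions of the local Galerkin equation\<close>

text \<open>A source that grows polynomially does not spoil geometric decay: the polynomial \<open>W l = A (l + L)\<^sup>e\<close>
satisfies the recursion with the source as a supersolution once \<open>L\<close> and \<open>A\<close> are large, so \<open>F - B W\<close>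
satisfies the recursion without the source.\<close>

lemma geometric_decay:
  fixes \<theta> :: real and k e l0 :: nat
  assumes \<theta>: "0 < \<theta>" "\<theta> < 1"
  shows "\<exists>S>0. \<forall>F B J m. 0 \<le> B \<longrightarrow>
           (\<forall>l. l + k \<le> J \<longrightarrow> F l \<le> \<theta> * F (l + k) + B * real (l + k + 1) ^ e) \<longrightarrow>
           l0 + m * k \<le> J \<longrightarrow> F l0 \<le> \<theta> ^ m * F (l0 + m * k) + B * S"
proof -
  define \<gamma> where "\<gamma> = (1 + \<theta>) / 2"
  have "(\<lambda>L. real k / real L) \<longlonglongrightarrow> 0" by (rule lim_const_over_n)
  hence "(\<lambda>L. \<theta> * (1 + real k / real L) ^ e) \<longlonglongrightarrow> \<theta> * (1 + 0) ^ e"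
    by (intro tendsto_intros)
  moreover have "\<theta> * (1 + 0) ^ e < \<gamma>" using \<theta> by (simp add: \<gamma>_def)
  ultimately have "eventually (\<lambda>L. \<theta> * (1 + real k / real L) ^ e < \<gamma>) sequentially"
    by (rule order_tendstoD)
  hence "eventually (\<lambda>L. \<theta> * (1 + real k / real L) ^ e < \<gamma> \<and> k + 1 \<le> L) sequentially"
    using eventually_ge_at_top[of "k + 1"] by eventually_elim auto
  then obtain L where L: "\<theta> * (1 + real k / real L) ^ e < \<gamma>" "k + 1 \<le> L"
    by (auto simp: eventually_sequentially)
  define A where "A = 2 / (1 - \<theta>)"
  have A: "A > 0" "A * (1 - \<gamma>) = 1" using \<theta> by (auto simp: A_def \<gamma>_def field_simps)
  define W where "W l = A * real (l + L) ^ e" for l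
  have W0: "W l \<ge> 0" for l using A by (simp add: W_def)
  have step: "\<theta> * W (l + k) + real (l + k + 1) ^ e \<le> W l" for l
  proof -
    have "real (l + k + L) \<le> (1 + real k / real L) * real (l + L)"
      using L(2) by (simp add: field_simps)
    hence "real (l + k + L) ^ e \<le> ((1 + real k / real L) * real (l + L)) ^ e"
      by (intro power_mono) auto
    hence "\<theta> * real (l + k + L) ^ e \<le> \<theta> * (1 + real k / real L) ^ e * real (l + L) ^ e"
      using \<theta> by (simp add: power_mult_distrib mult.assoc)
    also have "\<dots> \<le> \<gamma> * real (l + L) ^ e" using L(1) by (intro mult_right_mono) auto
    finally have "A * (\<theta> * real (l + k + L) ^ e) \<le> A * (\<gamma> * real (l + L) ^ e)"
      using A by (intro mult_left_mono) auto
    moreover have "real (l + k + 1) ^ e \<le> real (l + L) ^ e" using L(2) by (intro power_mono) auto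
    moreover have "A * real (l + L) ^ e = A * (\<gamma> * real (l + L) ^ e) + (A * (1 - \<gamma>)) * real (l + L) ^ e"
      by (simp add: algebra_simps)
    ultimately show ?thesis using A(2) unfolding W_def by (simp add: mult.left_commute)
  qed
  have main: "F l0 \<le> \<theta> ^ m * F (l0 + m * k) + B * (W l0 + 1)"
    if B: "0 \<le> B" and F: "\<forall>l. l + k \<le> J \<longrightarrow> F l \<le> \<theta> * F (l + k) + B * real (l + k + 1) ^ e"
      and m: "l0 + m * k \<le> J" for F B J m
  proof -
    have "F l0 - B * W l0 \<le> \<theta> ^ m * (F (l0 + m * k) - B * W (l0 + m * k))"
      using m
    proof (induction m)
      case (Suc m)
      let ?l = "l0 + m * k"
      have "F ?l \<le> \<theta> * F (?l + k) + B * real (?l + k + 1) ^ e" using Suc.prems by (intro F[rule_format]) simp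
      moreover have "B * (\<theta> * W (?l + k) + real (?l + k + 1) ^ e) \<le> B * W ?l"
        using step B by (intro mult_left_mono)
      ultimately have "F ?l - B * W ?l \<le> \<theta> * (F (?l + k) - B * W (?l + k))"
        by (simp add: algebra_simps)
      hence "\<theta> ^ m * (F ?l - B * W ?l) \<le> \<theta> ^ m * (\<theta> * (F (?l + k) - B * W (?l + k)))"
        using \<theta> by (intro mult_left_mono) auto
      moreover have "?l + k = l0 + Suc m * k" by simp
      moreover have "F l0 - B * W l0 \<le> \<theta> ^ m * (F ?l - B * W ?l)" using Suc by simp
      ultimately show ?case by (simp only: power_Suc mult_ac) 
    qed simp
    moreover have "0 \<le> \<theta> ^ m * (B * W (l0 + m * k))" using \<theta> B W0 by simp
    ultimately show ?thesis using B by (simp add: algebra_simps)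
  qed
  have pos: "W l0 + 1 > 0" using W0[of l0] by simp
  show ?thesis
    by (intro exI[of _ "W l0 + 1"] conjI allI impI; (rule pos | rule main; assumption))
qed

definition energy :: "(nat \<Rightarrow> real) \<Rightarrow> (nat \<Rightarrow> real poly) \<Rightarrow> nat \<Rightarrow> nat \<Rightarrow> real" where
  "energy x \<Phi> p q = (\<Sum>i\<in>{p..<q}. sqnorm (cell x i) (\<Phi> i))"

lemma integral_square_poly_nonneg: "0 \<le> sqnorm {\<alpha>..\<beta>} p" for p :: "real poly"
  by (intro integral_nonneg integrable_continuous_real continuous_intros) auto

lemma energy_nonneg: "0 \<le> energy x \<Phi> p q"
  unfolding energy_def by (intro sum_nonneg integral_square_poly_nonneg)

lemma energy_mono: "p' \<le> p \<Longrightarrow> q \<le> q' \<Longrightarrow> energy x \<Phi> p q \<le> energy x \<Phi> p' q'"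
  unfolding energy_def by (intro sum_mono2 integral_square_poly_nonneg) auto

lemma energy_element_le:
  "p \<le> i \<Longrightarrow> i < q \<Longrightarrow> sqnorm (cell x i) (\<Phi> i) \<le> energy x \<Phi> p q"
  unfolding energy_def by (rule member_le_sum) (auto intro: integral_square_poly_nonneg)

text \<open>Young's inequality. The second form, with the polynomial itself as test function, is what makes the
energy appear with a negative sign.\<close>

lemma element_estimate:
  fixes \<rho> :: "real \<Rightarrow> real" and P Q :: "real poly"
  assumes "continuous_on {\<alpha>..\<beta>} \<rho>"
  shows "integral {\<alpha>..\<beta>} (\<lambda>y. (\<rho> y - poly P y) * poly Q y) \<le>
           1 / 2 * integral {\<alpha>..\<beta>} (\<lambda>y. (\<rho> y)\<^sup>2) + sqnorm {\<alpha>..\<beta>} Q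
             + 1 / 2 * sqnorm {\<alpha>..\<beta>} P"
    and "integral {\<alpha>..\<beta>} (\<lambda>y. (\<rho> y - poly P y) * poly P y) \<le>
           1 / 2 * integral {\<alpha>..\<beta>} (\<lambda>y. (\<rho> y)\<^sup>2) - 1 / 2 * sqnorm {\<alpha>..\<beta>} P"
proof -
  note int = integrable_continuous_real
  have i: "(\<lambda>y. (\<rho> y)\<^sup>2) integrable_on {\<alpha>..\<beta>}" "(\<lambda>y. (poly R y)\<^sup>2) integrable_on {\<alpha>..\<beta>}"
    "(\<lambda>y. (\<rho> y - poly P y) * poly R y) integrable_on {\<alpha>..\<beta>}" for R
    using assms by (auto intro!: int continuous_intros)
  have "integral {\<alpha>..\<beta>} (\<lambda>y. (\<rho> y - poly P y) * poly Q y) \<le>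
     integral {\<alpha>..\<beta>} (\<lambda>y. 1 / 2 * (\<rho> y)\<^sup>2 + (poly Q y)\<^sup>2 + 1 / 2 * (poly P y)\<^sup>2)"
  proof (intro integral_le i integrable_add integrable_on_mult_right)
    fix y
    have "0 \<le> (\<rho> y - poly Q y)\<^sup>2 + (poly Q y + poly P y)\<^sup>2" by simp
    thus "(\<rho> y - poly P y) * poly Q y \<le> 1 / 2 * (\<rho> y)\<^sup>2 + (poly Q y)\<^sup>2 + 1 / 2 * (poly P y)\<^sup>2"
      by (simp add: power2_eq_square algebra_simps)
  qed
  also have "\<dots> = 1 / 2 * integral {\<alpha>..\<beta>} (\<lambda>y. (\<rho> y)\<^sup>2) + sqnorm {\<alpha>..\<beta>} Q
             + 1 / 2 * sqnorm {\<alpha>..\<beta>} P"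
    using i by (simp add: integral_add integrable_add integrable_on_mult_right)
  finally show "integral {\<alpha>..\<beta>} (\<lambda>y. (\<rho> y - poly P y) * poly Q y) \<le>
           1 / 2 * integral {\<alpha>..\<beta>} (\<lambda>y. (\<rho> y)\<^sup>2) + sqnorm {\<alpha>..\<beta>} Q
             + 1 / 2 * sqnorm {\<alpha>..\<beta>} P" .
  have "integral {\<alpha>..\<beta>} (\<lambda>y. (\<rho> y - poly P y) * poly P y) \<le>
     integral {\<alpha>..\<beta>} (\<lambda>y. 1 / 2 * (\<rho> y)\<^sup>2 - 1 / 2 * (poly P y)\<^sup>2)"
  proof (intro integral_le i integrable_diff integrable_on_mult_right)
    fix y
    have "0 \<le> (\<rho> y - poly P y)\<^sup>2" by simp
    thus "(\<rho> y - poly P y) * poly P y \<le> 1 / 2 * (\<rho> y)\<^sup>2 - 1 / 2 * (poly P y)\<^sup>2"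
      by (simp add: power2_eq_square algebra_simps)
  qed
  also have "\<dots> = 1 / 2 * integral {\<alpha>..\<beta>} (\<lambda>y. (\<rho> y)\<^sup>2) - 1 / 2 * sqnorm {\<alpha>..\<beta>} P"
    using i by (simp add: integral_diff integrable_on_mult_right)
  finally show "integral {\<alpha>..\<beta>} (\<lambda>y. (\<rho> y - poly P y) * poly P y) \<le>
           1 / 2 * integral {\<alpha>..\<beta>} (\<lambda>y. (\<rho> y)\<^sup>2) - 1 / 2 * sqnorm {\<alpha>..\<beta>} P" .
qed

lemma integral_square_le_sup:
  fixes Q :: "real poly"
  assumes "\<And>y. y \<in> {\<alpha>..\<beta>} \<Longrightarrow> (poly Q y)\<^sup>2 * h \<le> B" "0 < h" "\<beta> - \<alpha> \<le> h" "0 \<le> B"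
  shows "sqnorm {\<alpha>..\<beta>} Q \<le> B"
proof (cases "\<alpha> \<le> \<beta>")
  case True
  have "sqnorm {\<alpha>..\<beta>} Q \<le> integral {\<alpha>..\<beta>} (\<lambda>y. B / h)"
    using assms by (intro integral_le) (auto intro!: integrable_continuous_real continuous_intros simp: field_simps)
  also have "\<dots> = B / h * (\<beta> - \<alpha>)" using True by simp
  also have "\<dots> \<le> B / h * h" using assms by (intro mult_left_mono) auto
  finally show ?thesis using assms by simp
qed (use assms in auto)

text \<open>\<open>\<Phi>\<close> is a spline on the cells \<open>p, \<dots>, q - 1\<close> and \<open>\<rho> - \<Phi>\<close> is orthogonal to the splines that vanish
outside these cells. The test splines have to join zero smoothly at the end nodes \<open>x p\<close> and \<open>x q\<close>,
whereas \<open>\<Phi>\<close> may end there with any values; this asymmetry is what lets the equation pass to subranges.\<close>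

definition local_galerkin_equation :: "nat \<Rightarrow> nat \<Rightarrow> real \<Rightarrow> (nat \<Rightarrow> real) \<Rightarrow> real \<Rightarrow> nat \<Rightarrow> nat \<Rightarrow>
    (nat \<Rightarrow> real poly) \<Rightarrow> (real \<Rightarrow> real) \<Rightarrow> bool" where
  "local_galerkin_equation n \<mu> \<delta> x h p q \<Phi> \<rho> \<longleftrightarrow>
     0 < h \<and>
     (\<forall>i\<in>{p..<q}. \<delta> * h \<le> x (i + 1) - x i \<and> x (i + 1) - x i \<le> h) \<and>
     (\<forall>i. degree (\<Phi> i) \<le> n) \<and>
     (\<forall>i\<in>{p<..<q}. joined x \<mu> \<Phi> i) \<and>
     (\<forall>i\<in>{p..<q}. continuous_on (cell x i) \<rho>) \<and>
     (\<forall>Q. (\<forall>i. degree (Q i) \<le> n) \<longrightarrow> (\<forall>i. i < p \<or> q \<le> i \<longrightarrow> Q i = 0) \<longrightarrow>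
          (\<forall>i\<in>{p..q}. joined x \<mu> Q i) \<longrightarrow>
          (\<Sum>i\<in>{p..<q}. integral (cell x i) (\<lambda>y. (\<rho> y - poly (\<Phi> i) y) * poly (Q i) y)) = 0)"

lemma local_galerkin_equationD:
  assumes "local_galerkin_equation n \<mu> \<delta> x h p q \<Phi> \<rho>"
  shows "0 < h" "i \<in> {p..<q} \<Longrightarrow> \<delta> * h \<le> x (i + 1) - x i \<and> x (i + 1) - x i \<le> h"
    "degree (\<Phi> i) \<le> n" "i \<in> {p<..<q} \<Longrightarrow> joined x \<mu> \<Phi> i"
    "i \<in> {p..<q} \<Longrightarrow> continuous_on (cell x i) \<rho>"
  using assms unfolding local_galerkin_equation_def by blast+

lemma local_galerkin_equation_orthogonality:
  assumes "local_galerkin_equation n \<mu> \<delta> x h p q \<Phi> \<rho>"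
    and "\<And>i. degree (Q i) \<le> n" "\<And>i. i < p \<or> q \<le> i \<Longrightarrow> Q i = 0"
    and "\<And>i. i \<in> {p..q} \<Longrightarrow> joined x \<mu> Q i"
  shows "(\<Sum>i\<in>{p..<q}. integral (cell x i) (\<lambda>y. (\<rho> y - poly (\<Phi> i) y) * poly (Q i) y)) = 0"
  using assms unfolding local_galerkin_equation_def by blast

lemma local_galerkin_equation_subrange:
  assumes eq: "local_galerkin_equation n \<mu> \<delta> x h p q \<Phi> \<rho>" and pq: "p \<le> p'" "q' \<le> q"
  shows "local_galerkin_equation n \<mu> \<delta> x h p' q' \<Phi> \<rho>"
  unfolding local_galerkin_equation_def
proof (intro conjI allI ballI impI)
  fix Q :: "nat \<Rightarrow> real poly"
  assume Q: "\<forall>i. degree (Q i) \<le> n" "\<forall>i. i < p' \<or> q' \<le> i \<longrightarrow> Q i = 0"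
    "\<forall>i\<in>{p'..q'}. joined x \<mu> Q i"
  have "(\<Sum>i\<in>{p'..<q'}. integral (cell x i) (\<lambda>y. (\<rho> y - poly (\<Phi> i) y) * poly (Q i) y)) =
     (\<Sum>i\<in>{p..<q}. integral (cell x i) (\<lambda>y. (\<rho> y - poly (\<Phi> i) y) * poly (Q i) y))"
    using pq Q(2) by (intro sum.mono_neutral_left) auto
  also have "\<dots> = 0"
  proof (rule local_galerkin_equation_orthogonality[OF eq])
    fix i
    show "degree (Q i) \<le> n" using Q(1) by blast
    show "Q i = 0" if "i < p \<or> q \<le> i" using that Q(2) pq by auto
    show "joined x \<mu> Q i"
    proof (cases "i \<in> {p'..q'}")
      case True
      thus ?thesis using Q(3) by blast
    next
      case False
      hence "Q i = 0" "Q (i - 1) = 0" using Q(2) by auto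
      thus ?thesis by simp
    qed
  qed
  finally show "(\<Sum>i\<in>{p'..<q'}. integral (cell x i) (\<lambda>y. (\<rho> y - poly (\<Phi> i) y) * poly (Q i) y)) = 0" .
qed (use local_galerkin_equationD[OF eq] pq in auto)

text \<open>A Caccioppoli inequality. Test with \<open>\<Phi>\<close> cut off near both ends of the range. On the inner cells the
test function is \<open>\<Phi>\<close>, which produces the inner energy; on the \<open>n + 1\<close> cells at either end it is
controlled by the energy of \<open>\<Phi>\<close> on those cells alone.\<close>

lemma energy_step:
  fixes n \<mu> :: nat and \<delta> :: real
  assumes \<delta>: "0 < \<delta>" and \<mu>: "\<mu> \<le> n"
  obtains K where "0 < K"
    "\<And>x h \<Phi> \<rho> p q. 1 \<le> p \<Longrightarrow> p + 2 * (n + 1) \<le> q \<Longrightarrow> local_galerkin_equation n \<mu> \<delta> x h p q \<Phi> \<rho> \<Longrightarrow>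
       energy x \<Phi> (p + (n + 1)) (q - (n + 1)) \<le>
         K * (energy x \<Phi> p q - energy x \<Phi> (p + (n + 1)) (q - (n + 1))) +
         (\<Sum>i\<in>{p..<q}. integral (cell x i) (\<lambda>y. (\<rho> y)\<^sup>2))"
proof -
  obtain K0 where K0: "0 < K0" and cutoff: "cutoff_constant n \<delta> K0"
    by (rule spline_cutoff[OF \<delta>])
  define k where "k = n + 1"
  define K1 where "K1 = 2 + 2 * real k * K0"
  have K1: "K1 > 0" using K0 by (simp add: K1_def add_pos_nonneg)
  have main: "energy x \<Phi> (p + k) (q - k) \<le>
        (2 * K1 + 1) * (energy x \<Phi> p q - energy x \<Phi> (p + k) (q - k)) +
        (\<Sum>i\<in>{p..<q}. integral (cell x i) (\<lambda>y. (\<rho> y)\<^sup>2))"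
    if p: "1 \<le> p" and pq: "p + 2 * k \<le> q" and eq: "local_galerkin_equation n \<mu> \<delta> x h p q \<Phi> \<rho>"
    for x :: "nat \<Rightarrow> real" and h \<Phi> \<rho> p q
  proof -
    note h = local_galerkin_equationD(1)[OF eq] and x = local_galerkin_equationD(2)[OF eq]
      and \<Phi> = local_galerkin_equationD(4)[OF eq] and \<rho> = local_galerkin_equationD(5)[OF eq]
    have deg: "\<forall>i. degree (\<Phi> i) \<le> n" using local_galerkin_equationD(3)[OF eq] by blast
    define I where "I i = sqnorm (cell x i) (\<Phi> i)" for i
    have I0: "I i \<ge> 0" for i unfolding I_def by (rule integral_square_poly_nonneg)
    have "\<forall>i\<in>{p..p + n}. \<delta> * h \<le> x (i + 1) - x i \<and> x (i + 1) - x i \<le> h"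
      using x pq by (auto simp: k_def)
    from cutoff[unfolded cutoff_constant_def, THEN spec, THEN spec, THEN spec, THEN spec, THEN mp, THEN mp, THEN mp, THEN mp, OF h p deg this]
    obtain \<Psi>1 where \<Psi>1: "\<forall>i<p. \<Psi>1 i = 0" "\<forall>i\<ge>p + n. \<Psi>1 i = \<Phi> i" "\<forall>i. degree (\<Psi>1 i) \<le> n"
       "\<forall>i\<in>{p..p + n}. joined x n \<Psi>1 i"
       "\<forall>i\<in>{p..p + n}. \<forall>y\<in>cell x i. (poly (\<Psi>1 i) y)\<^sup>2 * h \<le> K0 * I (p + n)"
      by (elim exE conjE) (rule that; (assumption | unfold I_def, assumption))
    have qk: "1 \<le> q - k" "q - k + n = q - 1" "q - k + n + 1 = q" "p + k \<le> q - k" using pq p by (auto simp: k_def)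
    have "\<forall>i\<in>{q - k..q - k + n}. \<delta> * h \<le> x (i + 1) - x i \<and> x (i + 1) - x i \<le> h"
      using x pq qk by (auto simp: k_def)
    from cutoff[unfolded cutoff_constant_def, THEN spec, THEN spec, THEN spec, THEN spec, THEN mp, THEN mp, THEN mp, THEN mp, OF h qk(1) deg this]
    obtain \<Psi>2 where \<Psi>2: "\<forall>i<q - k. \<Psi>2 i = 0" "\<forall>i\<ge>q - k + n. \<Psi>2 i = \<Phi> i" "\<forall>i. degree (\<Psi>2 i) \<le> n"
       "\<forall>i\<in>{q - k..q - k + n}. joined x n \<Psi>2 i"
       "\<forall>i\<in>{q - k..q - k + n}. \<forall>y\<in>cell x i. (poly (\<Psi>2 i) y)\<^sup>2 * h \<le> K0 * I (q - k + n)"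
      by (elim exE conjE) (rule that; (assumption | unfold I_def, assumption))
    \<comment> \<open>Subtracting from \<open>\<Phi>\<close> its cutoff at the right end leaves a function that vanishes beyond that end.\<close>
    define Q where "Q i = \<Psi>1 i - \<Psi>2 i" for i
    have Qdeg: "\<forall>i. degree (Q i) \<le> n" using \<Psi>1(3) \<Psi>2(3) by (auto simp: Q_def intro: degree_diff_le)
    have Qin: "Q i = \<Phi> i" if "i \<in> {p + k..<q - k}" for i
      using that \<Psi>1(2) \<Psi>2(1) by (auto simp: Q_def k_def)
    have Qout: "\<forall>i. i < p \<or> q \<le> i \<longrightarrow> Q i = 0"
      using \<Psi>1(1,2) \<Psi>2(1,2) qk by (auto simp: Q_def k_def)
    have d1: "joined x \<mu> \<Psi>1 i" if "i \<in> {p..<q}" for i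
    proof (cases "i \<le> p + n")
      case True
      hence "joined x n \<Psi>1 i" using \<Psi>1(4) that by simp
      thus ?thesis using \<mu> by (meson dvd_trans le_imp_power_dvd)
    next
      case False
      have "p + n \<le> i - 1" "i \<in> {p<..<q}" using False that by auto
      thus ?thesis using \<Phi>[of i] \<Psi>1(2)[rule_format, of i] \<Psi>1(2)[rule_format, of "i - 1"] by simp
    qed
    have d2: "joined x \<mu> \<Psi>2 i" if "i \<in> {p..<q}" for i
    proof (cases "i < q - k")
      case False
      hence "joined x n \<Psi>2 i" using \<Psi>2(4) that qk by auto
      thus ?thesis using \<mu> by (meson dvd_trans le_imp_power_dvd)
    next
      case True
      thus ?thesis using \<Psi>2(1) by simp
    qed
    have Qdvd: "\<forall>i\<in>{p..q}. joined x \<mu> Q i"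
    proof
      fix i assume i: "i \<in> {p..q}"
      show "joined x \<mu> Q i"
      proof (cases "i = q")
        case True
        have "Q (q - 1) = 0" using \<Psi>1(2)[rule_format, of "q - 1"] \<Psi>2(2)[rule_format, of "q - 1"] qk pq
          by (simp add: Q_def k_def)
        thus ?thesis using True Qout by simp
      next
        case False
        hence "[:- x i, 1:] ^ \<mu> dvd (\<Psi>1 i - \<Psi>1 (i - 1)) - (\<Psi>2 i - \<Psi>2 (i - 1))"
          using i by (intro dvd_diff[OF d1 d2]) auto
        thus ?thesis by (simp add: Q_def algebra_simps)
      qed
    qed
    define G where "G i = integral (cell x i) (\<lambda>y. (\<rho> y - poly (\<Phi> i) y) * poly (Q i) y)" for i
    define R where "R i = integral (cell x i) (\<lambda>y. (\<rho> y)\<^sup>2)" for i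
    define T where "T i = sqnorm (cell x i) (Q i)" for i
    have sumG: "(\<Sum>i\<in>{p..<q}. G i) = 0" unfolding G_def 
      by (rule local_galerkin_equation_orthogonality[OF eq]) (use Qdeg Qout Qdvd in blast)+
    have T1: "T i \<le> K0 * I (p + n)" if "i \<in> {p..<p + k}" for i
    proof -
      have "Q i = \<Psi>1 i" using that qk \<Psi>2(1) by (simp add: Q_def)
      thus ?thesis unfolding T_def using \<Psi>1(5) that h x[of i] pq K0 I0
        by (intro integral_square_le_sup) (auto simp: k_def)
    qed
    have T2: "T i \<le> 2 * I i + 2 * (K0 * I (q - 1))" if "i \<in> {q - k..<q}" for i
    proof -
      have Qi: "Q i = \<Phi> i - \<Psi>2 i" using that qk \<Psi>1(2) by (simp add: Q_def k_def)
      have b: "sqnorm (cell x i) (\<Psi>2 i) \<le> K0 * I (q - 1)"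
        using \<Psi>2(5) that h x[of i] pq K0 I0 qk
        by (intro integral_square_le_sup) auto
      have "T i \<le> integral (cell x i) (\<lambda>y. 2 * (poly (\<Phi> i) y)\<^sup>2 + 2 * (poly (\<Psi>2 i) y)\<^sup>2)"
        unfolding T_def Qi
      proof (intro integral_le integrable_continuous_real continuous_intros)
        fix y
        have "0 \<le> (poly (\<Phi> i) y + poly (\<Psi>2 i) y)\<^sup>2" by simp
        thus "(poly (\<Phi> i - \<Psi>2 i) y)\<^sup>2 \<le> 2 * (poly (\<Phi> i) y)\<^sup>2 + 2 * (poly (\<Psi>2 i) y)\<^sup>2"
          by (simp add: power2_eq_square algebra_simps)
      qed
      also have "\<dots> = 2 * I i + 2 * sqnorm (cell x i) (\<Psi>2 i)"
        unfolding I_def by (subst integral_add) (auto intro!: integrable_continuous_real continuous_intros)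
      finally show ?thesis using b by linarith
    qed
    have split: "(\<Sum>i\<in>{p..<q}. f i) = (\<Sum>i\<in>{p..<p + k}. f i) + (\<Sum>i\<in>{p + k..<q - k}. f i) + (\<Sum>i\<in>{q - k..<q}. f i)" for f :: "nat \<Rightarrow> real"
      using qk by (simp add: sum.atLeastLessThan_concat)
    define A where "A = (\<Sum>i\<in>{p + k..<q - k}. I i)"
    define S1 where "S1 = (\<Sum>i\<in>{p..<p + k}. I i)"
    define S2 where "S2 = (\<Sum>i\<in>{q - k..<q}. I i)"
    have S1: "I (p + n) \<le> S1" unfolding S1_def by (rule member_le_sum) (auto simp: k_def I0)
    have S2: "I (q - 1) \<le> S2" unfolding S2_def by (rule member_le_sum) (use pq in \<open>auto simp: k_def I0\<close>)
    have T1s: "(\<Sum>i\<in>{p..<p + k}. T i) \<le> K1 * S1"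
    proof -
      have "(\<Sum>i\<in>{p..<p + k}. T i) \<le> (\<Sum>i\<in>{p..<p + k}. K0 * S1)"
        using K0 S1 by (intro sum_mono order_trans[OF T1] mult_left_mono) auto
      also have "\<dots> = real k * K0 * S1" by simp
      also have "\<dots> \<le> K1 * S1" using K0 S1 I0[of "p + n"] by (intro mult_right_mono) (auto simp: K1_def add_increasing)
      finally show ?thesis .
    qed
    have T2s: "(\<Sum>i\<in>{q - k..<q}. T i) \<le> K1 * S2"
    proof -
      have "(\<Sum>i\<in>{q - k..<q}. T i) \<le> (\<Sum>i\<in>{q - k..<q}. 2 * I i + 2 * (K0 * S2))"
        using K0 S2 by (intro sum_mono order_trans[OF T2] add_mono mult_left_mono) auto
      also have "\<dots> = 2 * S2 + real k * (2 * (K0 * S2))"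
        using pq by (simp add: sum.distrib S2_def sum_distrib_left)
      finally show ?thesis by (simp add: K1_def algebra_simps)
    qed
    have GRT: "G i \<le> 1/2 * R i + T i + 1/2 * I i" if "i \<in> {p..<q}" for i
      unfolding G_def R_def I_def T_def by (rule element_estimate(1)[OF \<rho>[OF that]])
    have "0 = (\<Sum>i\<in>{p..<p + k}. G i) + (\<Sum>i\<in>{p + k..<q - k}. G i) + (\<Sum>i\<in>{q - k..<q}. G i)"
      using sumG split[of G] by simp
    also have "\<dots> \<le> (\<Sum>i\<in>{p..<p + k}. 1/2 * R i + T i + 1/2 * I i) + (\<Sum>i\<in>{p + k..<q - k}. 1/2 * R i - 1/2 * I i)
         + (\<Sum>i\<in>{q - k..<q}. 1/2 * R i + T i + 1/2 * I i)"
    proof (intro add_mono sum_mono)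
      fix i assume i: "i \<in> {p + k..<q - k}"
      show "G i \<le> 1/2 * R i - 1/2 * I i" unfolding G_def R_def I_def Qin[OF i]
        by (rule element_estimate(2)[OF \<rho>]) (use i in auto)
    next
      fix i assume "i \<in> {p..<p + k}"
      hence "i \<in> {p..<q}" using pq by auto
      thus "G i \<le> 1/2 * R i + T i + 1/2 * I i" by (rule GRT)
    next
      fix i assume "i \<in> {q - k..<q}"
      hence "i \<in> {p..<q}" using pq by auto
      thus "G i \<le> 1/2 * R i + T i + 1/2 * I i" by (rule GRT)
    qed
    also have "\<dots> = 1/2 * (\<Sum>i\<in>{p..<q}. R i) + (\<Sum>i\<in>{p..<p + k}. T i) + (\<Sum>i\<in>{q - k..<q}. T i) + 1/2 * S1 + 1/2 * S2 - 1/2 * A"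
      unfolding split[of R] S1_def S2_def A_def by (simp add: sum.distrib sum_subtractf add_divide_distrib flip: sum_divide_distrib)
    finally have "A \<le> (\<Sum>i\<in>{p..<q}. R i) + (2 * K1 + 1) * (S1 + S2)"
      using T1s T2s by (simp add: algebra_simps)
    moreover have "energy x \<Phi> (p + k) (q - k) = A" by (simp add: energy_def A_def I_def)
    moreover have "energy x \<Phi> p q = S1 + A + S2"
      unfolding energy_def using split[of I] by (simp add: I_def S1_def A_def S2_def)
    ultimately show ?thesis by (simp add: R_def)
  qed
  show ?thesis
    by (rule that[of "2 * K1 + 1"]) (use K1 main in \<open>simp_all add: k_def\<close>)
qed

text \<open>The regions are \<open>{x (p - l)..x (q + l)}\<close>. The innermost one has at most two cells, and \<open>x0\<close> lies
within distance \<open>h\<close> of all its points; \<open>\<rho>\<close> vanishes at \<open>x0\<close> to order \<open>n + 2\<close>, whence the power \<open>2 (n + 2) + 1\<close> of \<open>h\<close>.\<close>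

definition decay_constants :: "nat \<Rightarrow> nat \<Rightarrow> real \<Rightarrow> nat \<Rightarrow> real \<Rightarrow> real \<Rightarrow> bool" where
  "decay_constants n \<mu> \<delta> l0 \<theta> C \<longleftrightarrow>
     (\<forall>x h x0 \<Phi> \<rho> M p q J m. J < p \<longrightarrow> p \<le> q \<longrightarrow> q \<le> p + 2 \<longrightarrow>
        local_galerkin_equation n \<mu> \<delta> x h (p - J) (q + J) \<Phi> \<rho> \<longrightarrow>
        (\<forall>l\<le>J. \<forall>y\<in>{x (p - l)..x (q + l)}. \<bar>y - x0\<bar> \<le> real (l + 1) * h) \<longrightarrow>
        (\<forall>i\<in>{p - J..<q + J}. \<forall>y\<in>cell x i. \<bar>\<rho> y\<bar> \<le> M * \<bar>y - x0\<bar> ^ (n + 2)) \<longrightarrow>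
        0 \<le> M \<longrightarrow> l0 + m * (n + 1) \<le> J \<longrightarrow>
        energy x \<Phi> (p - l0) (q + l0) \<le>
          \<theta> ^ m * energy x \<Phi> (p - J) (q + J) + C * M\<^sup>2 * h ^ (2 * n + 5))"

text \<open>Hole filling, with \<open>k = n + 1\<close> and \<open>F\<^sub>l\<close> the energy on the region \<open>l\<close>: \<open>F\<^sub>l \<le> K (F\<^sub>l\<^sub>+\<^sub>k - F\<^sub>l) + R\<close> gives \<open>F\<^sub>l \<le> \<theta> F\<^sub>l\<^sub>+\<^sub>k + R\<close> with \<open>\<theta> = K / (1 + K)\<close>. The sources grow
only like \<open>l\<^bsup>2n + 5\<^esup>\<close>, so their geometrically weighted sum is bounded independently of the number of
steps.\<close>

lemma local_decay:
  fixes n \<mu> l0 :: nat and \<delta> :: real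
  assumes \<delta>: "0 < \<delta>" and \<mu>: "\<mu> \<le> n"
  obtains \<theta> C where "0 < \<theta>" "\<theta> < 1" "0 < C" "decay_constants n \<mu> \<delta> l0 \<theta> C"
proof -
  obtain K where K: "0 < K" and step: "\<And>x h \<Phi> \<rho> p q. 1 \<le> p \<Longrightarrow> p + 2 * (n + 1) \<le> q \<Longrightarrow>
       local_galerkin_equation n \<mu> \<delta> x h p q \<Phi> \<rho> \<Longrightarrow>
       energy x \<Phi> (p + (n + 1)) (q - (n + 1)) \<le>
         K * (energy x \<Phi> p q - energy x \<Phi> (p + (n + 1)) (q - (n + 1))) +
         (\<Sum>i\<in>{p..<q}. integral (cell x i) (\<lambda>y. (\<rho> y)\<^sup>2))"
    using energy_step[OF \<delta> \<mu>] by blast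
  define k where "k = n + 1"
  define \<theta> where "\<theta> = K / (1 + K)"
  have \<theta>: "0 < \<theta>" "\<theta> < 1" using K by (auto simp: \<theta>_def)
  from geometric_decay[OF \<theta>, of k "2 * n + 5" l0] obtain S where S: "S > 0 \<and> (\<forall>F B J m. 0 \<le> B \<longrightarrow>
           (\<forall>l. l + k \<le> J \<longrightarrow> F l \<le> \<theta> * F (l + k) + B * real (l + k + 1) ^ (2 * n + 5)) \<longrightarrow>
           l0 + m * k \<le> J \<longrightarrow> F l0 \<le> \<theta> ^ m * F (l0 + m * k) + B * S)" ..
  have main: "energy x \<Phi> (p - l0) (q + l0) \<le> \<theta> ^ m * energy x \<Phi> (p - J) (q + J) + (2 * S) * M\<^sup>2 * h ^ (2 * n + 5)"
    if J: "J < p" and pq: "p \<le> q" "q \<le> p + 2"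
      and eq: "local_galerkin_equation n \<mu> \<delta> x h (p - J) (q + J) \<Phi> \<rho>"
      and dist: "\<forall>l\<le>J. \<forall>y\<in>{x (p - l)..x (q + l)}. \<bar>y - x0\<bar> \<le> real (l + 1) * h"
      and \<rho>: "\<forall>i\<in>{p - J..<q + J}. \<forall>y\<in>cell x i. \<bar>\<rho> y\<bar> \<le> M * \<bar>y - x0\<bar> ^ (n + 2)"
      and M: "0 \<le> M" and m: "l0 + m * (n + 1) \<le> J"
    for x h x0 \<Phi> \<rho> M p q J m
  proof -
    note h = local_galerkin_equationD(1)[OF eq] and x = local_galerkin_equationD(2)[OF eq]
      and \<rho>_cont = local_galerkin_equationD(5)[OF eq]
    define F where "F l = energy x \<Phi> (p - l) (q + l)" for l
    define B where "B = 2 * M\<^sup>2 * h ^ (2 * n + 5)"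
    have B: "B \<ge> 0" using h by (simp add: B_def)
    have xmono: "x i \<le> x j" if "i \<le> j" "p - J \<le> i" "j \<le> q + J" for i j
      using that
    proof (induction j)
      case (Suc j)
      show ?case
      proof (cases "i = Suc j")
        case False
        hence "x i \<le> x j" using Suc by simp
        moreover have "0 < \<delta> * h" using \<delta> h by simp
        moreover have "\<delta> * h \<le> x (j + 1) - x j" using x[of j] Suc.prems False by auto
        ultimately show ?thesis by simp
      qed simp
    qed simp
    have F_step: "F l \<le> \<theta> * F (l + k) + B * real (l + k + 1) ^ (2 * n + 5)" if l: "l + k \<le> J" for l
    proof -
      define p' where "p' = p - (l + k)"
      define q' where "q' = q + (l + k)"
      have p': "1 \<le> p'" "p' + 2 * (n + 1) \<le> q'" "p - J \<le> p'" "q' \<le> q + J"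
        using J l pq by (auto simp: p'_def q'_def k_def)
      have ends: "p' + (n + 1) = p - l" "q' - (n + 1) = q + l"
        using J l pq by (auto simp: p'_def q'_def k_def)
      define R where "R = (\<Sum>i\<in>{p'..<q'}. integral (cell x i) (\<lambda>y. (\<rho> y)\<^sup>2))"
      have "energy x \<Phi> (p' + (n + 1)) (q' - (n + 1)) \<le>
        K * (energy x \<Phi> p' q' - energy x \<Phi> (p' + (n + 1)) (q' - (n + 1))) + R"
        unfolding R_def
        by (rule step[OF p'(1,2) local_galerkin_equation_subrange[OF eq p'(3,4)]])
      hence "F l \<le> K * (F (l + k) - F l) + R"
        unfolding ends by (simp add: F_def p'_def q'_def)
      hence "F l * (1 + K) \<le> K * F (l + k) + R" by (simp add: algebra_simps)
      hence "F l \<le> (K * F (l + k) + R) / (1 + K)" using K by (simp add: field_simps)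
      also have "\<dots> = \<theta> * F (l + k) + R / (1 + K)" by (simp add: \<theta>_def add_divide_distrib)
      also have "R / (1 + K) \<le> B * real (l + k + 1) ^ (2 * n + 5)"
      proof -
        have el: "integral (cell x i) (\<lambda>y. (\<rho> y)\<^sup>2) \<le> (M * (real (l + k + 1) * h) ^ (n + 2))\<^sup>2 * h"
          if i: "i \<in> {p'..<q'}" for i
        proof -
          have iJ: "i \<in> {p - J..<q + J}" using i p' by auto
          have xi: "x i \<le> x (i + 1)" "x (i + 1) - x i \<le> h" using xmono[of i "i + 1"] x[OF iJ] iJ by auto
          have "integral (cell x i) (\<lambda>y. (\<rho> y)\<^sup>2) \<le> integral (cell x i) (\<lambda>y. (M * (real (l + k + 1) * h) ^ (n + 2))\<^sup>2)"
          proof (intro integral_le integrable_continuous_real continuous_intros)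
            show "continuous_on (cell x i) \<rho>" using \<rho>_cont iJ by blast
            fix y assume y: "y \<in> cell x i"
            have "x p' \<le> x i" "x (i + 1) \<le> x q'" using i p' by (auto intro!: xmono)
            hence "\<bar>y - x0\<bar> \<le> real (l + k + 1) * h" using y dist l by (auto simp: p'_def q'_def)
            moreover have "\<bar>\<rho> y\<bar> \<le> M * \<bar>y - x0\<bar> ^ (n + 2)" using \<rho> iJ y by blast
            ultimately have "\<bar>\<rho> y\<bar> \<le> M * (real (l + k + 1) * h) ^ (n + 2)"
              using M by (meson order_trans mult_left_mono power_mono abs_ge_zero)
            hence "\<bar>\<rho> y\<bar>\<^sup>2 \<le> (M * (real (l + k + 1) * h) ^ (n + 2))\<^sup>2" by (intro power_mono) auto
            thus "(\<rho> y)\<^sup>2 \<le> (M * (real (l + k + 1) * h) ^ (n + 2))\<^sup>2" by simp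
          qed
          also have "\<dots> = (M * (real (l + k + 1) * h) ^ (n + 2))\<^sup>2 * (x (i + 1) - x i)" using xi by (simp add: mult.commute)
          also have "\<dots> \<le> (M * (real (l + k + 1) * h) ^ (n + 2))\<^sup>2 * h" using xi by (intro mult_left_mono) auto
          finally show ?thesis .
        qed
        have "R \<le> (\<Sum>i\<in>{p'..<q'}. (M * (real (l + k + 1) * h) ^ (n + 2))\<^sup>2 * h)"
          unfolding R_def by (rule sum_mono[OF el])
        also have "\<dots> = real (q' - p') * ((M * (real (l + k + 1) * h) ^ (n + 2))\<^sup>2 * h)" by simp
        also have "\<dots> \<le> (2 * real (l + k + 1)) * ((M * (real (l + k + 1) * h) ^ (n + 2))\<^sup>2 * h)"
        proof (rule mult_right_mono)
          have "q' - p' \<le> 2 * (l + k + 1)" using pq J l by (auto simp: q'_def p'_def)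
          hence "real (q' - p') \<le> real (2 * (l + k + 1))" by (rule of_nat_mono)
          thus "real (q' - p') \<le> 2 * real (l + k + 1)" by simp
        qed (use h in simp)
        also have "\<dots> = B * real (l + k + 1) ^ (2 * n + 5)"
        proof -
          have "2 * n + 5 = (n + 2) * 2 + 1" by simp
          thus ?thesis unfolding B_def by (simp only: power_mult_distrib power_add power_mult power_one_right) (simp add: mult_ac)
        qed
        finally have R: "R \<le> B * real (l + k + 1) ^ (2 * n + 5)" .
        have "R \<ge> 0" unfolding R_def using p'
          by (intro sum_nonneg integral_nonneg integrable_continuous_real continuous_intros \<rho>_cont) auto
        hence "R / (1 + K) \<le> R / 1" using K by (intro divide_left_mono) auto
        thus ?thesis using R by simp
      qed
      finally show ?thesis by simp
    qed
    have "F l0 \<le> \<theta> ^ m * F (l0 + m * k) + B * S"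
    proof (rule conjunct2[OF S, THEN spec, THEN spec, THEN spec, THEN spec, THEN mp, THEN mp, THEN mp])
      show "\<forall>l. l + k \<le> J \<longrightarrow> F l \<le> \<theta> * F (l + k) + B * real (l + k + 1) ^ (2 * n + 5)"
        using F_step by blast
    qed (use B m in \<open>auto simp: k_def\<close>)
    also have "\<dots> \<le> \<theta> ^ m * F J + B * S"
      using m \<theta> by (intro add_right_mono mult_left_mono) (auto simp: F_def k_def intro!: energy_mono)
    finally show ?thesis by (simp add: F_def B_def mult_ac)
  qed
  have "decay_constants n \<mu> \<delta> l0 \<theta> (2 * S)"
    unfolding decay_constants_def by (intro allI impI; rule main; assumption)
  moreover have "0 < 2 * S" using S by simp
  ultimately show ?thesis using that \<theta> by blast
qed

text \<open>With \<open>J\<close> the integer part of \<open>C\<^sup>* \<bar>ln h\<bar>\<close> about \<open>C\<^sup>* \<bar>ln h\<bar> / k\<close> decay steps fit into the patch beyond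
the innermost \<open>k\<close> cells. Rounding costs at most three steps, which the factor \<open>\<theta>\<^bsup>-3\<^esup>\<close> absorbs.\<close>

lemma decay_rate:
  fixes \<theta> Cs h :: real and k :: nat
  assumes \<theta>: "0 < \<theta>" "\<theta> < 1" and k: "1 \<le> k" and h: "0 < h" "h < exp (- (real k + 1))"
    and Cs: "real k * (2 * real k + 3) / (- ln \<theta>) + 1 \<le> Cs"
  obtains J n where "real J * h \<le> Cs * h * \<bar>ln h\<bar>" "k + n * k \<le> J" "\<theta> ^ n \<le> (1 / \<theta>) ^ 3 * h ^ (2 * k + 3)"
proof -
  define L where "L = - ln h"
  have L: "real k + 1 < L" using h ln_less_cancel_iff[of h "exp (- (real k + 1))"] by (simp add: L_def)
  have aL: "\<bar>ln h\<bar> = L" using L by (simp add: L_def)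
  have lt: "0 < - ln \<theta>" using \<theta> by simp
  have "0 \<le> real k * (2 * real k + 3) / (- ln \<theta>)"
    using lt by (intro divide_nonneg_pos mult_nonneg_nonneg) linarith+
  hence Cs1: "1 \<le> Cs" using Cs by linarith
  have CL: "L \<le> Cs * L" using Cs1 L by (simp add: mult_le_cancel_right1)
  define J where "J = nat \<lfloor>Cs * L\<rfloor>"
  have J: "real J \<le> Cs * L" "Cs * L - 1 < real J" using CL L by (auto simp: J_def)
  have Jk: "k \<le> J"
  proof -
    have "real k < real J" using J CL L by linarith
    thus ?thesis by simp
  qed
  define n where "n = (J - k) div k"
  have "n * k \<le> J - k" by (simp add: n_def)
  hence n1: "k + n * k \<le> J" using Jk by simp
  have "J - k = n * k + (J - k) mod k" by (simp add: n_def)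
  moreover have "(J - k) mod k < k" using k by simp
  ultimately have "J - k < n * k + k" by linarith
  hence "J < (n + 2) * k" using Jk by simp
  hence "real J < real ((n + 2) * k)" by (simp only: of_nat_less_iff)
  hence n2: "Cs * L - 1 < (real n + 2) * real k" using J by (simp add: algebra_simps)
  have n3: "Cs * L < (real n + 3) * real k" using n2 k by (simp add: algebra_simps)
  have "real k * (2 * real k + 3) \<le> Cs * (- ln \<theta>)"
    using Cs lt by (simp add: field_simps)
  hence "real k * (2 * real k + 3) * L \<le> Cs * (- ln \<theta>) * L" using L by (intro mult_right_mono) auto
  also have "\<dots> = (- ln \<theta>) * (Cs * L)" by simp
  also have "\<dots> \<le> (- ln \<theta>) * ((real n + 3) * real k)" using n3 lt by (intro mult_left_mono) auto
  finally have "real k * ((2 * real k + 3) * L) \<le> real k * ((- ln \<theta>) * (real n + 3))" by (simp add: mult_ac)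
  hence "(2 * real k + 3) * L \<le> (- ln \<theta>) * (real n + 3)"
    by (rule mult_left_le_imp_le) (use k in simp)
  hence "ln \<theta> * real (n + 3) \<le> ln h * real (2 * k + 3)" by (simp add: L_def algebra_simps)
  hence "exp (ln \<theta> * real (n + 3)) \<le> exp (ln h * real (2 * k + 3))" by simp
  hence "\<theta> ^ (n + 3) \<le> h ^ (2 * k + 3)"
    using \<theta> h by (simp only: exp_of_nat2_mult exp_ln)
  hence "\<theta> ^ n \<le> (1 / \<theta>) ^ 3 * h ^ (2 * k + 3)"
    using \<theta> by (simp add: power_add field_simps)
  moreover have "real J * h \<le> Cs * h * \<bar>ln h\<bar>"
  proof -
    have "real J * h \<le> (Cs * L) * h" using J h by (intro mult_right_mono) auto
    thus ?thesis unfolding aL by (simp add: mult_ac)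
  qed
  ultimately show ?thesis using n1 that by blast
qed

section \<open>Piecewise polynomials and their smoothness\<close>

lemma mesh_less:
  assumes "mesh a b N x" "1 \<le> i" "i < j" "j \<le> N + 1"
  shows "x i < x j"
  using assms(3,4)
proof (induction j)
  case (Suc j)
  hence "x j < x (Suc j)" using assms(1,2) by (auto simp: mesh_def)
  thus ?case using Suc by (cases "i = j") auto
qed simp

lemma mesh_le:
  assumes "mesh a b N x" "1 \<le> i" "i \<le> j" "j \<le> N + 1"
  shows "x i \<le> x j"
  using mesh_less[OF assms(1,2), of j] assms by (cases "i = j") auto

lemma mesh_bounds:
  assumes "mesh a b N x" "1 \<le> i" "i \<le> N + 1"
  shows "x i \<in> {a..b}"
  using mesh_le[OF assms(1), of 1 i] mesh_le[OF assms(1), of i "N + 1"] assms by (auto simp: mesh_def)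

lemma mesh_elem_subset:
  assumes "mesh a b N x" "i \<in> {1..N}"
  shows "cell x i \<subseteq> {a..b}"
  using mesh_bounds[OF assms(1), of i] mesh_bounds[OF assms(1), of "i + 1"] assms by auto

lemma dvd_pderiv_of_dvd:
  fixes r :: "real poly"
  assumes "[:- c, 1:] ^ Suc m dvd r"
  shows "[:- c, 1:] ^ m dvd pderiv r"
proof -
  obtain s where "r = [:- c, 1:] ^ Suc m * s" using assms by (auto elim: dvdE)
  hence "pderiv r = [:- c, 1:] ^ m * ([:- c, 1:] * pderiv s + smult (of_nat (Suc m)) s)"
    by (simp only: pderiv_mult pderiv_power_Suc) (simp add: pderiv_pCons algebra_simps)
  thus ?thesis by simp
qed

lemma dvd_of_dvd_pderiv:
  fixes r :: "real poly"
  assumes "poly r c = 0" "[:- c, 1:] ^ m dvd pderiv r"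
  shows "[:- c, 1:] ^ Suc m dvd r"
proof (cases "r = 0")
  case False
  have "pderiv r \<noteq> 0"
  proof
    assume "pderiv r = 0"
    then obtain h where "r = [:h:]" using pderiv_iszero by blast
    thus False using False assms(1) by simp
  qed
  moreover have "order c r = Suc (order c (pderiv r))" by (rule order_pderiv[OF False assms(1)])
  ultimately show ?thesis using assms(2) by (simp add: order_divides del: power_Suc)
qed simp

lemma poly_eq_0_of_power_dvd:
  fixes r :: "real poly"
  assumes "[:- c, 1:] ^ Suc m dvd r"
  shows "poly r c = 0"
  using assms by (auto elim!: dvdE)

text \<open>Written as a sum of truncated jumps, a piecewise polynomial is defined on the whole line, and
measurability, continuity and differentiability are inherited from the summands.\<close>

definition pw :: "(nat \<Rightarrow> real) \<Rightarrow> nat \<Rightarrow> (nat \<Rightarrow> real poly) \<Rightarrow> real \<Rightarrow> real" where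
  "pw x N P y = poly (P 1) y + (\<Sum>i\<in>{2..N}. if x i \<le> y then poly (P i - P (i - 1)) y else 0)"

lemma pw_on_elem:
  assumes "mesh a b N x" "j \<in> {1..N}" "y \<in> {x j..x (j + 1)}"
    and "j < N \<Longrightarrow> y = x (j + 1) \<Longrightarrow> poly (P (j + 1) - P j) y = 0"
  shows "pw x N P y = poly (P j) y"
proof -
  have "(\<Sum>i\<in>{2..N}. if x i \<le> y then poly (P i - P (i - 1)) y else 0)
      = (\<Sum>i\<in>{2..j}. poly (P i - P (i - 1)) y)"
  proof (rule sum.mono_neutral_cong_right)
    show "\<forall>i\<in>{2..N} - {2..j}. (if x i \<le> y then poly (P i - P (i - 1)) y else 0) = 0"
    proof
      fix i assume i: "i \<in> {2..N} - {2..j}"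
      show "(if x i \<le> y then poly (P i - P (i - 1)) y else 0) = 0"
      proof (cases "i = j + 1")
        case True
        thus ?thesis using assms i by auto
      next
        case False
        hence "x (j + 1) < x i" using i by (intro mesh_less[OF assms(1)]) auto
        thus ?thesis using assms(3) by auto
      qed
    qed
  next
    fix i assume i: "i \<in> {2..j}"
    hence "x i \<le> x j" using assms(2) by (intro mesh_le[OF assms(1)]) auto
    thus "(if x i \<le> y then poly (P i - P (i - 1)) y else 0) = poly (P i - P (i - 1)) y"
      using assms(3) by auto
  qed (use assms(2) in auto)
  also have "\<dots> = poly (P j) y - poly (P 1) y"
  proof -
    have "1 \<le> j" using assms(2) by simp
    thus ?thesis
    proof (induction j rule: dec_induct)
      case (step n)
      thus ?case by (simp add: numeral_2_eq_2)
    qed simp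
  qed
  finally show ?thesis by (simp add: pw_def)
qed

lemma pw_on_open_elem:
  assumes "mesh a b N x" "j \<in> {1..N}" "y \<in> {x j<..<x (j + 1)}"
  shows "pw x N P y = poly (P j) y"
  using assms by (intro pw_on_elem) auto

lemma pw_has_derivative_open_elem:
  assumes "mesh a b N x" "j \<in> {1..N}" "y \<in> {x j<..<x (j + 1)}"
  shows "(pw x N P has_real_derivative poly (pderiv (P j)) y) (at y)"
  by (rule has_field_derivative_transform_within_open[OF poly_DERIV open_greaterThanLessThan assms(3)])
     (simp add: pw_on_open_elem[OF assms(1,2)])

lemma pw_measurable [measurable]: "pw x N P \<in> borel_measurable borel"
proof -
  have [measurable]: "poly p \<in> borel_measurable borel" for p :: "real poly"
    by (intro borel_measurable_continuous_onI continuous_intros)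
  show ?thesis unfolding pw_def by measurable
qed

lemma truncated_poly_has_derivative:
  fixes r :: "real poly"
  assumes "poly r c = 0" "poly (pderiv r) c = 0"
  shows "((\<lambda>y. if c \<le> y then poly r y else 0) has_real_derivative
           (if c \<le> y then poly (pderiv r) y else 0)) (at y within S)"
proof -
  let ?f = "\<lambda>y. if c \<le> y then poly r y else 0"
  consider "y < c" | "y = c" | "c < y" by linarith
  hence "(?f has_real_derivative (if c \<le> y then poly (pderiv r) y else 0)) (at y)"
  proof cases
    case 1
    have "(?f has_real_derivative 0) (at y)"
      by (rule has_field_derivative_transform_within_open[of "\<lambda>_. 0" _ _ "{..<c}"]) (use 1 in auto)
    thus ?thesis using 1 by simp
  next
    case 3
    have "(?f has_real_derivative poly (pderiv r) y) (at y)"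
      by (rule has_field_derivative_transform_within_open[of "poly r" _ _ "{c<..}"]) (use 3 in auto)
    thus ?thesis using 3 by simp
  next
    case 2
    have "(?f has_real_derivative 0) (at c within {..c})"
      by (rule has_field_derivative_transform_within[of "\<lambda>_. 0" _ _ _ 1]) (use assms in auto)
    moreover have "(?f has_real_derivative 0) (at c within {c..})"
      by (rule has_field_derivative_transform_within[of "poly r" _ _ _ 1])
         (use assms poly_DERIV[of r c] in \<open>auto intro: has_field_derivative_at_within\<close>)
    ultimately have "(?f has_real_derivative 0) (at c within {..c} \<union> {c..})"
      unfolding has_field_derivative_iff unfolding at_within_union by (rule filterlim_sup)
    moreover have "{..c} \<union> {c..} = UNIV" by auto
    ultimately have "(?f has_real_derivative 0) (at c)" by simp
    thus ?thesis using 2 assms by simp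
  qed
  thus ?thesis by (rule has_field_derivative_at_within)
qed

lemma pw_has_derivative:
  assumes "\<And>i. i \<in> {2..N} \<Longrightarrow> joined x 2 P i"
  shows "(pw x N P has_real_derivative pw x N (\<lambda>i. pderiv (P i)) y) (at y within S)"
  unfolding pw_def
proof (intro derivative_intros)
  show "(poly (P 1) has_real_derivative poly (pderiv (P 1)) y) (at y within S)"
    using poly_DERIV by (rule has_field_derivative_at_within)
  fix i assume "i \<in> {2..N}"
  hence d: "[:- x i, 1:] ^ Suc 1 dvd P i - P (i - 1)" using assms by (simp add: numeral_2_eq_2)
  have "poly (P i - P (i - 1)) (x i) = 0" by (rule poly_eq_0_of_power_dvd[OF d])
  moreover have "poly (pderiv (P i - P (i - 1))) (x i) = 0"
    using dvd_pderiv_of_dvd[OF d] by (simp only: power_one_right poly_eq_0_iff_dvd)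
  ultimately show "((\<lambda>y. if x i \<le> y then poly (P i - P (i - 1)) y else 0) has_real_derivative
      (if x i \<le> y then poly (pderiv (P i) - pderiv (P (i - 1))) y else 0)) (at y within S)"
    unfolding pderiv_diff[symmetric] by (rule truncated_poly_has_derivative)
qed

lemma pw_continuous:
  assumes "\<And>i. i \<in> {2..N} \<Longrightarrow> poly (P i - P (i - 1)) (x i) = 0"
  shows "continuous_on S (pw x N P)"
proof -
  have "pw x N P y = poly (P 1) y + (\<Sum>i\<in>{2..N}. poly (P i - P (i - 1)) (max (x i) y))" for y
    unfolding pw_def using assms by (intro arg_cong2[where f = "(+)"] sum.cong) (auto simp: max_def)
  hence "pw x N P = (\<lambda>y. poly (P 1) y + (\<Sum>i\<in>{2..N}. poly (P i - P (i - 1)) (max (x i) y)))" by auto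
  thus ?thesis by (auto intro!: continuous_intros)
qed

lemma pw_Cn_on:
  assumes "\<And>i. i \<in> {2..N} \<Longrightarrow> [:- x i, 1:] ^ Suc m dvd P i - P (i - 1)"
  shows "Cn_on m S (pw x N P)"
  using assms
proof (induction m arbitrary: P)
  case 0
  have "continuous_on S (pw x N P)"
    by (rule pw_continuous, rule poly_eq_0_of_power_dvd[OF 0])
  thus ?case by simp
next
  case (Suc m)
  have "(pw x N P has_real_derivative pw x N (\<lambda>i. pderiv (P i)) y) (at y within S)" for y
  proof (rule pw_has_derivative)
    fix i assume "i \<in> {2..N}"
    hence "[:- x i, 1:] ^ Suc (Suc m) dvd P i - P (i - 1)" by (rule Suc.prems)
    moreover have "[:- x i, 1:] ^ 2 dvd [:- x i, 1:] ^ Suc (Suc m)" by (intro le_imp_power_dvd) simp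
    ultimately show "joined x 2 P i" by (rule dvd_trans[rotated])
  qed
  moreover have "Cn_on m S (pw x N (\<lambda>i. pderiv (P i)))"
  proof (rule Suc.IH)
    fix i assume "i \<in> {2..N}"
    thus "[:- x i, 1:] ^ Suc m dvd pderiv (P i) - pderiv (P (i - 1))"
      unfolding pderiv_diff[symmetric] by (intro dvd_pderiv_of_dvd Suc.prems)
  qed
  ultimately show ?case by auto
qed

text \<open>Two polynomials that match \<open>m\<close> derivatives at \<open>c\<close> differ by a multiple of \<open>(y - c)\<^bsup>m + 1\<^esup>\<close>. The
derivatives of \<open>v\<close> at \<open>c\<close> are identified from either side, which the uniqueness of one-sided
derivatives permits.\<close>

lemma Cn_on_jump_dvd:
  assumes "Cn_on m S v" "open S" "{l..r} \<subseteq> S" "l < c" "c < r"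
    and "\<And>y. y \<in> {l..c} \<Longrightarrow> v y = poly p y" "\<And>y. y \<in> {c..r} \<Longrightarrow> v y = poly q y"
  shows "[:- c, 1:] ^ Suc m dvd q - p"
  using assms
proof (induction m arbitrary: v p q)
  case 0
  have "poly (q - p) c = 0" using 0(6)[of c] 0(7)[of c] 0(4,5) by simp
  thus ?case by (simp only: poly_eq_0_iff_dvd power_Suc power_0 mult_1_right)
next
  case (Suc m)
  obtain g where g: "\<And>y. y \<in> S \<Longrightarrow> (v has_real_derivative g y) (at y within S)" "Cn_on m S g"
    using Suc.prems(1) by auto
  have uniq: "g y = poly (pderiv w) y"
    if T: "T = {s..t}" "s < t" "T \<subseteq> {l..r}" "\<And>z. z \<in> T \<Longrightarrow> v z = poly w z" and y: "y \<in> T" for T s t y w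
  proof (rule has_field_derivative_unique)
    have "y \<in> S" using T y Suc.prems(3) by auto
    hence "(v has_real_derivative g y) (at y)" using g(1) Suc.prems(2) at_within_open by metis
    thus "(v has_real_derivative g y) (at y within T)" by (rule has_field_derivative_at_within)
    have "(poly w has_real_derivative poly (pderiv w) y) (at y within T)"
      using poly_DERIV by (rule has_field_derivative_at_within)
    thus "(v has_real_derivative poly (pderiv w) y) (at y within T)"
      by (rule has_field_derivative_transform_within[OF _ zero_less_one y]) (use T in auto)
    show "at y within T \<noteq> bot" using T y by (simp add: trivial_limit_within islimpt_Icc)
  qed
  have "[:- c, 1:] ^ Suc m dvd pderiv (q - p)"
    unfolding pderiv_diff
  proof (rule Suc.IH[OF g(2) Suc.prems(2-5)])
    show "g y = poly (pderiv p) y" if "y \<in> {l..c}" for y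
      using Suc.prems(4-6) that by (intro uniq[of "{l..c}" l c]) auto
    show "g y = poly (pderiv q) y" if "y \<in> {c..r}" for y
      using Suc.prems(4,5,7) that by (intro uniq[of "{c..r}" c r]) auto
  qed
  moreover have "poly (q - p) c = 0" using Suc.prems(6)[of c] Suc.prems(7)[of c] Suc.prems(4,5) by simp
  ultimately show ?case by (rule dvd_of_dvd_pderiv[rotated])
qed

lemma mesh_elem_containing:
  assumes "mesh a b N x" "y \<in> {a..<b}"
  obtains j where "j \<in> {1..N}" "x j \<le> y" "y < x (j + 1)"
proof -
  define A where "A = {i \<in> {1..N}. x i \<le> y}"
  have A: "finite A" "A \<noteq> {}" using assms by (auto simp: A_def mesh_def intro!: exI[of _ 1])
  have M: "Max A \<in> A" using A by (rule Max_in)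
  have "y < x (Max A + 1)"
  proof (cases "Max A = N")
    case True thus ?thesis using assms by (simp add: mesh_def)
  next
    case False
    have "Max A + 1 \<notin> A" using Max_ge[OF A(1), of "Max A + 1"] by auto
    thus ?thesis using M False by (auto simp: A_def)
  qed
  thus ?thesis using M that[of "Max A"] by (auto simp: A_def)
qed

lemma mesh_open_elem_containing:
  assumes "mesh a b N x" "y \<in> {a<..<b}" "y \<notin> x ` {1..N + 1}"
  obtains j where "j \<in> {1..N}" "y \<in> {x j<..<x (j + 1)}"
proof -
  obtain j where j: "j \<in> {1..N}" "x j \<le> y" "y < x (j + 1)"
    by (rule mesh_elem_containing[OF assms(1), of y]) (use assms(2) in auto)
  moreover have "x j \<in> x ` {1..N + 1}" using j(1) by auto
  hence "x j \<noteq> y" using assms(3) by auto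
  ultimately show ?thesis using that[of j] by auto
qed

section \<open>Galerkin orthogonality for piecewise polynomials\<close>

lemma poly_primitive_exists:
  fixes q :: "real poly"
  shows "\<exists>r. pderiv r = q \<and> degree r \<le> degree q + 1"
proof (intro exI conjI)
  let ?r = "\<Sum>i\<le>degree q. monom (coeff q i / real (Suc i)) (Suc i)"
  have "pderiv ?r = (\<Sum>i\<le>degree q. monom (coeff q i) i)"
    by (simp add: higher_pderiv_sum[of 1, simplified] pderiv_monom del: of_nat_Suc)
  thus "pderiv ?r = q" by (simp add: poly_as_sum_of_monoms)
  show "degree ?r \<le> degree q + 1"
    by (intro degree_sum_le) (auto intro: order_trans[OF degree_monom_le])
qed

lemma H01_left: "v \<in> H01 a b \<Longrightarrow> a \<le> b \<Longrightarrow> v a = 0"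
proof -
  assume "v \<in> H01 a b" "a \<le> b"
  then obtain g where "v a = (LBINT t:{a..a}. g t)" by (auto simp: H01_def)
  also have "\<dots> = integral\<^sup>L lborel (\<lambda>_ :: real. 0)"
    unfolding set_lebesgue_integral_def
    by (rule integral_discrete_difference[of "{a}"]) auto
  finally show ?thesis by simp
qed

lemma H01_right: "v \<in> H01 a b \<Longrightarrow> v b = 0"
  by (auto simp: H01_def)

lemma pw_in_H01:
  assumes mesh: "mesh a b N x" and ab: "a < b"
    and P: "\<And>i. i \<in> {2..N} \<Longrightarrow> poly (P i - P (i - 1)) (x i) = 0"
    and P_a: "poly (P 1) a = 0" and P_b: "poly (P N) b = 0"
  shows "pw x N P \<in> H01 a b"
proof -
  define g where "g = pw x N (\<lambda>i. pderiv (P i))"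
  define X where "X = x ` {1..N + 1}"
  have N: "1 \<le> N" "x 1 = a" "x (N + 1) = b" using mesh by (auto simp: mesh_def)
  have g_meas: "g \<in> borel_measurable borel" unfolding g_def by (rule pw_measurable)
  have "\<exists>B. \<forall>y\<in>{a..b}. \<bar>poly p y\<bar> \<le> B" for p :: "real poly"
    using continuous_attains_sup[of "{a..b}" "\<lambda>y. \<bar>poly p y\<bar>"] ab by (force intro!: continuous_intros)
  then obtain B where B: "\<And>p y. y \<in> {a..b} \<Longrightarrow> \<bar>poly p y\<bar> \<le> B p" by metis
  define M where "M = B (pderiv (P 1)) + (\<Sum>i\<in>{2..N}. B (pderiv (P i) - pderiv (P (i - 1))))"
  have gM: "\<bar>g y\<bar> \<le> M" if y: "y \<in> {a..b}" for y
  proof -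
    have B0: "0 \<le> B p" for p using B[OF y, of p] by linarith
    have "\<bar>g y\<bar> \<le> \<bar>poly (pderiv (P 1)) y\<bar> + (\<Sum>i\<in>{2..N}. \<bar>if x i \<le> y then poly (pderiv (P i) - pderiv (P (i - 1))) y else 0\<bar>)"
      unfolding g_def pw_def by (rule order_trans[OF abs_triangle_ineq add_left_mono[OF sum_abs]])
    also have "\<dots> \<le> M" unfolding M_def
    proof (intro add_mono sum_mono B y)
      fix i show "\<bar>if x i \<le> y then poly (pderiv (P i) - pderiv (P (i - 1))) y else 0\<bar> \<le> B (pderiv (P i) - pderiv (P (i - 1)))"
        using B[OF y, of "pderiv (P i) - pderiv (P (i - 1))"] B0 by auto
    qed
    finally show ?thesis .
  qed
  have int_g: "set_integrable lborel {a..c} g" if "c \<le> b" for c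
    unfolding set_integrable_def
    using g_meas gM that by (intro integrableI_bounded_set_indicator[where B = M]) (auto simp: emeasure_lborel_Icc_eq)
  have int_g2: "set_integrable lborel {a..b} (\<lambda>t. (g t)\<^sup>2)"
    unfolding set_integrable_def
  proof (rule integrableI_bounded_set_indicator[where B = "M\<^sup>2"])
    show "(\<lambda>t. (g t)\<^sup>2) \<in> borel_measurable lborel" using g_meas by measurable
    show "AE t in lborel. t \<in> {a..b} \<longrightarrow> norm ((g t)\<^sup>2) \<le> M\<^sup>2"
      using gM by (intro AE_I2) (auto simp: abs_le_square_iff[symmetric] intro: order_trans[OF _ abs_ge_self])
  qed (auto simp: emeasure_lborel_Icc_eq)
  have cont: "continuous_on S (pw x N P)" for S by (rule pw_continuous, rule P)
  have deriv: "(pw x N P has_vector_derivative g y) (at y)" if y: "y \<in> {a<..<b} - X" for y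
  proof -
    obtain j where j: "j \<in> {1..N}" "y \<in> {x j<..<x (j + 1)}"
      by (rule mesh_open_elem_containing[OF mesh, of y]) (use y X_def in auto)
    show ?thesis using pw_has_derivative_open_elem[OF mesh j] pw_on_open_elem[OF mesh j]
      by (simp add: g_def has_real_derivative_iff_has_vector_derivative)
  qed
  have pa: "pw x N P a = 0" using pw_on_elem[OF mesh, of 1 a P] N P[of 2] P_a ab mesh_less[OF mesh, of 1 2]
    by (auto simp: numeral_2_eq_2)
  have pb: "pw x N P b = 0" using pw_on_elem[OF mesh, of N b P] N P_b mesh_less[OF mesh, of N "N + 1"]
    by auto
  have main: "pw x N P y = (LBINT t:{a..y}. g t)" if y: "y \<in> {a..b}" for y
  proof -
    have "(g has_integral pw x N P y - pw x N P a) {a..y}"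
      using y by (intro fundamental_theorem_of_calculus_interior_strong[of X] deriv cont) (auto simp: X_def)
    hence "integral {a..y} g = pw x N P y" using pa by (simp add: integral_unique)
    thus ?thesis using set_borel_integral_eq_integral(2)[OF int_g[of y]] y by simp
  qed
  show ?thesis unfolding H01_def
  proof (intro CollectI exI[of _ g] conjI ballI)
    show "set_borel_measurable lborel {a..b} g"
      unfolding set_borel_measurable_def using g_meas by measurable
  qed (use int_g2 main pb in auto)
qed

text \<open>Splines of degree \<open>k - 1\<close> with mean zero are exactly the derivatives of discrete test functions. The
constant \<open>c\<close> is the mean of \<open>Q\<close>; each piece of the primitive is continued from the value that the
preceding one has at the common node.\<close>

lemma spline_primitive_in_V_space:
  fixes Q :: "nat \<Rightarrow> real poly"
  assumes mesh: "mesh a b N x" and ab: "a < b" and k: "1 \<le> k"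
    and Qdeg: "\<And>i. i \<in> {1..N} \<Longrightarrow> degree (Q i) \<le> k - 1"
    and Qdvd: "\<And>i. i \<in> {2..N} \<Longrightarrow> joined x \<mu> Q i"
  obtains c V where "pw x N V \<in> V_space a b N x k \<mu>"
    "\<And>i. pderiv (V i) = Q i - [:c:]"
proof -
  have N: "1 \<le> N" "x 1 = a" "x (N + 1) = b" using mesh by (auto simp: mesh_def)
  have "\<forall>i. \<exists>r. pderiv r = Q i \<and> degree r \<le> degree (Q i) + 1" using poly_primitive_exists by blast
  then obtain S where S: "\<And>i. pderiv (S i) = Q i" "\<And>i. degree (S i) \<le> degree (Q i) + 1" by metis
  define \<Delta> where "\<Delta> T j = poly (T j) (x (j + 1)) - poly (T j) (x j)" for T :: "nat \<Rightarrow> real poly" and j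
  define c where "c = (\<Sum>j\<in>{1..N}. \<Delta> S j) / (b - a)"
  define R where "R i = S i - [:0, c:]" for i
  define V where "V i = R i - [:poly (R i) (x i):] + [:\<Sum>j\<in>{1..<i}. \<Delta> R j:]" for i
  have dV: "pderiv (V i) = Q i - [:c:]" for i
    by (simp add: V_def R_def pderiv_diff pderiv_add S(1) pderiv_pCons)
  have left: "poly (V i) (x i) = (\<Sum>j\<in>{1..<i}. \<Delta> R j)" for i by (simp add: V_def)
  have right: "poly (V i) (x (i + 1)) = (\<Sum>j\<in>{1..<i + 1}. \<Delta> R j)" if "1 \<le> i" for i
    using that by (simp add: V_def \<Delta>_def)
  have "\<Delta> R j = \<Delta> S j - c * (x (j + 1) - x j)" for j by (simp add: R_def \<Delta>_def algebra_simps)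
  hence "(\<Sum>j\<in>{1..N}. \<Delta> R j) = (\<Sum>j\<in>{1..N}. \<Delta> S j) - (\<Sum>j\<in>{1..N}. c * (x (j + 1) - x j))"
    by (simp add: sum_subtractf)
  also have "(\<Sum>j\<in>{1..N}. c * (x (j + 1) - x j)) = c * (b - a)"
  proof -
    have "(\<Sum>j\<in>{1..N}. x (j + 1) - x j) = x (N + 1) - x 1"
      using sum_Suc_diff[of 1 N x] N by simp
    thus ?thesis using N by (simp add: sum_distrib_left[symmetric])
  qed
  finally have total: "(\<Sum>j\<in>{1..N}. \<Delta> R j) = 0" using ab by (simp add: c_def)
  have jump: "poly (V i - V (i - 1)) (x i) = 0" if "i \<in> {2..N}" for i
    using left[of i] right[of "i - 1"] that by (simp, force)
  have jump_dvd: "[:- x i, 1:] ^ Suc \<mu> dvd V i - V (i - 1)" if i: "i \<in> {2..N}" for i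
  proof (rule dvd_of_dvd_pderiv[OF jump[OF i]])
    have "pderiv (V i - V (i - 1)) = Q i - Q (i - 1)" by (simp add: pderiv_diff dV)
    thus "[:- x i, 1:] ^ \<mu> dvd pderiv (V i - V (i - 1))" using Qdvd[OF i] by simp
  qed
  have degV: "degree (V i) \<le> k" if "i \<in> {1..N}" for i
  proof -
    have "degree (S i) \<le> k" using S(2)[of i] Qdeg[OF that] k by linarith
    moreover have "degree [:0, c:] \<le> k" using k by (cases "c = 0") auto
    ultimately show ?thesis unfolding V_def R_def
      by (intro degree_add_le degree_diff_le) auto
  qed
  have "pw x N V \<in> spline_space a b N x k \<mu>"
    unfolding spline_space_def
  proof (intro CollectI conjI ballI pw_Cn_on)
    fix i assume i: "i \<in> {1..N}"
    show "\<exists>p. degree p \<le> k \<and> (\<forall>y\<in>mesh_elem x i. pw x N V y = poly p y)"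
    proof (intro exI[of _ "V i"] conjI ballI degV i)
      fix y assume "y \<in> mesh_elem x i"
      thus "pw x N V y = poly (V i) y"
        using i jump[of "i + 1"] by (intro pw_on_elem[OF mesh i]) (auto simp: mesh_elem_def)
    qed
  qed (rule jump_dvd)
  moreover have "pw x N V \<in> H01 a b"
  proof (rule pw_in_H01[OF mesh ab jump])
    show "poly (V 1) a = 0" using left[of 1] N by simp
    show "poly (V N) b = 0" using right[of N] N total by (simp add: atLeastLessThanSuc_atLeastAtMost)
  qed
  ultimately have "pw x N V \<in> V_space a b N x k \<mu>" by (simp add: V_space_def)
  thus ?thesis using dV that by blast
qed

text \<open>Testing with the primitive of \<open>Q - c\<close> gives the orthogonality to \<open>Q - c\<close>, and the constant \<open>c\<close> is
harmless because the integral of \<open>(u - uh)'\<close> vanishes. The values of \<^const>\<open>deriv\<close> at the nodes enter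
an integral only, so they can be replaced.\<close>

lemma galerkin_orthogonality:
  fixes u uh w :: "real \<Rightarrow> real"
  assumes mesh: "mesh a b N x" and ab: "a < b" and k: "1 \<le> k"
    and gal: "galerkin_solution a b N x k \<mu> u uh"
    and u: "continuous_on {a..b} u" "u a = 0" "u b = 0"
    and du: "\<And>y. y \<in> {a<..<b} \<Longrightarrow> (u has_real_derivative w y) (at y)"
    and w: "continuous_on {a..b} w"
  obtains P :: "nat \<Rightarrow> real poly" where
    "\<And>i. i \<in> {1..N} \<Longrightarrow> degree (P i) \<le> k"
    "\<And>i y. i \<in> {1..N} \<Longrightarrow> y \<in> cell x i \<Longrightarrow> uh y = poly (P i) y"
    "\<And>i. i \<in> {2..N} \<Longrightarrow> [:- x i, 1:] ^ Suc \<mu> dvd P i - P (i - 1)"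
    "\<And>i. i \<in> {1..N} \<Longrightarrow> integral (cell x i) (\<lambda>y. w y - poly (pderiv (P i)) y) =
        (u (x (i + 1)) - uh (x (i + 1))) - (u (x i) - uh (x i))"
    "\<And>Q. (\<And>i. i \<in> {1..N} \<Longrightarrow> degree (Q i) \<le> k - 1) \<Longrightarrow>
        (\<And>i. i \<in> {2..N} \<Longrightarrow> joined x \<mu> Q i) \<Longrightarrow>
        (\<Sum>i\<in>{1..N}. integral (cell x i) (\<lambda>y. (w y - poly (pderiv (P i)) y) * poly (Q i) y)) = 0"
    "uh a = 0" "uh b = 0"
proof -
  have N: "1 \<le> N" "x 1 = a" "x (N + 1) = b" using mesh by (auto simp: mesh_def)
  have uhV: "uh \<in> V_space a b N x k \<mu>" using gal by (simp add: galerkin_solution_def)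
  hence uhS: "uh \<in> spline_space a b N x k \<mu>" and uhH: "uh \<in> H01 a b" by (auto simp: V_space_def)
  have uh0: "uh a = 0" "uh b = 0" using H01_left[OF uhH] H01_right[OF uhH] ab by auto
  from uhS have "\<forall>i\<in>{1..N}. \<exists>p. degree p \<le> k \<and> (\<forall>y\<in>cell x i. uh y = poly p y)"
    by (simp add: spline_space_def mesh_elem_def)
  from bchoice[OF this] obtain P where P: "\<And>i. i \<in> {1..N} \<Longrightarrow> degree (P i) \<le> k"
      "\<And>i y. i \<in> {1..N} \<Longrightarrow> y \<in> cell x i \<Longrightarrow> uh y = poly (P i) y"
    by blast
  have Cn: "Cn_on \<mu> {a<..<b} uh" using uhS by (simp add: spline_space_def)
  have el: "x i < x (i + 1)" "a \<le> x i" "x (i + 1) \<le> b" if "i \<in> {1..N}" for i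
    using mesh_less[OF mesh, of i "i + 1"] mesh_bounds[OF mesh, of i] mesh_bounds[OF mesh, of "i + 1"] that by auto
  have Pdvd: "[:- x i, 1:] ^ Suc \<mu> dvd P i - P (i - 1)" if i: "i \<in> {2..N}" for i
  proof -
    have i1: "i - 1 + 1 = i" "i - 1 \<in> {1..N}" using i by auto
    have e1: "x (i - 1) < x i" "a \<le> x (i - 1)" using el[OF i1(2)] unfolding i1(1) by auto
    have e2: "x i < x (i + 1)" "x (i + 1) \<le> b" using el[of i] i by auto
    define l where "l = (x (i - 1) + x i) / 2"
    define r where "r = (x i + x (i + 1)) / 2"
    have lr: "x (i - 1) < l" "l < x i" "x i < r" "r < x (i + 1)" using e1 e2 by (auto simp: l_def r_def)
    show ?thesis
    proof (rule Cn_on_jump_dvd[OF Cn, of l r])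
      show "uh y = poly (P (i - 1)) y" if "y \<in> {l..x i}" for y
        using that lr by (intro P(2)[OF i1(2)], unfold i1(1)) auto
      show "uh y = poly (P i) y" if "y \<in> {x i..r}" for y
        using that i lr by (intro P(2)) auto
    qed (use lr e1 e2 in auto)
  qed
  define E where "E i y = w y - poly (pderiv (P i)) y" for i y
  have E_cont: "continuous_on (cell x i) (E i)" if "i \<in> {1..N}" for i
    unfolding E_def using mesh_elem_subset[OF mesh that]
    by (auto intro!: continuous_intros intro: continuous_on_subset[OF w])
  have dE: "((\<lambda>y. u y - uh y) has_real_derivative E i y) (at y)" if i: "i \<in> {1..N}" and y: "y \<in> {x i<..<x (i + 1)}" for i y
  proof -
    have "y \<in> {a<..<b}" using el[OF i] y by auto
    moreover have "(uh has_real_derivative poly (pderiv (P i)) y) (at y)"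
      by (rule has_field_derivative_transform_within_open[OF poly_DERIV open_greaterThanLessThan y])
         (use P(2) i in auto)
    ultimately show ?thesis unfolding E_def by (intro DERIV_diff du)
  qed
  have intE: "(E i has_integral (u (x (i + 1)) - uh (x (i + 1))) - (u (x i) - uh (x i))) (cell x i)"
    if i: "i \<in> {1..N}" for i
  proof (rule fundamental_theorem_of_calculus_interior)
    show "continuous_on (cell x i) (\<lambda>y. u y - uh y)"
    proof (rule continuous_on_diff)
      show "continuous_on (cell x i) u"
        using continuous_on_subset[OF u(1)] mesh_elem_subset[OF mesh i] by blast
      have "continuous_on (cell x i) (poly (P i))" by (intro continuous_intros)
      thus "continuous_on (cell x i) uh"
        by (rule continuous_on_eq) (use P(2) i in auto)
    qed
  qed (use el[OF i] dE[OF i] in \<open>auto simp: has_real_derivative_iff_has_vector_derivative[symmetric]\<close>)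
  have orth: "(\<Sum>i\<in>{1..N}. integral (cell x i) (\<lambda>y. E i y * poly (Q i) y)) = 0"
    if Q: "\<And>i. i \<in> {1..N} \<Longrightarrow> degree (Q i) \<le> k - 1"
        "\<And>i. i \<in> {2..N} \<Longrightarrow> joined x \<mu> Q i" for Q
  proof -
    obtain c V where V: "pw x N V \<in> V_space a b N x k \<mu>" "\<And>i. pderiv (V i) = Q i - [:c:]"
      using spline_primitive_in_V_space[OF mesh ab k Q] by blast
    define X where "X = x ` {1..N + 1}"
    define G where "G i y = E i y * (poly (Q i) y - c)" for i y
    have G_cont: "continuous_on (cell x i) (G i)" if "i \<in> {1..N}" for i
      unfolding G_def by (intro continuous_intros E_cont that)
    have "0 = (LBINT y:{a<..<b}. deriv (\<lambda>z. u z - uh z) y * deriv (pw x N V) y)"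
      using gal V(1) by (simp add: galerkin_solution_def)
    also have "\<dots> = integral\<^sup>L lborel (\<lambda>y. \<Sum>i\<in>{1..N}. indicator (cell x i) y *\<^sub>R G i y)"
      unfolding set_lebesgue_integral_def
    proof (rule integral_discrete_difference[of X])
      fix y assume y: "y \<notin> X"
      show "indicator {a<..<b} y *\<^sub>R (deriv (\<lambda>z. u z - uh z) y * deriv (pw x N V) y) =
          (\<Sum>i\<in>{1..N}. indicator (cell x i) y *\<^sub>R G i y)"
      proof (cases "y \<in> {a<..<b}")
        case False
        have "(\<Sum>i\<in>{1..N}. indicator (cell x i) y *\<^sub>R G i y) = (\<Sum>i\<in>{1..N}. 0)"
        proof (intro sum.cong refl)
          fix i assume i: "i \<in> {1..N}"
          have "y \<noteq> x i" "y \<noteq> x (i + 1)" using y i by (auto simp: X_def)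
          thus "indicator (cell x i) y *\<^sub>R G i y = 0" using False el[OF i] by auto
        qed
        thus ?thesis using False by simp
      next
        case True
        obtain j where j: "j \<in> {1..N}" "y \<in> {x j<..<x (j + 1)}"
          by (rule mesh_open_elem_containing[OF mesh, of y]) (use True y X_def in auto)
        have "(\<Sum>i\<in>{1..N}. indicator (cell x i) y *\<^sub>R G i y) = (\<Sum>i\<in>{1..N}. if i = j then G j y else 0)"
        proof (intro sum.cong refl)
          fix i assume i: "i \<in> {1..N}"
          show "indicator (cell x i) y *\<^sub>R G i y = (if i = j then G j y else 0)"
          proof (cases "i = j")
            case False
            hence "i + 1 \<le> j \<or> j + 1 \<le> i" by arith
            hence "x (i + 1) \<le> x j \<or> x (j + 1) \<le> x i"
              using mesh_le[OF mesh, of "i + 1" j] mesh_le[OF mesh, of "j + 1" i] i j(1) by auto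
            thus ?thesis using j(2) False by auto
          qed (use j in auto)
        qed
        also have "\<dots> = G j y" using j(1) by simp
        also have "\<dots> = deriv (\<lambda>z. u z - uh z) y * deriv (pw x N V) y"
          using DERIV_imp_deriv[OF dE[OF j]] DERIV_imp_deriv[OF pw_has_derivative_open_elem[OF mesh j, of V]]
          by (simp add: G_def V(2))
        finally show ?thesis using True by simp
      qed
    qed (auto simp: X_def intro: countable_finite)
    also have "\<dots> = (\<Sum>i\<in>{1..N}. LBINT y:cell x i. G i y)"
      unfolding set_lebesgue_integral_def
      using borel_integrable_atLeastAtMost'[OF G_cont] by (intro Bochner_Integration.integral_sum) (simp add: set_integrable_def)
    also have "\<dots> = (\<Sum>i\<in>{1..N}. integral (cell x i) (G i))"
      by (intro sum.cong refl set_borel_integral_eq_integral borel_integrable_atLeastAtMost' G_cont)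
    also have "\<dots> = (\<Sum>i\<in>{1..N}. integral (cell x i) (\<lambda>y. E i y * poly (Q i) y)
          - c * ((u (x (i + 1)) - uh (x (i + 1))) - (u (x i) - uh (x i))))"
    proof (intro sum.cong refl)
      fix i assume i: "i \<in> {1..N}"
      have "integral (cell x i) (G i) = integral (cell x i) (\<lambda>y. E i y * poly (Q i) y - c * E i y)"
        by (intro integral_cong) (simp add: G_def algebra_simps)
      also have "\<dots> = integral (cell x i) (\<lambda>y. E i y * poly (Q i) y) - integral (cell x i) (\<lambda>y. c * E i y)"
        by (intro integral_diff integrable_continuous_real continuous_intros E_cont i)
      also have "integral (cell x i) (\<lambda>y. c * E i y) = c * ((u (x (i + 1)) - uh (x (i + 1))) - (u (x i) - uh (x i)))"
        using integral_unique[OF intE[OF i]] by simp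
      finally show "integral (cell x i) (G i) = integral (cell x i) (\<lambda>y. E i y * poly (Q i) y)
          - c * ((u (x (i + 1)) - uh (x (i + 1))) - (u (x i) - uh (x i)))" .
    qed
    also have "\<dots> = (\<Sum>i\<in>{1..N}. integral (cell x i) (\<lambda>y. E i y * poly (Q i) y)) -
        c * (\<Sum>i\<in>{1..N}. (u (x (i + 1)) - uh (x (i + 1))) - (u (x i) - uh (x i)))"
      unfolding sum_distrib_left by (rule sum_subtractf)
    also have "(\<Sum>i\<in>{1..N}. (u (x (i + 1)) - uh (x (i + 1))) - (u (x i) - uh (x i))) = 0"
      using sum_Suc_diff[of 1 N "\<lambda>i. u (x i) - uh (x i)"] N u uh0 by simp
    finally show ?thesis by simp
  qed
  have E_eq: "E i = (\<lambda>y. w y - poly (pderiv (P i)) y)" for i by (rule ext) (simp add: E_def)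
  show ?thesis
  proof (rule that[of P])
    show "\<And>i. i \<in> {1..N} \<Longrightarrow> integral (cell x i) (\<lambda>y. w y - poly (pderiv (P i)) y) =
        (u (x (i + 1)) - uh (x (i + 1))) - (u (x i) - uh (x i))"
      using integral_unique[OF intE] unfolding E_eq .
    show "\<And>Q. (\<And>i. i \<in> {1..N} \<Longrightarrow> degree (Q i) \<le> k - 1) \<Longrightarrow>
        (\<And>i. i \<in> {2..N} \<Longrightarrow> joined x \<mu> Q i) \<Longrightarrow>
        (\<Sum>i\<in>{1..N}. integral (cell x i) (\<lambda>y. (w y - poly (pderiv (P i)) y) * poly (Q i) y)) = 0"
      using orth unfolding E_def .
  qed (fact P Pdvd uh0)+
qed

section \<open>Regularity, Taylor polynomials and reflection\<close>

lemma Cn_on_derivatives: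
  assumes "Cn_on k S f"
  shows "\<exists>D. D 0 = f \<and> (\<forall>j<k. \<forall>y\<in>S. (D j has_real_derivative D (Suc j) y) (at y within S)) \<and>
              continuous_on S (D k)"
  using assms
proof (induction k arbitrary: f)
  case 0
  thus ?case by (intro exI[of _ "\<lambda>_. f"]) auto
next
  case (Suc k)
  then obtain g where g: "\<forall>y\<in>S. (f has_real_derivative g y) (at y within S)" "Cn_on k S g" by auto
  from Suc.IH[OF g(2)] obtain D where D: "D 0 = g"
      "\<forall>j<k. \<forall>y\<in>S. (D j has_real_derivative D (Suc j) y) (at y within S)" "continuous_on S (D k)"
    by blast
  define D' where "D' j = (case j of 0 \<Rightarrow> f | Suc i \<Rightarrow> D i)" for j
  have "\<forall>y\<in>S. (D' j has_real_derivative D' (Suc j) y) (at y within S)" if "j < Suc k" for j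
    using that g D by (cases j) (auto simp: D'_def)
  thus ?case using D by (intro exI[of _ D']) (auto simp: D'_def)
qed

text \<open>On the open interval \<open>u'\<close> differs from \<open>- \<integral> f\<close> by a constant. This extends \<open>u'\<close> smoothly to the closed
interval and shows that it has one derivative more than \<open>f\<close>.\<close>

lemma poisson_solution_derivatives:
  assumes ab: "a < b" and f: "Cn_on k {a..b} f" and u: "poisson_solution a b f u"
  obtains D where
    "\<And>j y. j \<le> k \<Longrightarrow> y \<in> {a..b} \<Longrightarrow> (D j has_real_derivative D (Suc j) y) (at y within {a..b})"
    "continuous_on {a..b} (D (Suc k))"
    "\<And>y. y \<in> {a<..<b} \<Longrightarrow> (u has_real_derivative D 0 y) (at y)"
proof -
  from Cn_on_derivatives[OF f] obtain Df where Df: "Df 0 = f"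
      "\<forall>j<k. \<forall>y\<in>{a..b}. (Df j has_real_derivative Df (Suc j) y) (at y within {a..b})"
      "continuous_on {a..b} (Df k)" by blast
  have f_cont: "continuous_on {a..b} f"
  proof (cases k)
    case 0 thus ?thesis using Df by simp
  next
    case (Suc k')
    hence "\<forall>y\<in>{a..b}. (f has_real_derivative Df 1 y) (at y within {a..b})" using Df by auto
    thus ?thesis by (intro DERIV_continuous_on) blast
  qed
  define F where "F y = integral {a..y} f" for y
  have F: "(F has_real_derivative f y) (at y within {a..b})" if "y \<in> {a..b}" for y
    unfolding F_def by (rule integral_has_real_derivative[OF f_cont that])
  from u obtain u' where u': "\<And>y. y \<in> {a<..<b} \<Longrightarrow> (u has_real_derivative u' y) (at y)"
      "\<And>y. y \<in> {a<..<b} \<Longrightarrow> (u' has_real_derivative - f y) (at y)"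
    unfolding poisson_solution_def by blast
  have "\<exists>\<kappa>. \<forall>y\<in>{a<..<b}. u' y + F y = \<kappa>"
  proof -
    have "((\<lambda>y. u' y + F y) has_real_derivative 0) (at y within {a<..<b})" if y: "y \<in> {a<..<b}" for y
    proof -
      have "y \<in> interior {a..b}" using y by simp
      hence "(F has_real_derivative f y) (at y)"
        using F[of y] y at_within_interior[of y "{a..b}"] by simp
      from DERIV_add[OF u'(2)[OF y] this] show ?thesis
        by (simp add: has_field_derivative_at_within)
    qed
    from has_field_derivative_zero_constant[OF convex_real_interval(8) this] show ?thesis by metis
  qed
  then obtain \<kappa> where \<kappa>: "\<And>y. y \<in> {a<..<b} \<Longrightarrow> u' y + F y = \<kappa>" by blast
  define D where "D j = (case j of 0 \<Rightarrow> (\<lambda>y. \<kappa> - F y) | Suc i \<Rightarrow> (\<lambda>y. - Df i y))" for j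
  show ?thesis
  proof (rule that[of D])
    fix j y assume j: "j \<le> k" and y: "y \<in> {a..b}"
    show "(D j has_real_derivative D (Suc j) y) (at y within {a..b})"
    proof (cases j)
      case 0
      have "((\<lambda>y. \<kappa> - F y) has_real_derivative 0 - f y) (at y within {a..b})"
        by (intro DERIV_diff DERIV_const F y)
      thus ?thesis using 0 Df by (simp add: D_def)
    next
      case (Suc i)
      hence "(Df i has_real_derivative Df (Suc i) y) (at y within {a..b})" using Df j y by auto
      thus ?thesis using Suc by (simp add: D_def DERIV_minus)
    qed
  next
    show "continuous_on {a..b} (D (Suc k))" using Df by (auto simp: D_def intro: continuous_intros)
  next
    fix y assume y: "y \<in> {a<..<b}"
    have "u' y = D 0 y" using \<kappa>[OF y] by (simp add: D_def)
    thus "(u has_real_derivative D 0 y) (at y)" using u'(1)[OF y] by simp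
  qed
qed

lemma deriv_iterate_eq:
  assumes "open S" "\<And>j y. j < s \<Longrightarrow> y \<in> S \<Longrightarrow> (D j has_real_derivative D (Suc j) y) (at y)" "y \<in> S"
  shows "(deriv ^^ s) (D 0) y = D s y"
  using assms(2,3)
proof (induction s arbitrary: y)
  case (Suc s)
  have "eventually (\<lambda>z. z \<in> S) (nhds y)" using assms(1) Suc.prems(2) by (rule eventually_nhds_in_open)
  hence "eventually (\<lambda>z. (deriv ^^ s) (D 0) z = D s z) (nhds y)"
    by eventually_elim (use Suc in auto)
  hence "deriv ((deriv ^^ s) (D 0)) y = deriv (D s) y" by (rule deriv_cong_ev) simp
  also have "\<dots> = D (Suc s) y" using Suc.prems by (intro DERIV_imp_deriv) auto
  finally show ?case by simp
qed simp

definition reflect_poly_about :: "real \<Rightarrow> real poly \<Rightarrow> real poly" where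
  "reflect_poly_about x0 p = pcompose p [:2 * x0, -1:]"

lemma poly_reflect_about [simp]: "poly (reflect_poly_about x0 p) y = poly p (2 * x0 - y)"
  by (simp add: reflect_poly_about_def poly_pcompose)

lemma degree_reflect_about [simp]: "degree (reflect_poly_about x0 p) = degree p"
  by (simp add: reflect_poly_about_def degree_pcompose)

lemma reflect_about_diff: "reflect_poly_about x0 (p - q) = reflect_poly_about x0 p - reflect_poly_about x0 q"
  by (simp add: reflect_poly_about_def pcompose_diff)

lemma dvd_reflect_about:
  assumes "[:- c, 1:] ^ m dvd p"
  shows "[:- (2 * x0 - c), 1:] ^ m dvd reflect_poly_about x0 p"
proof -
  obtain s where p: "p = [:- c, 1:] ^ m * s" using assms by (auto elim: dvdE)
  have pow: "pcompose (r ^ n) q = pcompose r q ^ n" for r q :: "real poly" and n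
    by (induction n) (simp_all add: pcompose_mult pcompose_1)
  have "reflect_poly_about x0 p = pcompose [:- c, 1:] [:2 * x0, -1:] ^ m * reflect_poly_about x0 s"
    by (simp add: p reflect_poly_about_def pcompose_mult pow)
  also have "pcompose [:- c, 1:] [:2 * x0, -1:] = - [:- (2 * x0 - c), 1:]" by (simp add: pcompose_pCons)
  also have "(- [:- (2 * x0 - c), 1:]) ^ m = (-1) ^ m * [:- (2 * x0 - c), 1:] ^ m" by (rule power_minus)
  finally show ?thesis by (simp add: mult.assoc mult.left_commute)
qed

lemma higher_pderiv_reflect_about:
  "poly ((pderiv ^^ j) (reflect_poly_about x0 p)) y = (-1) ^ j * poly ((pderiv ^^ j) p) (2 * x0 - y)"
  unfolding reflect_poly_about_def higher_pderiv_pcompose_linear by (simp add: poly_pcompose)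

lemma higher_pderiv_diff: "(pderiv ^^ j) (p - q) = (pderiv ^^ j) p - (pderiv ^^ j) (q :: real poly)"
  by (induction j) (simp_all add: pderiv_diff)

definition taylor_poly :: "(nat \<Rightarrow> real \<Rightarrow> real) \<Rightarrow> nat \<Rightarrow> real \<Rightarrow> real poly" where
  "taylor_poly D k x0 = pcompose (\<Sum>i\<le>k. monom (D i x0 / fact i) i) [:- x0, 1:]"

lemma poly_taylor_poly: "poly (taylor_poly D k x0) y = (\<Sum>i\<le>k. D i x0 * (y - x0) ^ i / fact i)"
  by (simp add: taylor_poly_def poly_pcompose poly_sum poly_monom)

lemma higher_pderiv_at_0: "poly ((pderiv ^^ j) p) 0 = fact j * coeff (p :: real poly) j"
proof (induction j arbitrary: p)
  case (Suc j)
  have "poly ((pderiv ^^ Suc j) p) 0 = poly ((pderiv ^^ j) (pderiv p)) 0" by (simp add: funpow_swap1)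
  thus ?case using Suc by (simp add: coeff_pderiv algebra_simps)
qed (simp add: poly_0_coeff_0)

lemma higher_pderiv_taylor_poly:
  assumes "j \<le> k"
  shows "poly ((pderiv ^^ j) (taylor_poly D k x0)) x0 = D j x0"
  using assms unfolding taylor_poly_def higher_pderiv_pcompose_linear
  by (simp add: poly_pcompose higher_pderiv_at_0 coeff_sum)

text \<open>Folding multiplies the term of degree \<open>i\<close> by \<open>1 - (-1)\<^bsup>k + i\<^esup>\<close>, which is zero for \<open>i = k\<close>.\<close>

lemma degree_taylor_symmetrized:
  assumes "1 \<le> k"
  shows "degree (taylor_poly D k x0 - smult ((-1) ^ k) (reflect_poly_about x0 (taylor_poly D k x0))) \<le> k - 1"
proof -
  define T0 where "T0 = (\<Sum>i\<le>k. monom (D i x0 / fact i) i)"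
  define W where "W = (\<Sum>i\<in>{..<k}. monom ((1 - (-1) ^ (k + i)) * (D i x0 / fact i)) i)"
  have "taylor_poly D k x0 - smult ((-1) ^ k) (reflect_poly_about x0 (taylor_poly D k x0)) = pcompose W [:- x0, 1:]"
  proof (rule poly_eq_poly_eq_iff[THEN iffD1], rule ext)
    fix y
    have "poly (taylor_poly D k x0 - smult ((-1) ^ k) (reflect_poly_about x0 (taylor_poly D k x0))) y
       = (\<Sum>i\<le>k. D i x0 * (y - x0) ^ i / fact i) - (-1) ^ k * (\<Sum>i\<le>k. D i x0 * (- (y - x0)) ^ i / fact i)"
      by (simp add: poly_taylor_poly)
    also have "\<dots> = (\<Sum>i\<le>k. (1 - (-1) ^ (k + i)) * (D i x0 / fact i) * (y - x0) ^ i)"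
      unfolding sum_distrib_left sum_subtractf[symmetric]
    proof (rule sum.cong[OF refl])
      fix i
      show "D i x0 * (y - x0) ^ i / fact i - (-1) ^ k * (D i x0 * (- (y - x0)) ^ i / fact i)
          = (1 - (-1) ^ (k + i)) * (D i x0 / fact i) * (y - x0) ^ i"
        unfolding power_minus[of "y - x0"] by (simp add: power_add algebra_simps diff_divide_distrib)
    qed
    also have "\<dots> = (\<Sum>i<k. (1 - (-1) ^ (k + i)) * (D i x0 / fact i) * (y - x0) ^ i)"
      by (simp add: lessThan_Suc_atMost[symmetric] mult_2[symmetric])
    also have "\<dots> = poly (pcompose W [:- x0, 1:]) y"
      by (simp add: W_def poly_pcompose poly_sum poly_monom)
    finally show "poly (taylor_poly D k x0 - smult ((-1) ^ k) (reflect_poly_about x0 (taylor_poly D k x0))) y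
       = poly (pcompose W [:- x0, 1:]) y" .
  qed
  moreover have "degree W \<le> k - 1" unfolding W_def
    by (intro degree_sum_le) (auto intro: order_trans[OF degree_monom_le])
  ultimately show ?thesis by (simp add: degree_pcompose)
qed

lemma taylor_poly_error:
  assumes D: "\<And>j y. j \<le> k \<Longrightarrow> y \<in> {a..b} \<Longrightarrow> (D j has_real_derivative D (Suc j) y) (at y within {a..b})"
    and B: "\<And>y. y \<in> {a..b} \<Longrightarrow> \<bar>D (Suc k) y\<bar> \<le> B" and x0: "x0 \<in> {a..b}" and y: "y \<in> {a..b}"
  shows "\<bar>D 0 y - poly (taylor_poly D k x0) y\<bar> \<le> B * \<bar>y - x0\<bar> ^ (k + 1)"
proof -
  have B0: "0 \<le> B" using B[OF y] by linarith
  have "norm (D 0 y - (\<Sum>i\<le>k. D i x0 * (y - x0) ^ i / fact i)) \<le> B * norm (y - x0) ^ Suc k / fact k"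
    by (rule field_Taylor[of "{a..b}" k D B]) (use D B x0 y in auto)
  also have "\<dots> \<le> B * norm (y - x0) ^ Suc k / 1"
    using B0 by (intro divide_left_mono mult_nonneg_nonneg) auto
  finally show ?thesis by (simp add: poly_taylor_poly)
qed

section \<open>The symmetric patch and the folded orthogonality\<close>

lemma mesh_size_bounds:
  assumes "mesh a b N x"
  shows "0 < mesh_size N x" "\<And>i. i \<in> {1..N} \<Longrightarrow> x (i + 1) - x i \<le> mesh_size N x"
proof -
  have N: "1 \<le> N" using assms by (simp add: mesh_def)
  show le: "x (i + 1) - x i \<le> mesh_size N x" if "i \<in> {1..N}" for i
    unfolding mesh_size_def using that by (intro Max_ge) auto
  have "0 < x (1 + 1) - x 1" using mesh_less[OF assms, of 1 "1 + 1"] N by simp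
  thus "0 < mesh_size N x" using le[of 1] N by auto
qed

lemma symmetric_patch_reflected_elem:
  assumes "symmetric_patch N x k \<mu> d x0" "i \<in> {1..N}" "x i \<le> x (i + 1)"
    and "cell x i \<inter> {x0 - d..x0 + d} \<noteq> {}"
  obtains i' where "i' \<in> {1..N}" "x i' = 2 * x0 - x (i + 1)" "x (i' + 1) = 2 * x0 - x i"
proof -
  define E where "E = {mesh_elem x i |i. i \<in> {1..N} \<and> mesh_elem x i \<subseteq> enlarged_patch N x k \<mu> d x0}"
  have "mesh_elem x i \<subseteq> patch N x d x0"
    unfolding patch_def using assms(2,4) by (auto simp: mesh_elem_def)
  hence "mesh_elem x i \<in> E" using assms(2) by (auto simp: E_def enlarged_patch_def)
  hence "(\<lambda>y. 2 * x0 - y) ` mesh_elem x i \<in> (\<lambda>K. (\<lambda>y. 2 * x0 - y) ` K) ` E" by (rule imageI)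
  also have "\<dots> = E" using assms(1) by (simp add: symmetric_patch_def E_def Let_def)
  finally obtain i' where i': "i' \<in> {1..N}" "(\<lambda>y. 2 * x0 - y) ` mesh_elem x i = mesh_elem x i'"
    by (auto simp: E_def)
  hence "{2 * x0 - x (i + 1)..2 * x0 - x i} = {x i'..x (i' + 1)}" by (simp add: mesh_elem_def)
  hence "x i' = 2 * x0 - x (i + 1)" "x (i' + 1) = 2 * x0 - x i" using assms(3) by (auto simp: Icc_eq_Icc)
  thus ?thesis using that i'(1) by blast
qed

lemma mesh_inj:
  assumes "mesh a b N x" "i \<in> {1..N + 1}" "j \<in> {1..N + 1}" "x i = x j"
  shows "i = j"
  using mesh_less[OF assms(1), of i j] mesh_less[OF assms(1), of j i] assms by (cases i j rule: linorder_cases) auto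

text \<open>Reflection acts on the node indices near \<open>x0\<close> as \<open>i \<mapsto> c + 1 - i\<close> and on the cells as \<open>i \<mapsto> c - i\<close>,
where \<open>c = 2 m\<close> if \<open>x0\<close> is the midpoint of the cell \<open>m\<close> and \<open>c = 2 m - 1\<close> if \<open>x0\<close> is the node \<open>x m\<close>. Every
cell that meets \<open>{x0 - d..x0 + d}\<close> belongs to the enlarged patch, so its reflection is a cell;
going outwards from \<open>x0\<close>, consecutive cells have consecutive reflections. As every cell has length at
most \<open>h\<close>, at least \<open>J\<close> further cells on either side are reached if \<open>J h \<le> d\<close>.\<close>

lemma symmetric_patch_indices:
  assumes mesh: "mesh a b N x" and h: "h = mesh_size N x" and d: "{x0 - d..x0 + d} \<subseteq> {a<..<b}"
    and sym: "symmetric_patch N x k \<mu> d x0" and J: "real J * h \<le> d" and m: "m \<in> {1..N}" "x m \<le> x0" "x0 < x (m + 1)"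
  defines "c \<equiv> (if x m < x0 then 2 * m else 2 * m - 1)"
  shows "m + J \<le> N" "m + J < c" "\<And>i. i \<in> {c - m - J..m + 1 + J} \<Longrightarrow> x (c + 1 - i) = 2 * x0 - x i"
    "\<And>l y. l \<le> J \<Longrightarrow> y \<in> {x (c - m - l)..x (m + 1 + l)} \<Longrightarrow> \<bar>y - x0\<bar> \<le> real (l + 1) * h"
proof -
  have h0: "0 < h" and hx: "\<And>i. i \<in> {1..N} \<Longrightarrow> x (i + 1) - x i \<le> h"
    using mesh_size_bounds[OF mesh] by (auto simp: h)
  have d0: "0 \<le> d" using J h0 by (meson mult_nonneg_nonneg of_nat_0_le_iff order_trans less_imp_le)
  hence "x0 + d \<in> {x0 - d..x0 + d}" by simp
  hence "x0 + d \<in> {a<..<b}" using d by blast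
  hence db: "x0 + d < b" by simp
  have b: "x (N + 1) = b" using mesh by (simp add: mesh_def)
  have claim: "m + j \<le> N \<and> m + j < c \<and> x (m + j) \<le> x0 + real j * h \<and>
      x (c + 1 - (m + j)) = 2 * x0 - x (m + j) \<and> x (c - (m + j)) = 2 * x0 - x (m + j + 1)" if "j \<le> J" for j
    using that
  proof (induction j)
    case 0
    have "x0 \<in> {x m..x (m + 1)} \<inter> {x0 - d..x0 + d}" using m d0 by auto
    hence "{x m..x (m + 1)} \<inter> {x0 - d..x0 + d} \<noteq> {}" by blast
    from symmetric_patch_reflected_elem[OF sym m(1) _ this] m
    obtain i' where i': "i' \<in> {1..N}" "x i' = 2 * x0 - x (m + 1)" "x (i' + 1) = 2 * x0 - x m" by auto
    show ?case
    proof (cases "x m < x0")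
      case True
      have "i' = m"
      proof (rule ccontr)
        assume "i' \<noteq> m"
        hence "i' + 1 \<le> m \<or> m + 1 \<le> i'" by arith
        hence "x (i' + 1) \<le> x m \<or> x (m + 1) \<le> x i'"
          using mesh_le[OF mesh, of "i' + 1" m] mesh_le[OF mesh, of "m + 1" i'] i'(1) m(1) by auto
        thus False using i' True m by auto
      qed
      thus ?thesis using True i' m by (simp add: c_def)
    next
      case False
      hence x0: "x m = x0" using m by simp
      have "i' + 1 = m" by (rule mesh_inj[OF mesh]) (use i' m x0 in auto)
      thus ?thesis using False x0 i' m by (auto simp: c_def)
    qed
  next
    case (Suc j)
    hence IH: "m + j \<le> N" "m + j < c" "x (m + j) \<le> x0 + real j * h"
      "x (c + 1 - (m + j)) = 2 * x0 - x (m + j)" "x (c - (m + j)) = 2 * x0 - x (m + j + 1)" by auto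
    have up: "x (m + j + 1) \<le> x0 + real (Suc j) * h"
      using hx[of "m + j"] IH m by (simp add: algebra_simps)
    have "real (Suc j) * h \<le> real J * h" using Suc.prems h0 by (intro mult_right_mono) auto
    hence up': "x (m + j + 1) \<le> x0 + d" using up J by linarith
    have "m + j + 1 \<noteq> N + 1" using up' db b by auto
    hence le: "m + j + 1 \<in> {1..N}" using IH by simp
    have "x (m + 1) \<le> x (m + j + 1)" using le m by (intro mesh_le[OF mesh]) auto
    hence low: "x0 \<le> x (m + j + 1)" using m by linarith
    have inc: "x (m + j + 1) < x (m + j + 1 + 1)" using mesh_less[OF mesh, of "m + j + 1" "m + j + 1 + 1"] le by auto
    have "x (m + j + 1) \<in> {x (m + j + 1)..x (m + j + 1 + 1)} \<inter> {x0 - d..x0 + d}"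
      using inc low up' d0 by auto
    hence "{x (m + j + 1)..x (m + j + 1 + 1)} \<inter> {x0 - d..x0 + d} \<noteq> {}" by blast
    from symmetric_patch_reflected_elem[OF sym le _ this] inc
    obtain i' where i': "i' \<in> {1..N}" "x i' = 2 * x0 - x (m + j + 1 + 1)" "x (i' + 1) = 2 * x0 - x (m + j + 1)" by auto
    have "c - (m + j) \<in> {1..N + 1}"
    proof -
      have "c \<le> 2 * m" by (auto simp: c_def)
      thus ?thesis using IH m by auto
    qed
    hence "i' + 1 = c - (m + j)" using i' IH by (intro mesh_inj[OF mesh]) auto
    hence "i' = c - (m + Suc j)" "m + Suc j < c" "c + 1 - (m + Suc j) = i' + 1" using i'(1) by auto
    thus ?case using i' le up by auto
  qed
  show mJ: "m + J \<le> N" "m + J < c" using claim[of J] by auto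
  have ci: "c = 2 * m \<or> c = 2 * m - 1" by (auto simp: c_def)
  have right: "x (c + 1 - i) = 2 * x0 - x i" if "i \<in> {m..m + 1 + J}" for i
  proof (cases "i = m + 1 + J")
    case True
    thus ?thesis using claim[of J] by simp
  next
    case False
    define j where "j = i - m"
    have "i = m + j" "j \<le> J" using that False by (auto simp: j_def)
    thus ?thesis using claim[of j] by simp
  qed
  show "x (c + 1 - i) = 2 * x0 - x i" if i: "i \<in> {c - m - J..m + 1 + J}" for i
  proof (cases "m \<le> i")
    case True thus ?thesis using right i by auto
  next
    case False
    hence "c + 1 - i \<in> {m..m + 1 + J}" using i mJ ci m(1) by auto
    from right[OF this] have "x (c + 1 - (c + 1 - i)) = 2 * x0 - x (c + 1 - i)" .
    moreover have "c + 1 - (c + 1 - i) = i" using False ci m(1) by auto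
    ultimately show ?thesis by simp
  qed
  show "\<bar>y - x0\<bar> \<le> real (l + 1) * h" if l: "l \<le> J" and y: "y \<in> {x (c - m - l)..x (m + 1 + l)}" for l y
  proof -
    have "x (m + l) \<le> x0 + real l * h" using claim[OF l] by auto
    moreover have "x (m + l + 1) - x (m + l) \<le> h" using hx[of "m + l"] l mJ m by simp
    ultimately have "x (m + 1 + l) \<le> x0 + real (l + 1) * h" by (simp add: algebra_simps)
    moreover have "x (c - m - l) = 2 * x0 - x (m + 1 + l)" using claim[OF l] by simp
    ultimately show ?thesis using y unfolding abs_le_iff atLeastAtMost_iff by linarith
  qed
qed

text \<open>Where the test spline is constant the integral of \<open>E\<close> telescopes to nodal values of the error, so
that only the cells in between remain.\<close>

lemma constant_extension_identity:
  fixes E :: "nat \<Rightarrow> real \<Rightarrow> real" and e :: "nat \<Rightarrow> real" and Q :: "nat \<Rightarrow> real poly"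
  assumes intE: "\<And>i. i \<in> {1..N} \<Longrightarrow> integral (cell x i) (E i) = e (i + 1) - e i"
    and e0: "e 1 = 0" "e (N + 1) = 0" and pq: "1 \<le> p" "p \<le> q" "q \<le> N + 1"
    and orth: "(\<Sum>i\<in>{1..N}. integral (cell x i) (\<lambda>y. E i y * poly (Q i) y)) = 0"
    and Q: "\<And>i. i < p \<Longrightarrow> Q i = [:\<alpha>:]" "\<And>i. q \<le> i \<Longrightarrow> Q i = [:\<beta>:]"
  shows "(\<Sum>i\<in>{p..<q}. integral (cell x i) (\<lambda>y. E i y * poly (Q i) y)) = \<beta> * e q - \<alpha> * e p"
proof -
  define I where "I i = integral (cell x i) (\<lambda>y. E i y * poly (Q i) y)" for i
  have tele: "(\<Sum>i\<in>{s..<t}. integral (cell x i) (\<lambda>y. E i y * \<gamma>)) = \<gamma> * (e t - e s)"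
    if "1 \<le> s" "s \<le> t" "t \<le> N + 1" for s t \<gamma>
  proof -
    have "(\<Sum>i\<in>{s..<t}. integral (cell x i) (\<lambda>y. E i y * \<gamma>)) = (\<Sum>i\<in>{s..<t}. (e (Suc i) - e i) * \<gamma>)"
    proof (rule sum.cong[OF refl])
      fix i assume "i \<in> {s..<t}"
      hence "i \<in> {1..N}" using that by auto
      from intE[OF this] show "integral (cell x i) (\<lambda>y. E i y * \<gamma>) = (e (Suc i) - e i) * \<gamma>" by simp
    qed
    also have "\<dots> = (e t - e s) * \<gamma>" using sum_Suc_diff'[OF that(2), of e] by (simp add: sum_distrib_right[symmetric])
    finally show ?thesis by simp
  qed
  have "0 = (\<Sum>i\<in>{1..<p}. I i) + (\<Sum>i\<in>{p..<q}. I i) + (\<Sum>i\<in>{q..<N + 1}. I i)"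
  proof -
    have "{1..N} = {1..<N + 1}" by auto
    hence "(\<Sum>i\<in>{1..<N + 1}. I i) = 0" using orth by (simp only: I_def)
    moreover have "(\<Sum>i\<in>{1..<p}. I i) + (\<Sum>i\<in>{p..<q}. I i) = (\<Sum>i\<in>{1..<q}. I i)"
      "(\<Sum>i\<in>{1..<q}. I i) + (\<Sum>i\<in>{q..<N + 1}. I i) = (\<Sum>i\<in>{1..<N + 1}. I i)"
      using pq by (simp_all only: sum.atLeastLessThan_concat[of 1 p q I] sum.atLeastLessThan_concat[of 1 q "N + 1" I])
    ultimately show ?thesis by simp
  qed
  also have "(\<Sum>i\<in>{1..<p}. I i) = (\<Sum>i\<in>{1..<p}. integral (cell x i) (\<lambda>y. E i y * \<alpha>))"
    using Q(1) by (intro sum.cong) (auto simp: I_def)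
  also have "\<dots> = \<alpha> * e p" using tele[of 1 p \<alpha>] pq e0 by simp
  also have "(\<Sum>i\<in>{q..<N + 1}. I i) = (\<Sum>i\<in>{q..<N + 1}. integral (cell x i) (\<lambda>y. E i y * \<beta>))"
    using Q(2) by (intro sum.cong) (auto simp: I_def)
  also have "\<dots> = - (\<beta> * e q)" using tele[of q "N + 1" \<beta>] pq e0 by simp
  finally show ?thesis by (simp add: I_def)
qed

text \<open>The reflection of a spline that is constant on both sides of the range is again a spline, with the
two constants exchanged. Substituting \<open>2 x0 - y\<close> in the identity for the reflected test spline moves
the reflection onto \<open>E\<close>.\<close>

lemma symmetrized_identity:
  fixes E :: "nat \<Rightarrow> real \<Rightarrow> real" and e :: "nat \<Rightarrow> real" and Q :: "nat \<Rightarrow> real poly"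
  assumes intE: "\<And>i. i \<in> {1..N} \<Longrightarrow> integral (cell x i) (E i) = e (i + 1) - e i"
    and contE: "\<And>i. i \<in> {1..N} \<Longrightarrow> continuous_on (cell x i) (E i)"
    and e0: "e 1 = 0" "e (N + 1) = 0" and pq: "1 \<le> p" "p \<le> q" "q \<le> N + 1" "p + q = c + 1"
    and orth: "\<And>Q. (\<And>i. i \<in> {1..N} \<Longrightarrow> degree (Q i) \<le> n) \<Longrightarrow>
        (\<And>i. i \<in> {2..N} \<Longrightarrow> joined x \<mu> Q i) \<Longrightarrow>
        (\<Sum>i\<in>{1..N}. integral (cell x i) (\<lambda>y. E i y * poly (Q i) y)) = 0"
    and xrefl: "\<And>i. i \<in> {p..q} \<Longrightarrow> x (c + 1 - i) = 2 * x0 - x i"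
    and Q: "\<And>i. i < p \<Longrightarrow> Q i = [:\<alpha>:]" "\<And>i. q \<le> i \<Longrightarrow> Q i = [:\<beta>:]" "\<And>i. degree (Q i) \<le> n"
      "\<And>i. i \<in> {p..q} \<Longrightarrow> joined x \<mu> Q i"
  shows "(\<Sum>i\<in>{p..<q}. integral (cell x i) (\<lambda>y. (E i y - \<tau> * E (c - i) (2 * x0 - y)) * poly (Q i) y))
     = \<beta> * e q - \<alpha> * e p - \<tau> * (\<alpha> * e q - \<beta> * e p)"
proof -
  have id1: "(\<Sum>i\<in>{p..<q}. integral (cell x i) (\<lambda>y. E i y * poly (Q i) y)) = \<beta> * e q - \<alpha> * e p"
  proof (rule constant_extension_identity[OF intE e0 pq(1-3) orth Q(1,2)])
    fix i assume i: "i \<in> {2..N}"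
    consider "i < p" | "i \<in> {p..q}" | "q < i" by fastforce
    thus "joined x \<mu> Q i"
    proof cases
      case 1 thus ?thesis using Q(1)[of i] Q(1)[of "i - 1"] by simp
    next
      case 3 thus ?thesis using Q(2)[of i] Q(2)[of "i - 1"] by simp
    qed (rule Q(4))
  qed (auto intro: Q(3))
  define R where "R i = (if i \<le> c then reflect_poly_about x0 (Q (c - i)) else [:\<alpha>:])" for i
  have rc: "reflect_poly_about x0 [:\<gamma>:] = [:\<gamma>:]" for \<gamma> by (simp add: reflect_poly_about_def)
  have R1: "R i = [:\<beta>:]" if "i < p" for i
  proof -
    have "i \<le> c" "q \<le> c - i" using that pq by auto
    thus ?thesis using Q(2)[of "c - i"] rc by (simp add: R_def)
  qed
  have R2: "R i = [:\<alpha>:]" if "q \<le> i" for i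
  proof (cases "i \<le> c")
    case True
    hence "c - i < p" using that pq by auto
    thus ?thesis using True Q(1)[of "c - i"] rc by (simp add: R_def)
  qed (simp add: R_def)
  have id2: "(\<Sum>i\<in>{p..<q}. integral (cell x i) (\<lambda>y. E i y * poly (R i) y)) = \<alpha> * e q - \<beta> * e p"
  proof (rule constant_extension_identity[OF intE e0 pq(1-3) orth R1 R2])
    fix i assume i: "i \<in> {2..N}"
    consider "i < p" | "i \<in> {p..q}" | "q < i" by fastforce
    thus "joined x \<mu> R i"
    proof cases
      case 1 thus ?thesis using R1[of i] R1[of "i - 1"] by simp
    next
      case 3 thus ?thesis using R2[of i] R2[of "i - 1"] by simp
    next
      case 2
      define i' where "i' = c + 1 - i"
      have i': "i' \<in> {p..q}" "c - i = i' - 1" "c - (i - 1) = i'" "i \<le> c" "i - 1 \<le> c"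
        using 2 pq by (auto simp: i'_def)
      have "[:- x i', 1:] ^ \<mu> dvd Q i' - Q (i' - 1)" using i'(1) by (rule Q(4))
      hence "[:- (2 * x0 - x i'), 1:] ^ \<mu> dvd reflect_poly_about x0 (Q i' - Q (i' - 1))"
        by (rule dvd_reflect_about)
      moreover have "2 * x0 - x i' = x i" using xrefl[OF 2] by (simp add: i'_def)
      moreover have "R i - R (i - 1) = - reflect_poly_about x0 (Q i' - Q (i' - 1))"
      proof -
        have "R i = reflect_poly_about x0 (Q (i' - 1))" "R (i - 1) = reflect_poly_about x0 (Q i')"
          unfolding R_def using i'(2-5) by presburger+
        thus ?thesis by (simp add: reflect_about_diff)
      qed
      ultimately show ?thesis by (simp only: dvd_minus_iff)
    qed
  qed (auto simp: R_def intro: Q(3))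
  have swap: "(\<Sum>i\<in>{p..<q}. integral (cell x i) (\<lambda>y. E i y * poly (R i) y)) =
     (\<Sum>i\<in>{p..<q}. integral (cell x i) (\<lambda>y. E (c - i) (2 * x0 - y) * poly (Q i) y))"
  proof (rule sum.reindex_bij_witness[of _ "\<lambda>i. c - i" "\<lambda>i. c - i"])
    fix i assume i: "i \<in> {p..<q}"
    show ii: "c - i \<in> {p..<q}" and cc: "c - (c - i) = i" using i pq by auto
    have N: "i \<in> {1..N}" using i pq by auto
    have e1: "x (c - i) = 2 * x0 - x (i + 1)"
      using xrefl[of "i + 1"] i by simp
    have e2: "x (c - i + 1) = 2 * x0 - x i"
    proof -
      have "c + 1 - i = c - i + 1" using i pq by auto
      thus ?thesis using xrefl[of i] i by simp
    qed
    have "integral {2 * x0 - x (i + 1)..2 * x0 - x i} (\<lambda>y. E i (2 * x0 - y) * poly (R i) (2 * x0 - y))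
        = integral (cell x i) (\<lambda>y. E i y * poly (R i) y)"
      by (rule integral_reflect_about) (intro continuous_intros contE N)
    moreover have "R i = reflect_poly_about x0 (Q (c - i))" using i pq by (simp add: R_def)
    ultimately show "integral {x (c - i)..x (c - i + 1)} (\<lambda>y. E (c - (c - i)) (2 * x0 - y) * poly (Q (c - i)) y)
        = integral (cell x i) (\<lambda>y. E i y * poly (R i) y)"
      unfolding e1 e2 cc by simp
  qed (use pq in auto)
  have contE': "continuous_on (cell x i) (\<lambda>y. E (c - i) (2 * x0 - y))" if i: "i \<in> {p..<q}" for i
  proof -
    have "c - i \<in> {1..N}" using i pq by auto
    from contE[OF this] show ?thesis
    proof (rule continuous_on_compose2)
      have "c + 1 - i = c - i + 1" using i pq by auto
      thus "(\<lambda>y. 2 * x0 - y) ` (cell x i) \<subseteq> {x (c - i)..x (c - i + 1)}"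
        using xrefl[of "i + 1"] xrefl[of i] i by auto
    qed (intro continuous_intros)
  qed
  have "(\<Sum>i\<in>{p..<q}. integral (cell x i) (\<lambda>y. (E i y - \<tau> * E (c - i) (2 * x0 - y)) * poly (Q i) y)) =
     (\<Sum>i\<in>{p..<q}. integral (cell x i) (\<lambda>y. E i y * poly (Q i) y)
        - \<tau> * integral (cell x i) (\<lambda>y. E (c - i) (2 * x0 - y) * poly (Q i) y))"
  proof (rule sum.cong[OF refl])
    fix i assume i: "i \<in> {p..<q}"
    hence N: "i \<in> {1..N}" using pq by auto
    have "integral (cell x i) (\<lambda>y. (E i y - \<tau> * E (c - i) (2 * x0 - y)) * poly (Q i) y)
      = integral (cell x i) (\<lambda>y. E i y * poly (Q i) y - \<tau> * (E (c - i) (2 * x0 - y) * poly (Q i) y))"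
      by (simp add: algebra_simps)
    also have "\<dots> = integral (cell x i) (\<lambda>y. E i y * poly (Q i) y)
        - integral (cell x i) (\<lambda>y. \<tau> * (E (c - i) (2 * x0 - y) * poly (Q i) y))"
      by (intro integral_diff integrable_continuous_real continuous_intros contE contE' N i)
    finally show "integral (cell x i) (\<lambda>y. (E i y - \<tau> * E (c - i) (2 * x0 - y)) * poly (Q i) y)
      = integral (cell x i) (\<lambda>y. E i y * poly (Q i) y)
        - \<tau> * integral (cell x i) (\<lambda>y. E (c - i) (2 * x0 - y) * poly (Q i) y)" by simp
  qed
  also have "\<dots> = \<beta> * e q - \<alpha> * e p - \<tau> * (\<alpha> * e q - \<beta> * e p)"
    using id1 id2 swap by (simp add: sum_subtractf sum_distrib_left[symmetric])
  finally show ?thesis .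
qed

section \<open>The error on a single mesh\<close>

lemma higher_pderiv_dvd:
  fixes r :: "real poly"
  assumes "[:- c, 1:] ^ (m + j) dvd r"
  shows "[:- c, 1:] ^ m dvd (pderiv ^^ j) r"
  using assms
proof (induction j arbitrary: m)
  case (Suc j)
  hence "[:- c, 1:] ^ Suc m dvd (pderiv ^^ j) r" by (intro Suc.IH) simp
  thus ?case by (simp only: funpow.simps o_apply dvd_pderiv_of_dvd)
qed simp

lemma MVT_bound:
  fixes f :: "real \<Rightarrow> real"
  assumes "s \<le> t" "continuous_on {s..t} f"
    and "\<And>y. s < y \<Longrightarrow> y < t \<Longrightarrow> \<exists>D. (f has_real_derivative D) (at y) \<and> \<bar>D\<bar> \<le> B"
  shows "\<bar>f t - f s\<bar> \<le> B * (t - s)"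
proof (cases "s = t")
  case False
  hence "s < t" using assms(1) by simp
  obtain l z where z: "s < z" "z < t" "(f has_real_derivative l) (at z)" "f t - f s = (t - s) * l"
    using MVT[OF \<open>s < t\<close> assms(2)] assms(3) by (metis real_differentiable_def)
  obtain D where D: "(f has_real_derivative D) (at z)" "\<bar>D\<bar> \<le> B" using assms(3) z by blast
  have "l = D" using z D DERIV_unique by blast
  thus ?thesis using z D \<open>s < t\<close> by (simp add: abs_mult mult.commute)
qed simp

text \<open>\<open>D j\<close> is the derivative of order \<open>j\<close> of \<open>u'\<close> and \<open>P i\<close> the piece of \<open>uh\<close> on the cell \<open>i\<close>. The constants
\<open>M\<close> and \<open>\<delta>\<close> are meant to be the same for all meshes of the family; no bound below may depend on the
mesh except through \<open>h\<close>.\<close>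

locale galerkin_error =
  fixes a b :: real and N :: nat and x :: "nat \<Rightarrow> real" and k \<mu> :: nat and u uh :: "real \<Rightarrow> real"
    and D :: "nat \<Rightarrow> real \<Rightarrow> real" and M \<delta> h :: real and P :: "nat \<Rightarrow> real poly"
  assumes mesh: "mesh a b N x" and ab: "a < b" and k: "1 \<le> k" and \<mu>: "\<mu> \<le> k - 1"
    and D: "\<And>j y. j \<le> k \<Longrightarrow> y \<in> {a..b} \<Longrightarrow> (D j has_real_derivative D (Suc j) y) (at y within {a..b})"
    and M: "\<And>j y. j \<le> Suc k \<Longrightarrow> y \<in> {a..b} \<Longrightarrow> \<bar>D j y\<bar> \<le> M"
    and u: "continuous_on {a..b} u" "u a = 0" "u b = 0"
    and du: "\<And>y. y \<in> {a<..<b} \<Longrightarrow> (u has_real_derivative D 0 y) (at y)"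
    and Pdeg: "\<And>i. i \<in> {1..N} \<Longrightarrow> degree (P i) \<le> k"
    and uh_eq: "\<And>i y. i \<in> {1..N} \<Longrightarrow> y \<in> cell x i \<Longrightarrow> uh y = poly (P i) y"
    and Pdvd: "\<And>i. i \<in> {2..N} \<Longrightarrow> [:- x i, 1:] ^ Suc \<mu> dvd P i - P (i - 1)"
    and int_error: "\<And>i. i \<in> {1..N} \<Longrightarrow> integral (cell x i) (\<lambda>y. D 0 y - poly (pderiv (P i)) y) =
        (u (x (i + 1)) - uh (x (i + 1))) - (u (x i) - uh (x i))"
    and orthogonality: "\<And>Q. (\<And>i. i \<in> {1..N} \<Longrightarrow> degree (Q i) \<le> k - 1) \<Longrightarrow>
        (\<And>i. i \<in> {2..N} \<Longrightarrow> joined x \<mu> Q i) \<Longrightarrow>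
        (\<Sum>i\<in>{1..N}. integral (cell x i) (\<lambda>y. (D 0 y - poly (pderiv (P i)) y) * poly (Q i) y)) = 0"
    and uh0: "uh a = 0" "uh b = 0"
    and \<delta>: "0 < \<delta>" and h_def: "h = mesh_size N x"
    and quasi_uniform: "\<And>i. i \<in> {1..N} \<Longrightarrow> \<delta> * h \<le> x (i + 1) - x i"
begin

abbreviation U :: "nat \<Rightarrow> real poly" where "U i \<equiv> pderiv (P i)"

definition err :: "real \<Rightarrow> real" where "err y = u y - uh y"

definition E :: "nat \<Rightarrow> real \<Rightarrow> real" where "E i y = D 0 y - poly (U i) y"

lemma N: "1 \<le> N" "x 1 = a" "x (N + 1) = b" using mesh by (auto simp: mesh_def)

lemma h_pos: "0 < h" and elem_le_h: "i \<in> {1..N} \<Longrightarrow> x (i + 1) - x i \<le> h"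
  using mesh_size_bounds[OF mesh] by (auto simp: h_def)

lemma elem: "i \<in> {1..N} \<Longrightarrow> x i < x (i + 1)" "i \<in> {1..N} \<Longrightarrow> a \<le> x i" "i \<in> {1..N} \<Longrightarrow> x (i + 1) \<le> b"
  using mesh_less[OF mesh, of i "i + 1"] mesh_bounds[OF mesh, of i] mesh_bounds[OF mesh, of "i + 1"] by auto

lemma M0: "0 \<le> M" using M[of 0 a] ab by auto

lemma D0_cont: "continuous_on {a..b} (D 0)"
  using D[of 0] by (intro DERIV_continuous_on) auto

lemma D_at: "j \<le> k \<Longrightarrow> y \<in> {a<..<b} \<Longrightarrow> (D j has_real_derivative D (Suc j) y) (at y)"
  using D[of j y] at_within_interior[of y "{a..b}"] by simp

lemma D0_cont_elem: "i \<in> {1..N} \<Longrightarrow> continuous_on (cell x i) (D 0)"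
  using continuous_on_subset[OF D0_cont] mesh_elem_subset[OF mesh] by blast

lemma E_cont: "i \<in> {1..N} \<Longrightarrow> continuous_on (cell x i) (E i)"
  unfolding E_def by (intro continuous_intros D0_cont_elem)

lemma U_deg: "i \<in> {1..N} \<Longrightarrow> degree (U i) \<le> k - 1"
  using Pdeg[of i] by (auto simp: degree_pderiv)

lemma U_dvd: "i \<in> {2..N} \<Longrightarrow> joined x \<mu> U i"
  using dvd_pderiv_of_dvd[OF Pdvd] by (simp add: pderiv_diff)

lemma err_deriv:
  assumes "i \<in> {1..N}" "y \<in> {x i<..<x (i + 1)}"
  shows "(err has_real_derivative E i y) (at y)"
proof -
  have "y \<in> {a<..<b}" using elem[OF assms(1)] assms(2) by auto
  moreover have "(uh has_real_derivative poly (U i) y) (at y)"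
    by (rule has_field_derivative_transform_within_open[OF poly_DERIV open_greaterThanLessThan assms(2)])
       (use uh_eq assms(1) in auto)
  ultimately show ?thesis unfolding E_def err_def[abs_def] by (intro DERIV_diff du)
qed

lemma err_cont:
  assumes "i \<in> {1..N}"
  shows "continuous_on (cell x i) err"
proof -
  have "continuous_on (cell x i) u"
    using continuous_on_subset[OF u(1)] mesh_elem_subset[OF mesh assms] by blast
  moreover have "continuous_on (cell x i) uh"
    by (rule continuous_on_eq[of _ "poly (P i)"]) (use uh_eq assms in \<open>auto intro: continuous_intros\<close>)
  ultimately show ?thesis unfolding err_def[abs_def] by (intro continuous_intros)
qed

text \<open>Stability of the Galerkin projection: test with \<open>uh\<close> itself.\<close>

lemma energy_U_le: "energy x U 1 (N + 1) \<le> M\<^sup>2 * (b - a)"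
proof -
  have set: "{1..<N + 1} = {1..N}" by auto
  have "0 = (\<Sum>i\<in>{1..N}. integral (cell x i) (\<lambda>y. (D 0 y - poly (U i) y) * poly (U i) y))"
    using orthogonality[of U, OF U_deg U_dvd] by simp
  also have "\<dots> \<le> (\<Sum>i\<in>{1..N}. 1/2 * integral (cell x i) (\<lambda>y. (D 0 y)\<^sup>2) - 1/2 * sqnorm (cell x i) (U i))"
    by (intro sum_mono element_estimate(2) D0_cont_elem)
  also have "\<dots> = 1/2 * (\<Sum>i\<in>{1..N}. integral (cell x i) (\<lambda>y. (D 0 y)\<^sup>2)) - 1/2 * energy x U 1 (N + 1)"
    unfolding energy_def set sum_distrib_left by (rule sum_subtractf)
  finally have "energy x U 1 (N + 1) \<le> (\<Sum>i\<in>{1..N}. integral (cell x i) (\<lambda>y. (D 0 y)\<^sup>2))" by simp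
  also have "\<dots> \<le> (\<Sum>i\<in>{1..N}. M\<^sup>2 * (x (Suc i) - x i))"
  proof (rule sum_mono)
    fix i assume i: "i \<in> {1..N}"
    have "integral (cell x i) (\<lambda>y. (D 0 y)\<^sup>2) \<le> integral (cell x i) (\<lambda>y. M\<^sup>2)"
    proof (intro integral_le integrable_continuous_real continuous_intros D0_cont_elem i)
      fix y assume "y \<in> cell x i"
      hence "\<bar>D 0 y\<bar> \<le> M" using M[of 0 y] elem[OF i] by auto
      hence "\<bar>D 0 y\<bar>\<^sup>2 \<le> M\<^sup>2" by (intro power_mono) auto
      thus "(D 0 y)\<^sup>2 \<le> M\<^sup>2" by simp
    qed
    thus "integral (cell x i) (\<lambda>y. (D 0 y)\<^sup>2) \<le> M\<^sup>2 * (x (Suc i) - x i)"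
      using elem[OF i] by (simp add: mult.commute)
  qed
  also have "\<dots> = M\<^sup>2 * (b - a)"
    using sum_Suc_diff[of 1 N x] N by (simp add: sum_distrib_left[symmetric])
  finally show ?thesis .
qed

lemma uh_eq_pw:
  assumes "y \<in> {a..<b}"
  shows "uh y = pw x N P y"
proof -
  obtain j where j: "j \<in> {1..N}" "x j \<le> y" "y < x (j + 1)"
    by (rule mesh_elem_containing[OF mesh assms])
  thus ?thesis using uh_eq[OF j(1), of y] pw_on_elem[OF mesh j(1), of y P] by auto
qed

text \<open>At a node the two pieces of \<open>uh\<close> share the derivatives up to the order \<open>\<mu>\<close>, so that those of the
right piece represent the derivatives of \<open>uh\<close>.\<close>

lemma higher_deriv_err:
  assumes m: "m \<in> {1..N}" "x m \<le> x0" "x0 < x (m + 1)" "a < x0"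
    and s: "x m < x0 \<and> Suc j \<le> k \<or> x0 = x m \<and> Suc j \<le> \<mu>"
  shows "(deriv ^^ Suc j) err x0 = D j x0 - poly ((pderiv ^^ j) (U m)) x0"
proof -
  have U_eq: "(pderiv ^^ j) (U m) = (pderiv ^^ Suc j) (P m)" for j by (simp add: funpow_swap1)
  show ?thesis
  proof (cases "x m < x0")
    case True
    define V where "V l = (case l of 0 \<Rightarrow> err | Suc i \<Rightarrow> (\<lambda>y. D i y - poly ((pderiv ^^ Suc i) (P m)) y))" for l
    have "(deriv ^^ Suc j) (V 0) x0 = V (Suc j) x0"
    proof (rule deriv_iterate_eq[of "{x m<..<x (m + 1)}"])
      fix l y assume l: "l < Suc j" and y: "y \<in> {x m<..<x (m + 1)}"
      have y': "y \<in> {a<..<b}" using y elem[OF m(1)] by auto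
      show "(V l has_real_derivative V (Suc l) y) (at y)"
      proof (cases l)
        case 0
        thus ?thesis using err_deriv[OF m(1) y] by (simp add: V_def E_def)
      next
        case (Suc i)
        have "i \<le> k" using l s Suc True by auto
        from D_at[OF this y'] have "((\<lambda>y. D i y - poly ((pderiv ^^ Suc i) (P m)) y) has_real_derivative
            D (Suc i) y - poly (pderiv ((pderiv ^^ Suc i) (P m))) y) (at y)"
          by (intro DERIV_diff poly_DERIV)
        thus ?thesis using Suc by (simp add: V_def)
      qed
    qed (use True m in auto)
    thus ?thesis unfolding U_eq by (simp add: V_def del: funpow.simps)
  next
    case False
    hence x0: "x0 = x m" and j\<mu>: "Suc j \<le> \<mu>" using s by auto
    define V where "V l = (case l of 0 \<Rightarrow> err | Suc i \<Rightarrow> (\<lambda>y. D i y - pw x N (\<lambda>l. (pderiv ^^ Suc i) (P l)) y))" for l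
    have dpw: "(pw x N (\<lambda>i. (pderiv ^^ l) (P i)) has_real_derivative pw x N (\<lambda>i. (pderiv ^^ Suc l) (P i)) y) (at y)"
      if "l \<le> j" for l y
    proof -
      have "(pw x N (\<lambda>i. (pderiv ^^ l) (P i)) has_real_derivative pw x N (\<lambda>i. pderiv ((pderiv ^^ l) (P i))) y) (at y)"
      proof (rule pw_has_derivative)
        fix i assume i: "i \<in> {2..N}"
        have "[:- x i, 1:] ^ (2 + l) dvd [:- x i, 1:] ^ Suc \<mu>"
          using that j\<mu> by (intro le_imp_power_dvd) auto
        hence "[:- x i, 1:] ^ (2 + l) dvd P i - P (i - 1)" using Pdvd[OF i] by (rule dvd_trans)
        hence "[:- x i, 1:] ^ 2 dvd (pderiv ^^ l) (P i - P (i - 1))" by (rule higher_pderiv_dvd)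
        thus "[:- x i, 1:] ^ 2 dvd (pderiv ^^ l) (P i) - (pderiv ^^ l) (P (i - 1))"
          by (simp add: higher_pderiv_diff)
      qed
      thus ?thesis by simp
    qed
    have "(deriv ^^ Suc j) (V 0) x0 = V (Suc j) x0"
    proof (rule deriv_iterate_eq[of "{a<..<b}"])
      fix l y assume l: "l < Suc j" and y: "y \<in> {a<..<b}"
      show "(V l has_real_derivative V (Suc l) y) (at y)"
      proof (cases l)
        case 0
        have "(pw x N P has_real_derivative pw x N (\<lambda>i. (pderiv ^^ Suc 0) (P i)) y) (at y)"
          using dpw[of 0 y] by simp
        hence "(uh has_real_derivative pw x N (\<lambda>i. (pderiv ^^ Suc 0) (P i)) y) (at y)"
          by (rule has_field_derivative_transform_within_open[OF _ open_greaterThanLessThan y])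
             (use uh_eq_pw in auto)
        thus ?thesis using 0 du[OF y] unfolding V_def err_def[abs_def] by (auto intro: DERIV_diff)
      next
        case (Suc i)
        have i: "i \<le> k" "Suc i \<le> j" using l j\<mu> \<mu> Suc by auto
        from D_at[OF i(1) y] dpw[OF i(2), of y]
        have "((\<lambda>y. D i y - pw x N (\<lambda>l. (pderiv ^^ Suc i) (P l)) y) has_real_derivative
            D (Suc i) y - pw x N (\<lambda>l. (pderiv ^^ Suc (Suc i)) (P l)) y) (at y)"
          by (intro DERIV_diff)
        thus ?thesis using Suc by (simp add: V_def)
      qed
    qed (use elem[OF m(1)] m in auto)
    moreover have "pw x N (\<lambda>l. (pderiv ^^ Suc j) (P l)) x0 = poly ((pderiv ^^ Suc j) (P m)) x0"
      using m by (intro pw_on_elem[OF mesh m(1)]) auto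
    ultimately show ?thesis unfolding U_eq by (simp add: V_def del: funpow.simps)
  qed
qed

text \<open>For coarse meshes, stability and the inverse estimate with the fixed lower bound \<open>h0\<close> for \<open>h\<close> bound
\<open>(u - uh)'\<close> and its higher derivatives on every cell; the error itself is then integrated from \<open>a\<close>.\<close>

lemma crude_bound:
  assumes inv: "inverse_constant (k - 1) \<delta> K"
    and K: "0 < K" and h0: "0 < h0" "h0 \<le> 1" "h0 \<le> h"
    and m: "m \<in> {1..N}" "x m \<le> x0" "x0 < x (m + 1)" "a < x0"
    and s: "x m < x0 \<and> s \<le> k \<or> x0 = x m \<and> s \<le> \<mu>"
  shows "\<bar>(deriv ^^ s) err x0\<bar> \<le> (M + sqrt (K * (M\<^sup>2 * (b - a)) / h0 ^ (2 * k))) * (1 + (b - a))"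
proof -
  define B where "B = sqrt (K * (M\<^sup>2 * (b - a)) / h0 ^ (2 * k))"
  have B0: "0 \<le> B" using K ab h0 by (simp add: B_def)
  have U_bd: "\<bar>poly ((pderiv ^^ j) (U i)) y\<bar> \<le> B" if i: "i \<in> {1..N}" and y: "y \<in> cell x i" and j: "j \<le> k - 1" for i y j
  proof -
    have "h0 ^ (2 * k) \<le> h0 ^ (2 * j + 1)" using h0 j k by (intro power_decreasing) auto
    also have "\<dots> \<le> h ^ (2 * j + 1)" using h0 by (intro power_mono) auto
    finally have "(poly ((pderiv ^^ j) (U i)) y)\<^sup>2 * h0 ^ (2 * k) \<le> (poly ((pderiv ^^ j) (U i)) y)\<^sup>2 * h ^ (2 * j + 1)"
      by (intro mult_left_mono) auto
    also have "\<dots> \<le> K * sqnorm (cell x i) (U i)"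
      by (rule inv[unfolded inverse_constant_def, rule_format])
         (use h_pos U_deg quasi_uniform elem_le_h i y j in auto)
    also have "\<dots> \<le> K * energy x U 1 (N + 1)"
      using K i by (intro mult_left_mono energy_element_le) auto
    also have "\<dots> \<le> K * (M\<^sup>2 * (b - a))" using K energy_U_le by (intro mult_left_mono) auto
    finally have "(poly ((pderiv ^^ j) (U i)) y)\<^sup>2 \<le> K * (M\<^sup>2 * (b - a)) / h0 ^ (2 * k)"
      using h0 by (simp add: pos_le_divide_eq)
    thus ?thesis unfolding B_def by (metis real_sqrt_abs real_sqrt_le_iff)
  qed
  have x0: "x0 \<in> {a..b}" using m elem[OF m(1)] by auto
  show ?thesis
  proof (cases s)
    case (Suc j)
    have jk: "j \<le> k - 1" using s Suc \<mu> k by auto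
    have "(deriv ^^ s) err x0 = D j x0 - poly ((pderiv ^^ j) (U m)) x0"
      unfolding Suc by (rule higher_deriv_err[OF m]) (use s Suc in auto)
    moreover have "\<bar>D j x0\<bar> \<le> M" using M[of j x0] jk x0 by auto
    moreover have "\<bar>poly ((pderiv ^^ j) (U m)) x0\<bar> \<le> B" using m jk by (intro U_bd) auto
    ultimately have "\<bar>(deriv ^^ s) err x0\<bar> \<le> M + B"
      using abs_triangle_ineq4[of "D j x0" "poly ((pderiv ^^ j) (U m)) x0"] by simp
    also have "M + B = (M + B) * 1" by simp
    also have "\<dots> \<le> (M + B) * (1 + (b - a))" using M0 B0 ab by (intro mult_left_mono) auto
    finally show ?thesis by (simp add: B_def)
  next
    case 0
    have E_bd: "\<bar>E i y\<bar> \<le> M + B" if i: "i \<in> {1..N}" and y: "y \<in> cell x i" for i y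
    proof -
      have "\<bar>D 0 y\<bar> \<le> M" using M[of 0 y] elem[OF i] y by auto
      moreover have "\<bar>poly (U i) y\<bar> \<le> B" using U_bd[OF i y, of 0] by simp
      ultimately show ?thesis unfolding E_def by linarith
    qed
    have step: "\<bar>err t - err (x i)\<bar> \<le> (M + B) * (t - x i)" if i: "i \<in> {1..N}" and t: "t \<in> cell x i" for i t
    proof (rule MVT_bound)
      show "continuous_on {x i..t} err" by (rule continuous_on_subset[OF err_cont[OF i]]) (use t in auto)
      show "\<exists>D. (err has_real_derivative D) (at y) \<and> \<bar>D\<bar> \<le> M + B" if "x i < y" "y < t" for y
        using that t by (intro exI[of _ "E i y"] conjI err_deriv i E_bd) auto
    qed (use t in auto)
    have nodes: "\<bar>err (x i)\<bar> \<le> (M + B) * (x i - a)" if "1 \<le> i" "i \<le> N + 1" for i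
      using that
    proof (induction i rule: dec_induct)
      case base
      thus ?case using N u uh0 by (simp add: err_def)
    next
      case (step i)
      hence i: "i \<in> {1..N}" by auto
      have "\<bar>err (x (i + 1)) - err (x i)\<bar> \<le> (M + B) * (x (i + 1) - x i)"
        by (rule \<open>\<And>t i. i \<in> {1..N} \<Longrightarrow> t \<in> cell x i \<Longrightarrow> \<bar>err t - err (x i)\<bar> \<le> (M + B) * (t - x i)\<close>[OF i])
           (use elem[OF i] in auto)
      moreover have "\<bar>err (x i)\<bar> \<le> (M + B) * (x i - a)" using step by simp
      ultimately show ?case by (simp add: algebra_simps)
    qed
    have "\<bar>err x0 - err (x m)\<bar> \<le> (M + B) * (x0 - x m)" using m by (intro step) auto
    moreover have "\<bar>err (x m)\<bar> \<le> (M + B) * (x m - a)" using m by (intro nodes) auto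
    ultimately have "\<bar>err x0\<bar> \<le> (M + B) * (x0 - a)" by (simp add: algebra_simps)
    also have "\<dots> \<le> (M + B) * (1 + (b - a))" using M0 B0 x0 by (intro mult_left_mono) auto
    finally show ?thesis using 0 by (simp add: B_def)
  qed
qed

end

text \<open>The cells \<open>c - m - J, \<dots>, m + J\<close> form a range that is symmetric about \<open>x0\<close>; see
\<open>symmetric_patch_indices\<close> for \<open>c\<close>.\<close>

locale symmetric_galerkin_error = galerkin_error +
  fixes x0 :: real and m c J :: nat
  assumes m: "m \<in> {1..N}" "x m \<le> x0" "x0 < x (m + 1)" "a < x0"
    and c: "c = (if x m < x0 then 2 * m else 2 * m - 1)"
    and J: "m + J \<le> N" "m + J < c"
    and reflected: "\<And>i. i \<in> {c - m - J..m + 1 + J} \<Longrightarrow> x (c + 1 - i) = 2 * x0 - x i"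
begin

abbreviation patch_cells :: "nat set" where "patch_cells \<equiv> {c - m - J..<m + 1 + J}"

lemma c_cases: "c = 2 * m \<or> c = 2 * m - 1" by (auto simp: c)

lemma patch_range: "i \<in> patch_cells \<Longrightarrow> i \<in> {1..N}"
  "i \<in> patch_cells \<Longrightarrow> c - i \<in> patch_cells"
  "i \<in> patch_cells \<Longrightarrow> c - i \<in> {1..N}"
  "i \<in> patch_cells \<Longrightarrow> c - (c - i) = i"
  using J c_cases m by auto

lemma reflected_elem:
  assumes "i \<in> patch_cells"
  shows "x (c - i) = 2 * x0 - x (i + 1)" "x (c - i + 1) = 2 * x0 - x i"
proof -
  show "x (c - i) = 2 * x0 - x (i + 1)" using reflected[of "i + 1"] assms by simp
  have "c + 1 - i = c - i + 1" using assms J c_cases by auto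
  thus "x (c - i + 1) = 2 * x0 - x i" using reflected[of i] assms by simp
qed

lemma x0_in: "x0 \<in> {a<..<b}" using m elem[OF m(1)] by auto

definition T :: "real poly" where "T = taylor_poly D k x0"

text \<open>The folded error \<open>e' y - (-1)\<^sup>k e' (2 x0 - y)\<close> equals \<open>\<rho> - \<Phi>\<close>: the folded Taylor polynomial
\<open>sym_part\<close>, which has degree less than \<open>k\<close>, is moved from the smooth part to the spline part.\<close>

definition sym_part :: "real poly" where
  "sym_part = T - smult ((-1) ^ k) (reflect_poly_about x0 T)"

definition \<rho> :: "real \<Rightarrow> real" where
  "\<rho> y = D 0 y - (-1) ^ k * D 0 (2 * x0 - y) - poly sym_part y"

definition \<Phi> :: "nat \<Rightarrow> real poly" where
  "\<Phi> i = (if i \<in> patch_cells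
      then U i - smult ((-1) ^ k) (reflect_poly_about x0 (U (c - i))) - sym_part else 0)"

lemma \<rho>_minus_\<Phi>:
  assumes "i \<in> patch_cells"
  shows "\<rho> y - poly (\<Phi> i) y = E i y - (-1) ^ k * E (c - i) (2 * x0 - y)"
  using assms by (simp add: \<rho>_def \<Phi>_def E_def algebra_simps)

lemma sym_part_deg: "degree sym_part \<le> k - 1"
  unfolding sym_part_def T_def by (rule degree_taylor_symmetrized[OF k])

lemma \<Phi>_deg: "degree (\<Phi> i) \<le> k - 1"
  using U_deg[OF patch_range(1), of i] U_deg[OF patch_range(3), of i] sym_part_deg
  by (auto simp: \<Phi>_def intro!: degree_diff_le)

lemma reflect_in:
  assumes "i \<in> patch_cells" "y \<in> cell x i"
  shows "y \<in> {a..b}" "2 * x0 - y \<in> {x (c - i)..x (c - i + 1)}" "2 * x0 - y \<in> {a..b}"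
  using elem[OF patch_range(1)[OF assms(1)]] elem[OF patch_range(3)[OF assms(1)]] assms(2)
  unfolding reflected_elem[OF assms(1)] by auto

lemma \<rho>_bound:
  assumes "y \<in> {a..b}" "2 * x0 - y \<in> {a..b}"
  shows "\<bar>\<rho> y\<bar> \<le> 2 * M * \<bar>y - x0\<bar> ^ (k + 1)"
proof -
  have err: "\<bar>D 0 z - poly T z\<bar> \<le> M * \<bar>z - x0\<bar> ^ (k + 1)" if "z \<in> {a..b}" for z
    unfolding T_def 
    by (rule taylor_poly_error[where a = a and b = b]) (use D M x0_in that in auto)
  have "\<rho> y = (D 0 y - poly T y) - (-1) ^ k * (D 0 (2 * x0 - y) - poly T (2 * x0 - y))"
    by (simp add: \<rho>_def sym_part_def algebra_simps)
  also have "\<bar>\<dots>\<bar> \<le> \<bar>D 0 y - poly T y\<bar> + \<bar>D 0 (2 * x0 - y) - poly T (2 * x0 - y)\<bar>"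
    by (rule order_trans[OF abs_triangle_ineq4]) (simp add: abs_mult power_abs)
  also have "\<dots> \<le> M * \<bar>y - x0\<bar> ^ (k + 1) + M * \<bar>2 * x0 - y - x0\<bar> ^ (k + 1)"
    by (intro add_mono err assms)
  also have "\<bar>2 * x0 - y - x0\<bar> = \<bar>y - x0\<bar>" by linarith
  finally show ?thesis by simp
qed

lemma \<rho>_cont:
  assumes i: "i \<in> patch_cells"
  shows "continuous_on (cell x i) \<rho>"
proof -
  have "continuous_on (cell x i) (\<lambda>y. D 0 (2 * x0 - y))"
    by (rule continuous_on_compose2[OF D0_cont]) (use reflect_in(3)[OF i] in \<open>auto intro!: continuous_intros\<close>)
  thus ?thesis unfolding \<rho>_def by (intro continuous_intros D0_cont_elem patch_range(1)[OF i])
qed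

lemma \<Phi>_dvd:
  assumes i: "i \<in> {c - m - J<..<m + 1 + J}"
  shows "joined x \<mu> \<Phi> i"
proof -
  define i' where "i' = c + 1 - i"
  have r: "i \<in> patch_cells" "i - 1 \<in> patch_cells" "i \<in> {2..N}"
    and i': "i' \<in> {2..N}" "c - i = i' - 1" "c - (i - 1) = i'"
    using i J c_cases m by (auto simp: i'_def)
  have "[:- (2 * x0 - x i'), 1:] ^ \<mu> dvd reflect_poly_about x0 (U i' - U (i' - 1))"
    by (rule dvd_reflect_about[OF U_dvd[OF i'(1)]])
  moreover have "2 * x0 - x i' = x i" using reflected[of i] i by (simp add: i'_def)
  ultimately have "[:- x i, 1:] ^ \<mu> dvd reflect_poly_about x0 (U i' - U (i' - 1))" by (simp only:)
  hence "[:- x i, 1:] ^ \<mu> dvd (U i - U (i - 1)) + smult ((-1) ^ k) (reflect_poly_about x0 (U i' - U (i' - 1)))"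
    by (intro dvd_add U_dvd r(3) dvd_smult)
  also have "\<dots> = \<Phi> i - \<Phi> (i - 1)"
    using r(1,2) unfolding \<Phi>_def i'(2,3) by (simp add: reflect_about_diff smult_diff_right)
  finally show ?thesis .
qed

lemma \<Phi>_identity:
  assumes l: "l \<le> J"
    and Q: "\<And>i. i < c - m - l \<Longrightarrow> Q i = [:\<alpha>:]" "\<And>i. m + 1 + l \<le> i \<Longrightarrow> Q i = [:\<beta>:]" "\<And>i. degree (Q i) \<le> k - 1"
      "\<And>i. i \<in> {c - m - l..m + 1 + l} \<Longrightarrow> joined x \<mu> Q i"
  shows "(\<Sum>i\<in>{c - m - l..<m + 1 + l}. integral (cell x i) (\<lambda>y. (\<rho> y - poly (\<Phi> i) y) * poly (Q i) y))
     = (\<beta> - (-1) ^ k * \<alpha>) * err (x (m + 1 + l)) - (\<alpha> - (-1) ^ k * \<beta>) * err (x (c - m - l))"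
proof -
  have "(\<Sum>i\<in>{c - m - l..<m + 1 + l}. integral (cell x i) (\<lambda>y. (\<rho> y - poly (\<Phi> i) y) * poly (Q i) y))
     = (\<Sum>i\<in>{c - m - l..<m + 1 + l}. integral (cell x i) (\<lambda>y. (E i y - (-1) ^ k * E (c - i) (2 * x0 - y)) * poly (Q i) y))"
  proof (rule sum.cong[OF refl])
    fix i assume "i \<in> {c - m - l..<m + 1 + l}"
    hence "i \<in> patch_cells" using l by auto
    thus "integral (cell x i) (\<lambda>y. (\<rho> y - poly (\<Phi> i) y) * poly (Q i) y)
       = integral (cell x i) (\<lambda>y. (E i y - (-1) ^ k * E (c - i) (2 * x0 - y)) * poly (Q i) y)"
      by (simp only: \<rho>_minus_\<Phi>)
  qed
  also have "\<dots> = \<beta> * err (x (m + 1 + l)) - \<alpha> * err (x (c - m - l))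
      - (-1) ^ k * (\<alpha> * err (x (m + 1 + l)) - \<beta> * err (x (c - m - l)))"
  proof (rule symmetrized_identity[where N = N and n = "k - 1" and \<mu> = \<mu> and e = "\<lambda>i. err (x i)"])
    show "\<And>i. i \<in> {1..N} \<Longrightarrow> integral (cell x i) (E i) = err (x (i + 1)) - err (x i)"
      using int_error by (simp add: E_def[abs_def] err_def)
    show "\<And>i. i \<in> {c - m - l..m + 1 + l} \<Longrightarrow> x (c + 1 - i) = 2 * x0 - x i"
      using l by (intro reflected) auto
    show "err (x 1) = 0" "err (x (N + 1)) = 0" using N u uh0 by (auto simp: err_def)
    show "1 \<le> c - m - l" "c - m - l \<le> m + 1 + l" "m + 1 + l \<le> N + 1" "c - m - l + (m + 1 + l) = c + 1"
      using l J c_cases m by auto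
  qed (use E_cont orthogonality Q in \<open>auto simp: E_def\<close>)
  finally show ?thesis by (simp add: algebra_simps)
qed

lemma reflected_energy:
  "(\<Sum>i\<in>patch_cells. integral (cell x i) (\<lambda>y. (poly (reflect_poly_about x0 (U (c - i))) y)\<^sup>2))
     = energy x U (c - m - J) (m + 1 + J)"
  unfolding energy_def
proof (rule sum.reindex_bij_witness[of _ "\<lambda>i. c - i" "\<lambda>i. c - i"])
  fix i assume i: "i \<in> patch_cells"
  show "c - i \<in> patch_cells" "c - (c - i) = i" using patch_range[OF i] by auto
  have "integral {2 * x0 - x (c - i + 1)..2 * x0 - x (c - i)} (\<lambda>y. (poly (U (c - i)) (2 * x0 - y))\<^sup>2)
      = sqnorm {x (c - i)..x (c - i + 1)} (U (c - i))"
    by (rule integral_reflect_about) (intro continuous_intros)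
  thus "sqnorm {x (c - i)..x (c - i + 1)} (U (c - i))
      = integral (cell x i) (\<lambda>y. (poly (reflect_poly_about x0 (U (c - i))) y)\<^sup>2)"
    unfolding reflected_elem[OF i] by simp
qed (use patch_range in auto)

lemma sym_part_bound:
  assumes "y \<in> {a..b}" "2 * x0 - y \<in> {a..b}"
  shows "\<bar>poly sym_part y\<bar> \<le> 2 * M * (1 + (b - a) ^ (k + 1))"
proof -
  have "poly sym_part y = D 0 y - (-1) ^ k * D 0 (2 * x0 - y) - \<rho> y" by (simp add: \<rho>_def)
  also have "\<bar>\<dots>\<bar> \<le> \<bar>D 0 y\<bar> + \<bar>(-1) ^ k * D 0 (2 * x0 - y)\<bar> + \<bar>\<rho> y\<bar>" by linarith
  also have "\<bar>(-1) ^ k * D 0 (2 * x0 - y)\<bar> = \<bar>D 0 (2 * x0 - y)\<bar>" by (simp add: abs_mult power_abs)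
  also have "\<bar>D 0 y\<bar> + \<bar>D 0 (2 * x0 - y)\<bar> + \<bar>\<rho> y\<bar> \<le> M + M + 2 * M * (b - a) ^ (k + 1)"
  proof (intro add_mono M assms)
    have "\<bar>\<rho> y\<bar> \<le> 2 * M * \<bar>y - x0\<bar> ^ (k + 1)" by (rule \<rho>_bound[OF assms])
    also have "\<dots> \<le> 2 * M * (b - a) ^ (k + 1)"
      using M0 assms x0_in by (intro mult_left_mono power_mono) auto
    finally show "\<bar>\<rho> y\<bar> \<le> 2 * M * (b - a) ^ (k + 1)" .
  qed auto
  finally show ?thesis by (simp add: algebra_simps)
qed

lemma \<Phi>_energy_le:
  "energy x \<Phi> (c - m - J) (m + 1 + J) \<le>
     6 * (M\<^sup>2 * (b - a)) + 3 * ((2 * M * (1 + (b - a) ^ (k + 1)))\<^sup>2 * (b - a))"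
proof -
  define S where "S = 2 * M * (1 + (b - a) ^ (k + 1))"
  define p where "p = c - m - J"
  define q where "q = m + 1 + J"
  have pq: "1 \<le> p" "p \<le> q" "q \<le> N + 1" using J c_cases m by (auto simp: p_def q_def)
  define I where "I i = sqnorm (cell x i) (U i)" for i
  define R where "R i = integral (cell x i) (\<lambda>y. (poly (reflect_poly_about x0 (U (c - i))) y)\<^sup>2)" for i
  have "energy x \<Phi> p q \<le> (\<Sum>i\<in>{p..<q}. 3 * I i + 3 * R i + 3 * S\<^sup>2 * (x (Suc i) - x i))"
    unfolding energy_def
  proof (rule sum_mono)
    fix i assume "i \<in> {p..<q}"
    hence i: "i \<in> patch_cells" by (simp add: p_def q_def)
    let ?r = "reflect_poly_about x0 (U (c - i))"
    have "sqnorm (cell x i) (\<Phi> i) \<le>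
        integral (cell x i) (\<lambda>y. 3 * (poly (U i) y)\<^sup>2 + 3 * (poly ?r y)\<^sup>2 + 3 * S\<^sup>2)"
    proof (intro integral_le integrable_continuous_real continuous_intros)
      fix y assume y: "y \<in> cell x i"
      have three: "(A - B - C)\<^sup>2 \<le> 3 * A\<^sup>2 + 3 * B\<^sup>2 + 3 * C\<^sup>2" for A B C :: real
      proof -
        have "0 \<le> (A + B)\<^sup>2 + (A + C)\<^sup>2 + (B - C)\<^sup>2" by simp
        thus ?thesis by (simp add: power2_eq_square algebra_simps)
      qed
      have "\<bar>poly sym_part y\<bar>\<^sup>2 \<le> S\<^sup>2"
        unfolding S_def using reflect_in[OF i y] by (intro power_mono sym_part_bound) auto
      hence "(poly sym_part y)\<^sup>2 \<le> S\<^sup>2" by simp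
      moreover have "((-1) ^ k * poly ?r y)\<^sup>2 = (poly ?r y)\<^sup>2" by (simp add: power_mult_distrib flip: power_mult)
      moreover have "poly (\<Phi> i) y = poly (U i) y - (-1) ^ k * poly ?r y - poly sym_part y"
        using i by (simp add: \<Phi>_def)
      ultimately show "(poly (\<Phi> i) y)\<^sup>2 \<le> 3 * (poly (U i) y)\<^sup>2 + 3 * (poly ?r y)\<^sup>2 + 3 * S\<^sup>2"
        using three[of "poly (U i) y" "(-1) ^ k * poly ?r y" "poly sym_part y"] by simp
    qed
    also have "\<dots> = 3 * I i + 3 * R i + 3 * S\<^sup>2 * (x (Suc i) - x i)"
    proof -
      have sq: "((\<lambda>y. (poly w y)\<^sup>2) has_integral sqnorm (cell x i) w) (cell x i)"
        for w :: "real poly"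
        by (intro integrable_integral integrable_continuous_real continuous_intros)
      have "((\<lambda>y. 3 * (poly (U i) y)\<^sup>2 + 3 * (poly ?r y)\<^sup>2 + 3 * S\<^sup>2) has_integral
          3 * I i + 3 * R i + measure lborel (cell x i) *\<^sub>R (3 * S\<^sup>2)) (cell x i)"
        unfolding I_def R_def
        by (rule has_integral_add[OF has_integral_add[OF
              has_integral_mult_right[OF sq] has_integral_mult_right[OF sq]] has_integral_const_real])
      moreover have "measure lborel (cell x i) = x (i + 1) - x i"
        using elem(1)[OF patch_range(1)[OF i]] by simp
      ultimately have "((\<lambda>y. 3 * (poly (U i) y)\<^sup>2 + 3 * (poly ?r y)\<^sup>2 + 3 * S\<^sup>2) has_integral
          3 * I i + 3 * R i + (x (i + 1) - x i) *\<^sub>R (3 * S\<^sup>2)) (cell x i)" by simp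
      thus ?thesis by (simp add: integral_unique mult.commute)
    qed
    finally show "sqnorm (cell x i) (\<Phi> i) \<le> 3 * I i + 3 * R i + 3 * S\<^sup>2 * (x (Suc i) - x i)" .
  qed
  also have "\<dots> = 3 * (\<Sum>i\<in>{p..<q}. I i) + 3 * (\<Sum>i\<in>{p..<q}. R i) + 3 * S\<^sup>2 * (\<Sum>i\<in>{p..<q}. x (Suc i) - x i)"
    by (simp add: sum.distrib sum_distrib_left)
  also have "(\<Sum>i\<in>{p..<q}. I i) = energy x U p q" by (simp add: energy_def I_def)
  also have "(\<Sum>i\<in>{p..<q}. R i) = energy x U p q"
    unfolding R_def p_def q_def by (rule reflected_energy)
  also have "(\<Sum>i\<in>{p..<q}. x (Suc i) - x i) = x q - x p" using sum_Suc_diff'[OF pq(2), of x] .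
  also have "3 * energy x U p q + 3 * energy x U p q + 3 * S\<^sup>2 * (x q - x p) \<le> 6 * (M\<^sup>2 * (b - a)) + 3 * S\<^sup>2 * (b - a)"
  proof -
    have "energy x U p q \<le> energy x U 1 (N + 1)" using pq by (intro energy_mono) auto
    moreover have "x q - x p \<le> b - a"
      using mesh_bounds[OF mesh, of p] mesh_bounds[OF mesh, of q] pq by auto
    hence "3 * S\<^sup>2 * (x q - x p) \<le> 3 * S\<^sup>2 * (b - a)" by (intro mult_left_mono) auto
    ultimately show ?thesis using energy_U_le by linarith
  qed
  finally show ?thesis by (simp add: p_def q_def S_def mult.assoc)
qed

text \<open>Since \<open>k - s\<close> is even for \<open>s = j + 1\<close>, folding doubles the derivative of order \<open>j\<close> of \<open>e'\<close> at \<open>x0\<close>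
instead of cancelling it, while \<open>\<rho>\<close> vanishes there to higher order.\<close>

lemma superconvergence_derivative:
  assumes bound: "\<bar>poly ((pderiv ^^ j) (\<Phi> m)) x0\<bar> \<le> B"
    and s: "x m < x0 \<and> Suc j \<le> k \<or> x0 = x m \<and> Suc j \<le> \<mu>" and even: "even (k - Suc j)"
  shows "\<bar>(deriv ^^ Suc j) err x0\<bar> \<le> B"
proof -
  have jk: "Suc j \<le> k" using s \<mu> by auto
  \<comment> \<open>The parity of \<open>k - s\<close> enters here.\<close>
  have sign: "(-1) ^ k * (-1) ^ j = (-1 :: real)"
  proof -
    have "k + j = (k - Suc j) + (2 * j + 1)" using jk by simp
    hence "odd (k + j)" using even by simp
    thus ?thesis by (simp flip: power_add)
  qed
  have mid: "m \<in> patch_cells" using c_cases by auto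
  have other: "poly ((pderiv ^^ j) (U (c - m))) x0 = poly ((pderiv ^^ j) (U m)) x0"
  proof (cases "x m < x0")
    case True
    thus ?thesis by (simp add: c)
  next
    case False
    hence x0: "x0 = x m" "Suc j \<le> \<mu>" "c - m = m - 1" using s by (auto simp: c)
    have "m \<noteq> 1" using x0 m N by auto
    hence m2: "m \<in> {2..N}" using m by auto
    have "[:- x m, 1:] ^ (Suc 0 + j) dvd [:- x m, 1:] ^ \<mu>" using x0(2) by (intro le_imp_power_dvd) auto
    hence "[:- x m, 1:] ^ (Suc 0 + j) dvd U m - U (m - 1)" using U_dvd[OF m2] by (rule dvd_trans)
    hence "[:- x m, 1:] ^ Suc 0 dvd (pderiv ^^ j) (U m - U (m - 1))" by (rule higher_pderiv_dvd)
    hence "poly ((pderiv ^^ j) (U m - U (m - 1))) (x m) = 0" by (rule poly_eq_0_of_power_dvd)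
    thus ?thesis unfolding x0(1,3) by (simp add: higher_pderiv_diff)
  qed
  have "poly ((pderiv ^^ j) (\<Phi> m)) x0 = poly ((pderiv ^^ j) (U m)) x0
      - ((-1) ^ k * (-1) ^ j) * poly ((pderiv ^^ j) (U (c - m))) x0
      - (1 - (-1) ^ k * (-1) ^ j) * poly ((pderiv ^^ j) T) x0"
  proof -
    have "\<Phi> m = U m - smult ((-1) ^ k) (reflect_poly_about x0 (U (c - m))) -
        (T - smult ((-1) ^ k) (reflect_poly_about x0 T))"
      using mid by (simp add: \<Phi>_def sym_part_def)
    thus ?thesis
      unfolding \<open>\<Phi> m = _\<close> higher_pderiv_diff higher_pderiv_smult
      by (simp add: higher_pderiv_reflect_about algebra_simps)
  qed
  also have "\<dots> = 2 * poly ((pderiv ^^ j) (U m)) x0 - 2 * D j x0"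
    unfolding sign other using jk by (simp add: T_def higher_pderiv_taylor_poly)
  finally have "poly ((pderiv ^^ j) (\<Phi> m)) x0 = - 2 * (deriv ^^ Suc j) err x0"
    unfolding higher_deriv_err[OF m s] by simp
  thus ?thesis using bound by simp
qed

text \<open>Pairing the folded error with a spline \<open>\<eta>\<close> that steps from 0 to 1 gives the sum of the errors at the
two end nodes of the region; the function \<open>H y = e y + e (2 x0 - y)\<close> takes that sum at the right end
node and \<open>2 e x0\<close> at \<open>x0\<close>, and its derivative is the folded error.\<close>

lemma superconvergence_value:
  assumes l: "l \<le> J" and even: "even k"
    and G: "\<And>i y. i \<in> {c - m - l..<m + 1 + l} \<Longrightarrow> y \<in> cell x i \<Longrightarrow> \<bar>\<rho> y - poly (\<Phi> i) y\<bar> \<le> B"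
    and dist: "x (m + 1 + l) - x0 \<le> real (l + 1) * h"
    and \<eta>: "\<And>i. i < c - m - l \<Longrightarrow> \<eta> i = 0" "\<And>i. m + 1 + l \<le> i \<Longrightarrow> \<eta> i = 1" "\<And>i. degree (\<eta> i) \<le> k - 1"
      "\<And>i. i \<in> {c - m - l..m + 1 + l} \<Longrightarrow> joined x \<mu> \<eta> i"
      "\<And>i y. i \<in> {c - m - l..<m + 1 + l} \<Longrightarrow> y \<in> cell x i \<Longrightarrow> \<bar>poly (\<eta> i) y\<bar> \<le> S"
  shows "\<bar>err x0\<bar> \<le> real (l + 1) * (S + 1) * (B * h)"
proof -
  define p where "p = c - m - l"
  define q where "q = m + 1 + l"
  have sub: "i \<in> {p..<q} \<Longrightarrow> i \<in> patch_cells" for i using l by (auto simp: p_def q_def)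
  have m_in: "m \<in> {p..<q}" using c_cases by (auto simp: p_def q_def)
  have B0: "0 \<le> B" using G[of m "x m"] m_in elem(1)[OF m(1)] by (simp add: p_def q_def)
  have S0: "0 \<le> S" using \<eta>(5)[of m "x m"] m_in elem(1)[OF m(1)] by (simp add: p_def q_def)
  have "(\<Sum>i\<in>{p..<q}. integral (cell x i) (\<lambda>y. (\<rho> y - poly (\<Phi> i) y) * poly (\<eta> i) y))
     = (1 - (-1) ^ k * 0) * err (x q) - (0 - (-1) ^ k * 1) * err (x p)"
    unfolding p_def q_def by (rule \<Phi>_identity[OF l]) (use \<eta> in \<open>auto simp: one_pCons\<close>)
  hence "err (x q) + err (x p) = (\<Sum>i\<in>{p..<q}. integral (cell x i) (\<lambda>y. (\<rho> y - poly (\<Phi> i) y) * poly (\<eta> i) y))"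
    using even by simp
  also have "\<bar>\<dots>\<bar> \<le> (\<Sum>i\<in>{p..<q}. B * S * h)"
  proof (rule order_trans[OF sum_abs sum_mono])
    fix i assume i: "i \<in> {p..<q}"
    have iN: "i \<in> {1..N}" using patch_range(1) sub[OF i] by blast
    have "norm (integral (cell x i) (\<lambda>y. (\<rho> y - poly (\<Phi> i) y) * poly (\<eta> i) y)) \<le> (B * S) * (x (i + 1) - x i)"
    proof (rule integral_bound)
      show "x i \<le> x (i + 1)" using elem(1)[OF iN] by simp
      show "continuous_on (cell x i) (\<lambda>y. (\<rho> y - poly (\<Phi> i) y) * poly (\<eta> i) y)"
        by (intro continuous_intros \<rho>_cont sub i)
      fix y assume "y \<in> cell x i"
      thus "norm ((\<rho> y - poly (\<Phi> i) y) * poly (\<eta> i) y) \<le> B * S"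
        unfolding real_norm_def abs_mult using i B0 by (intro mult_mono G \<eta>(5)) (auto simp: p_def q_def)
    qed
    also have "\<dots> \<le> (B * S) * h" using elem_le_h[OF iN] B0 S0 by (intro mult_left_mono) auto
    finally show "\<bar>integral (cell x i) (\<lambda>y. (\<rho> y - poly (\<Phi> i) y) * poly (\<eta> i) y)\<bar> \<le> B * S * h" by simp
  qed
  also have "\<dots> = real (q - p) * (B * S * h)" by simp
  also have "\<dots> \<le> (2 * real (l + 1)) * (B * S * h)"
  proof (rule mult_right_mono)
    have "q - p \<le> 2 * (l + 1)" using c_cases J l by (auto simp: p_def q_def)
    hence "real (q - p) \<le> real (2 * (l + 1))" by (rule of_nat_mono)
    thus "real (q - p) \<le> 2 * real (l + 1)" by simp
  qed (use B0 S0 h_pos in auto)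
  finally have sum_err: "\<bar>err (x q) + err (x p)\<bar> \<le> (2 * real (l + 1)) * (B * S * h)" .
  define H where "H y = err y + err (2 * x0 - y)" for y
  have H_step: "\<bar>H t - H s\<bar> \<le> B * (t - s)"
    if i: "i \<in> {p..<q}" and st: "s \<le> t" "x i \<le> s" "t \<le> x (i + 1)" for i s t
  proof (rule MVT_bound[OF st(1)])
    note r = reflected_elem[OF sub[OF i]] reflected_elem(2)[OF sub[OF i], simplified]
    have iN: "i \<in> {1..N}" "c - i \<in> {1..N}" using patch_range(1,3) sub[OF i] by blast+
    have c1: "continuous_on {s..t} err"
      by (rule continuous_on_subset[OF err_cont[OF iN(1)]]) (use st in auto)
    have c2: "continuous_on {s..t} (\<lambda>y. err (2 * x0 - y))"
      by (rule continuous_on_compose2[OF err_cont[OF iN(2)]])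
         (use st in \<open>auto simp: r intro!: continuous_intros\<close>)
    show "continuous_on {s..t} H" unfolding H_def by (intro continuous_intros c1 c2)
    fix y assume y: "s < y" "y < t"
    have "(err has_real_derivative E i y) (at y)" using y st by (intro err_deriv iN) auto
    moreover have "((\<lambda>y. err (2 * x0 - y)) has_real_derivative E (c - i) (2 * x0 - y) * (0 - 1)) (at y)"
    proof (rule DERIV_chain'[where f = "\<lambda>y. 2 * x0 - y" and g = err])
      show "((\<lambda>y. 2 * x0 - y) has_real_derivative 0 - 1) (at y)" by (intro DERIV_diff DERIV_const DERIV_ident)
      show "(err has_real_derivative E (c - i) (2 * x0 - y)) (at (2 * x0 - y))"
        by (rule err_deriv[OF iN(2)]) (use y st in \<open>auto simp: r\<close>)
    qed
    ultimately have "(H has_real_derivative E i y + E (c - i) (2 * x0 - y) * (0 - 1)) (at y)"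
      unfolding H_def[abs_def] by (rule DERIV_add)
    moreover have "E i y + E (c - i) (2 * x0 - y) * (0 - 1) = \<rho> y - poly (\<Phi> i) y"
      using \<rho>_minus_\<Phi>[OF sub[OF i], of y] even by simp
    ultimately show "\<exists>D. (H has_real_derivative D) (at y) \<and> \<bar>D\<bar> \<le> B"
      using G[of i y] i y st by (auto simp: p_def q_def)
  qed
  have "\<bar>H (x (m + 1 + n)) - H x0\<bar> \<le> B * (x (m + 1 + n) - x0)" if "n \<le> l" for n
    using that
  proof (induction n)
    case 0
    show ?case using H_step[of m x0 "x (m + 1)"] m m_in by simp
  next
    case (Suc n)
    have i: "m + 1 + n \<in> {p..<q}" using Suc.prems c_cases by (auto simp: p_def q_def)
    have "x (m + 1 + n) < x (m + 1 + n + 1)" using elem(1) patch_range(1) sub[OF i] by blast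
    hence "\<bar>H (x (m + 1 + Suc n)) - H (x (m + 1 + n))\<bar> \<le> B * (x (m + 1 + Suc n) - x (m + 1 + n))"
      using H_step[OF i, of "x (m + 1 + n)" "x (m + 1 + n + 1)"] by simp
    moreover have "\<bar>H (x (m + 1 + n)) - H x0\<bar> \<le> B * (x (m + 1 + n) - x0)" using Suc by simp
    ultimately show ?case by (simp add: algebra_simps)
  qed
  from this[of l] have "\<bar>H (x q) - H x0\<bar> \<le> B * (x q - x0)" by (simp add: q_def)
  also have "\<dots> \<le> B * (real (l + 1) * h)" using dist B0 unfolding q_def by (intro mult_left_mono)
  finally have "\<bar>H (x q) - H x0\<bar> \<le> B * (real (l + 1) * h)" .
  moreover have "H (x q) = err (x q) + err (x p)"
  proof -
    have "x (c + 1 - q) = 2 * x0 - x q" using l c_cases by (intro reflected) (auto simp: q_def)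
    moreover have "c + 1 - q = p" by (auto simp: p_def q_def)
    ultimately show ?thesis by (simp add: H_def)
  qed
  moreover have "H x0 = 2 * err x0" by (simp add: H_def)
  ultimately have "\<bar>2 * err x0\<bar> \<le> (2 * real (l + 1)) * (B * S * h) + B * (real (l + 1) * h)"
    using sum_err by linarith
  also have "\<dots> \<le> 2 * (real (l + 1) * (S + 1) * (B * h))"
    using B0 h_pos by (simp add: algebra_simps)
  finally show ?thesis by simp
qed

section \<open>The bound on fine meshes\<close>

lemma \<Phi>_local_equation: "local_galerkin_equation (k - 1) \<mu> \<delta> x h (c - m - J) (m + 1 + J) \<Phi> \<rho>"
  unfolding local_galerkin_equation_def
proof (intro conjI allI ballI impI)
  fix Q :: "nat \<Rightarrow> real poly"
  assume Q: "\<forall>i. degree (Q i) \<le> k - 1" "\<forall>i. i < c - m - J \<or> m + 1 + J \<le> i \<longrightarrow> Q i = 0"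
    "\<forall>i\<in>{c - m - J..m + 1 + J}. joined x \<mu> Q i"
  have "(\<Sum>i\<in>patch_cells. integral (cell x i) (\<lambda>y. (\<rho> y - poly (\<Phi> i) y) * poly (Q i) y))
    = (0 - (-1) ^ k * 0) * err (x (m + 1 + J)) - (0 - (-1) ^ k * 0) * err (x (c - m - J))"
    by (rule \<Phi>_identity[OF order_refl]) (use Q in auto)
  thus "(\<Sum>i\<in>patch_cells. integral (cell x i) (\<lambda>y. (\<rho> y - poly (\<Phi> i) y) * poly (Q i) y)) = 0"
    by simp
qed (use h_pos quasi_uniform elem_le_h patch_range(1) \<Phi>_deg \<Phi>_dvd \<rho>_cont in auto)

text \<open>The decay over \<open>r\<close> steps reduces the energy of \<open>\<Phi>\<close> from its a priori bound \<open>CE\<close> on the patch to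
\<open>O(h\<^bsup>2k + 3\<^esup>)\<close> on the central \<open>k\<close> cells on either side of \<open>x0\<close>; that many are kept because the step
function for \<open>s = 0\<close> needs room for its \<open>k\<close> knots. The inverse estimate turns the energy into
pointwise bounds.\<close>

lemma fine_bound:
  fixes \<theta> C Ki Kc :: real and r :: nat
  assumes decay: "decay_constants (k - 1) \<mu> \<delta> k \<theta> C"
    and inv: "inverse_constant (k - 1) \<delta> Ki" and cutoff: "cutoff_constant (k - 1) \<delta> Kc"
    and pos: "0 < Ki" "0 < Kc" "0 < C" "0 < \<theta>"
    and dist: "\<And>l y. l \<le> J \<Longrightarrow> y \<in> {x (c - m - l)..x (m + 1 + l)} \<Longrightarrow> \<bar>y - x0\<bar> \<le> real (l + 1) * h"
    and J_large: "k + r * k \<le> J" and rate: "\<theta> ^ r \<le> (1 / \<theta>) ^ 3 * h ^ (2 * k + 3)"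
    and s: "x m < x0 \<and> s \<le> k \<or> x0 = x m \<and> s \<le> \<mu>" and even: "even (k - s)"
  defines "CE \<equiv> 6 * (M\<^sup>2 * (b - a)) + 3 * ((2 * M * (1 + (b - a) ^ (k + 1)))\<^sup>2 * (b - a))"
  defines "B \<equiv> sqrt (Ki * ((1 / \<theta>) ^ 3 * CE + C * (2 * M)\<^sup>2))"
  shows "\<bar>(deriv ^^ s) err x0\<bar> \<le>
     (B + real (k + 1) * (sqrt Kc + 2) * (B + 2 * M * real (k + 1) ^ (k + 1))) * h ^ (k + 2 - s)"
proof -
  define n where "n = k - 1"
  have n: "k = n + 1" using k by (simp add: n_def)
  note decay = decay[folded n_def] and inv = inv[folded n_def] and cutoff = cutoff[folded n_def]
  have nk: "k - 1 = n" "n + 2 = k + 1" "2 * n + 5 = 2 * k + 3" using n by auto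
  have CE: "0 \<le> CE" using ab by (auto simp: CE_def)
  define CB where "CB = (1 / \<theta>) ^ 3 * CE + C * (2 * M)\<^sup>2"
  have CB: "0 \<le> CB" using CE pos by (simp add: CB_def)
  have "B = sqrt (Ki * CB)" by (simp only: B_def CB_def)
  hence Bsq: "B\<^sup>2 = Ki * CB" and B0: "0 \<le> B" using pos CB by simp_all
  have "energy x \<Phi> (c - m - k) (m + 1 + k) \<le> \<theta> ^ r * energy x \<Phi> (c - m - J) (m + 1 + J) + C * (2 * M)\<^sup>2 * h ^ (2 * n + 5)"
  proof (rule decay[unfolded decay_constants_def, rule_format])
    show "J < c - m" "c - m \<le> m + 1" "m + 1 \<le> c - m + 2" using J c_cases m by auto
    show "local_galerkin_equation n \<mu> \<delta> x h (c - m - J) (m + 1 + J) \<Phi> \<rho>"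
      using \<Phi>_local_equation nk by simp
    show "\<bar>y - x0\<bar> \<le> real (l + 1) * h" if "l \<le> J" "y \<in> {x (c - m - l)..x (m + 1 + l)}" for l y
      using that by (rule dist)
    show "\<bar>\<rho> y\<bar> \<le> 2 * M * \<bar>y - x0\<bar> ^ (n + 2)"
      if "i \<in> patch_cells" "y \<in> cell x i" for i y
      unfolding nk using \<rho>_bound reflect_in[OF that] by blast
    show "0 \<le> 2 * M" using M0 by simp
    show "k + r * (n + 1) \<le> J" using J_large unfolding n[symmetric] .
  qed
  also have "\<theta> ^ r * energy x \<Phi> (c - m - J) (m + 1 + J) \<le> ((1 / \<theta>) ^ 3 * h ^ (2 * k + 3)) * CE"
    using rate \<Phi>_energy_le h_pos pos CE by (intro mult_mono) (auto simp: CE_def energy_nonneg)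
  finally have en: "energy x \<Phi> (c - m - k) (m + 1 + k) \<le> CB * h ^ (2 * k + 3)"
    unfolding nk by (simp add: CB_def algebra_simps)
  have kJ: "k \<le> J" using J_large by simp
  have central: "i \<in> patch_cells" if "i \<in> {c - m - k..<m + 1 + k}" for i
    using that kJ by auto
  have \<Phi>_bd: "\<bar>poly ((pderiv ^^ j) (\<Phi> i)) y\<bar> \<le> B * h ^ (k + 1 - j)"
    if i: "i \<in> {c - m - k..<m + 1 + k}" and y: "y \<in> cell x i" and j: "j \<le> n" for i j y
  proof -
    note iN = patch_range(1)[OF central[OF i]]
    have "(poly ((pderiv ^^ j) (\<Phi> i)) y)\<^sup>2 * h ^ (2 * j + 1) \<le> Ki * sqnorm (cell x i) (\<Phi> i)"
      by (rule inv[unfolded inverse_constant_def, rule_format]) (use h_pos \<Phi>_deg nk j quasi_uniform[OF iN] elem_le_h[OF iN] y in auto)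
    also have "\<dots> \<le> Ki * energy x \<Phi> (c - m - k) (m + 1 + k)"
      using pos i by (intro mult_left_mono energy_element_le) auto
    also have "\<dots> \<le> Ki * (CB * h ^ (2 * k + 3))" using en pos by (intro mult_left_mono) auto
    also have "\<dots> = (B * h ^ (k + 1 - j))\<^sup>2 * h ^ (2 * j + 1)"
    proof -
      have "2 * k + 3 = 2 * (k + 1 - j) + (2 * j + 1)" using j n by auto
      hence "h ^ (2 * k + 3) = (h ^ (k + 1 - j))\<^sup>2 * h ^ (2 * j + 1)"
        by (simp only: power_add power_mult[symmetric] mult.commute[of _ 2])
      thus ?thesis by (simp add: power_mult_distrib Bsq)
    qed
    finally have "(poly ((pderiv ^^ j) (\<Phi> i)) y)\<^sup>2 \<le> (B * h ^ (k + 1 - j))\<^sup>2"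
      using h_pos by (simp add: mult_le_cancel_right)
    hence "\<bar>poly ((pderiv ^^ j) (\<Phi> i)) y\<bar> \<le> \<bar>B * h ^ (k + 1 - j)\<bar>" by (simp only: abs_le_square_iff)
    thus ?thesis using B0 h_pos by simp
  qed
  define C2 where "C2 = real (k + 1) * (sqrt Kc + 2) * (B + 2 * M * real (k + 1) ^ (k + 1))"
  have C2: "0 \<le> C2" using pos B0 M0 by (auto simp: C2_def)
  have "\<bar>(deriv ^^ s) err x0\<bar> \<le> (B + C2) * h ^ (k + 2 - s)"
  proof (cases s)
    case (Suc j)
    have jn: "j \<le> n" using s Suc n \<mu> by auto
    have "m \<in> {c - m - k..<m + 1 + k}" using c_cases by auto
    hence "\<bar>poly ((pderiv ^^ j) (\<Phi> m)) x0\<bar> \<le> B * h ^ (k + 1 - j)"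
      using jn m by (intro \<Phi>_bd) auto
    hence "\<bar>(deriv ^^ s) err x0\<bar> \<le> B * h ^ (k + 1 - j)"
      unfolding Suc by (rule superconvergence_derivative) (use s even Suc in auto)
    also have "k + 1 - j = k + 2 - s" using Suc by simp
    also have "B * h ^ (k + 2 - s) \<le> (B + C2) * h ^ (k + 2 - s)"
      using C2 h_pos by (intro mult_right_mono) auto
    finally show ?thesis .
  next
    case 0
    define p where "p = c - m - k"
    have p1: "1 \<le> p" using J c_cases kJ by (auto simp: p_def)
    have pn: "p + n \<le> m" using J c_cases kJ m n by (auto simp: p_def)
    have "\<forall>i\<in>{p..p + n}. \<delta> * h \<le> x (i + 1) - x i \<and> x (i + 1) - x i \<le> h"
    proof
      fix i assume "i \<in> {p..p + n}"
      hence "i \<in> {1..N}" using p1 pn m by auto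
      thus "\<delta> * h \<le> x (i + 1) - x i \<and> x (i + 1) - x i \<le> h" using quasi_uniform elem_le_h by blast
    qed
    \<comment> \<open>The cutoff of the constant 1 is the step function.\<close>
    from cutoff[unfolded cutoff_constant_def, THEN spec, THEN spec, THEN spec, THEN spec, THEN mp, THEN mp, THEN mp, THEN mp, OF h_pos p1 _ this, of "\<lambda>_. 1"]
    obtain \<eta> where \<eta>: "\<forall>i<p. \<eta> i = 0" "\<forall>i\<ge>p + n. \<eta> i = 1" "\<forall>i. degree (\<eta> i) \<le> n"
       "\<forall>i\<in>{p..p + n}. joined x n \<eta> i"
       "\<forall>i\<in>{p..p + n}. \<forall>y\<in>cell x i.
          (poly (\<eta> i) y)\<^sup>2 * h \<le> Kc * sqnorm {x (p + n)..x (p + n + 1)} 1" by auto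
    define B' where "B' = (B + 2 * M * real (k + 1) ^ (k + 1)) * h ^ (k + 1)"
    have "\<bar>err x0\<bar> \<le> real (k + 1) * ((sqrt Kc + 1) + 1) * (B' * h)"
    proof (rule superconvergence_value[OF kJ])
      show "even k" using even 0 by simp
      fix i y assume i: "i \<in> {c - m - k..<m + 1 + k}" and y: "y \<in> cell x i"
      have "x (c - m - k) \<le> x i" "x (i + 1) \<le> x (m + 1 + k)"
        using i J c_cases kJ m by (auto intro!: mesh_le[OF mesh])
      hence "\<bar>y - x0\<bar> \<le> real (k + 1) * h" using y by (intro dist[OF kJ]) auto
      hence "2 * M * \<bar>y - x0\<bar> ^ (k + 1) \<le> 2 * M * (real (k + 1) * h) ^ (k + 1)"
        using M0 by (intro mult_left_mono power_mono) auto
      moreover have "\<bar>\<rho> y\<bar> \<le> 2 * M * \<bar>y - x0\<bar> ^ (k + 1)"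
        using reflect_in[OF central[OF i] y] by (intro \<rho>_bound)
      moreover have "\<bar>poly (\<Phi> i) y\<bar> \<le> B * h ^ (k + 1)" using \<Phi>_bd[OF i y, of 0] by simp
      ultimately have "\<bar>\<rho> y - poly (\<Phi> i) y\<bar> \<le> 2 * M * (real (k + 1) * h) ^ (k + 1) + B * h ^ (k + 1)" by linarith
      also have "\<dots> = B'" by (simp only: B'_def power_mult_distrib) (simp add: algebra_simps)
      finally show "\<bar>\<rho> y - poly (\<Phi> i) y\<bar> \<le> B'" .
    next
      have "x (c - m - k) \<le> x (m + 1 + k)" using J c_cases kJ m by (intro mesh_le[OF mesh]) auto
      hence "\<bar>x (m + 1 + k) - x0\<bar> \<le> real (k + 1) * h" by (intro dist[OF kJ]) auto
      thus "x (m + 1 + k) - x0 \<le> real (k + 1) * h" by linarith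
    next
      fix i assume i: "i \<in> {c - m - k..m + 1 + k}"
      show "joined x \<mu> \<eta> i"
      proof (cases "i \<le> p + n")
        case True
        hence "joined x n \<eta> i" using \<eta>(4) i by (auto simp: p_def)
        moreover have "[:- x i, 1:] ^ \<mu> dvd [:- x i, 1:] ^ n" using \<mu> nk by (intro le_imp_power_dvd) auto
        ultimately show ?thesis by (rule dvd_trans[rotated])
      next
        case False
        hence "\<eta> i = 1" "\<eta> (i - 1) = 1" using \<eta>(2) by auto
        thus ?thesis by simp
      qed
    next
      fix i y assume i: "i \<in> {c - m - k..<m + 1 + k}" and y: "y \<in> cell x i"
      show "\<bar>poly (\<eta> i) y\<bar> \<le> sqrt Kc + 1"
      proof (cases "i \<le> p + n")
        case True
        have pnN: "p + n \<in> {1..N}" using p1 pn m by auto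
        have "(poly (\<eta> i) y)\<^sup>2 * h \<le> Kc * sqnorm {x (p + n)..x (p + n + 1)} 1"
          using \<eta>(5) True i y by (auto simp: p_def)
        also have "\<dots> = Kc * (x (p + n + 1) - x (p + n))" using elem(1)[OF pnN] by simp
        also have "\<dots> \<le> Kc * h" using elem_le_h[OF pnN] pos by (intro mult_left_mono) auto
        finally have "(poly (\<eta> i) y)\<^sup>2 \<le> Kc" using h_pos by (simp add: mult_le_cancel_right)
        hence "\<bar>poly (\<eta> i) y\<bar> \<le> sqrt Kc" by (metis real_sqrt_abs real_sqrt_le_iff)
        thus ?thesis by simp
      next
        case False
        hence "\<eta> i = 1" using \<eta>(2) by auto
        thus ?thesis using pos by simp
      qed
    qed (use \<eta> pn nk in \<open>auto simp: p_def\<close>)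
    also have "\<dots> = C2 * h ^ (k + 2 - s)" using 0 by (simp add: C2_def B'_def algebra_simps)
    also have "\<dots> \<le> (B + C2) * h ^ (k + 2 - s)" using B0 h_pos by (intro mult_right_mono) auto
    finally show ?thesis using 0 by simp
  qed
  thus ?thesis by (simp add: C2_def)
qed

end

section \<open>Superconvergence at symmetry points\<close>

theorem theorem3p6:
  fixes a b :: real and f u :: "real \<Rightarrow> real" and k \<mu> :: nat
    and F :: "(nat \<times> (nat \<Rightarrow> real)) set"
  assumes "a < b" and "1 \<le> k" and "\<mu> \<le> k - 1"
    and "Cn_on k {a..b} f"
    and "poisson_solution a b f u"
    and "quasi_uniform_family a b F"
  shows "\<exists>C0>0. \<forall>Cstar\<ge>C0. \<exists>C>0. \<forall>(N, x)\<in>F. \<forall>uh x0 h d s.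
           h = mesh_size N x \<longrightarrow> d = Cstar * h * \<bar>ln h\<bar> \<longrightarrow>
           galerkin_solution a b N x k \<mu> u uh \<longrightarrow>
           {x0 - d..x0 + d} \<subseteq> {a<..<b} \<longrightarrow>
           symmetric_patch N x k \<mu> d x0 \<longrightarrow>
           even (k - s) \<longrightarrow>
           (x0 \<in> x ` {1..N + 1} \<and> s \<le> \<mu>) \<or>
             (x0 \<in> (\<Union>i\<in>{1..N}. {x i<..<x (i + 1)}) \<and> s \<le> k) \<longrightarrow>
           \<bar>(deriv ^^ s) (\<lambda>y. u y - uh y) x0\<bar> \<le> C * h ^ (k + 2 - s)"
proof -
  note ab = assms(1) and k = assms(2) and \<mu> = assms(3)
  obtain D where D: "\<And>j y. j \<le> k \<Longrightarrow> y \<in> {a..b} \<Longrightarrow> (D j has_real_derivative D (Suc j) y) (at y within {a..b})"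
    "continuous_on {a..b} (D (Suc k))"
    "\<And>y. y \<in> {a<..<b} \<Longrightarrow> (u has_real_derivative D 0 y) (at y)"
    using poisson_solution_derivatives[OF ab assms(4,5)] by blast
  have D_cont: "continuous_on {a..b} (D j)" if "j \<le> Suc k" for j
  proof (cases "j = Suc k")
    case False
    hence "j \<le> k" using that by simp
    from DERIV_continuous_on[OF D(1)[OF this]] show ?thesis .
  qed (use D(2) in simp)
  have "\<exists>B. \<forall>y\<in>{a..b}. \<bar>D j y\<bar> \<le> B" if "j \<le> Suc k" for j
  proof -
    have "continuous_on {a..b} (\<lambda>y. \<bar>D j y\<bar>)" by (intro continuous_intros D_cont that)
    from continuous_attains_sup[OF compact_Icc _ this] ab show ?thesis by fastforce
  qed
  then obtain Bd where Bd: "\<And>j y. j \<le> Suc k \<Longrightarrow> y \<in> {a..b} \<Longrightarrow> \<bar>D j y\<bar> \<le> Bd j" by metis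
  define M where "M = (\<Sum>j\<le>Suc k. Bd j)"
  have M: "\<bar>D j y\<bar> \<le> M" if "j \<le> Suc k" "y \<in> {a..b}" for j y
  proof -
    have "0 \<le> Bd i" if "i \<in> {..Suc k}" for i using Bd[of i a] that ab by fastforce
    hence "Bd j \<le> M" unfolding M_def using that by (intro member_le_sum) auto
    thus ?thesis using Bd[OF that] by linarith
  qed
  have M0: "0 \<le> M" using M[of 0 a] ab by auto
  have u: "continuous_on {a..b} u" "u a = 0" "u b = 0"
    using assms(5) by (simp_all add: poisson_solution_def)
  from assms(6) have mesh: "\<And>N x. (N, x) \<in> F \<Longrightarrow> mesh a b N x"
    unfolding quasi_uniform_family_def by blast
  from assms(6) obtain \<sigma> where \<sigma>: "0 < \<sigma>"
    "\<And>N x i. (N, x) \<in> F \<Longrightarrow> i \<in> {1..N} \<Longrightarrow> mesh_size N x \<le> \<sigma> * (x (i + 1) - x i)"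
    unfolding quasi_uniform_family_def by blast
  define \<delta> where "\<delta> = 1 / \<sigma>"
  have \<delta>: "0 < \<delta>" using \<sigma> by (simp add: \<delta>_def)
  obtain Ki where Ki: "0 < Ki" "inverse_constant (k - 1) \<delta> Ki" by (rule inverse_estimate[OF \<delta>])
  obtain Kc where Kc: "0 < Kc" "cutoff_constant (k - 1) \<delta> Kc" by (rule spline_cutoff[OF \<delta>])
  obtain \<theta> Cd where \<theta>: "0 < \<theta>" "\<theta> < 1" "0 < Cd" "decay_constants (k - 1) \<mu> \<delta> k \<theta> Cd"
    by (rule local_decay[OF \<delta> \<mu>])
  \<comment> \<open>The decay rate dictates how large \<open>C\<^sup>*\<close> must be; below \<open>h0\<close> the patch contains more than \<open>k\<close> layers.\<close>
  define C0 where "C0 = real k * (2 * real k + 3) / (- ln \<theta>) + 1"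
  have "0 \<le> real k * (2 * real k + 3) / (- ln \<theta>)"
    using \<theta> by (intro divide_nonneg_pos mult_nonneg_nonneg) auto
  hence C0: "0 < C0" by (simp add: C0_def)
  define h0 where "h0 = exp (- (real k + 1))"
  have h0: "0 < h0" "h0 \<le> 1" by (simp_all add: h0_def)
  define CE where "CE = 6 * (M\<^sup>2 * (b - a)) + 3 * ((2 * M * (1 + (b - a) ^ (k + 1)))\<^sup>2 * (b - a))"
  define B where "B = sqrt (Ki * ((1 / \<theta>) ^ 3 * CE + Cd * (2 * M)\<^sup>2))"
  define C1 where "C1 = B + real (k + 1) * (sqrt Kc + 2) * (B + 2 * M * real (k + 1) ^ (k + 1))"
  define C2 where "C2 = (M + sqrt (Ki * (M\<^sup>2 * (b - a)) / h0 ^ (2 * k))) * (1 + (b - a))"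
  have CE0: "0 \<le> CE" using ab by (simp add: CE_def)
  have B0: "0 \<le> B" using Ki \<theta> CE0 by (simp add: B_def)
  have C1: "0 \<le> C1" using B0 Kc M0 by (simp add: C1_def)
  have C2: "0 \<le> C2" using M0 Ki ab h0 by (simp add: C2_def)
  define C where "C = C1 + C2 / h0 ^ (k + 2) + 1"
  have C2': "0 \<le> C2 / h0 ^ (k + 2)" using C2 h0 by simp
  have C: "0 < C" "C1 \<le> C" "C2 / h0 ^ (k + 2) \<le> C" using C1 C2' by (simp_all add: C_def)
  have main: "\<bar>(deriv ^^ s) (\<lambda>y. u y - uh y) x0\<bar> \<le> C * h ^ (k + 2 - s)"
    if Cs: "C0 \<le> Cstar" and Nx: "(N, x) \<in> F" and h: "h = mesh_size N x" and d: "d = Cstar * h * \<bar>ln h\<bar>"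
      and gal: "galerkin_solution a b N x k \<mu> u uh" and sub: "{x0 - d..x0 + d} \<subseteq> {a<..<b}"
      and sym: "symmetric_patch N x k \<mu> d x0" and even: "even (k - s)"
      and s: "(x0 \<in> x ` {1..N + 1} \<and> s \<le> \<mu>) \<or> (x0 \<in> (\<Union>i\<in>{1..N}. {x i<..<x (i + 1)}) \<and> s \<le> k)"
    for Cstar N x uh x0 h d s
  proof -
    note mesh = mesh[OF Nx]
    obtain P where P: "\<And>i. i \<in> {1..N} \<Longrightarrow> degree (P i) \<le> k"
      "\<And>i y. i \<in> {1..N} \<Longrightarrow> y \<in> cell x i \<Longrightarrow> uh y = poly (P i) y"
      "\<And>i. i \<in> {2..N} \<Longrightarrow> [:- x i, 1:] ^ Suc \<mu> dvd P i - P (i - 1)"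
      "\<And>i. i \<in> {1..N} \<Longrightarrow> integral (cell x i) (\<lambda>y. D 0 y - poly (pderiv (P i)) y) =
          (u (x (i + 1)) - uh (x (i + 1))) - (u (x i) - uh (x i))"
      "\<And>Q. (\<And>i. i \<in> {1..N} \<Longrightarrow> degree (Q i) \<le> k - 1) \<Longrightarrow>
          (\<And>i. i \<in> {2..N} \<Longrightarrow> joined x \<mu> Q i) \<Longrightarrow>
          (\<Sum>i\<in>{1..N}. integral (cell x i) (\<lambda>y. (D 0 y - poly (pderiv (P i)) y) * poly (Q i) y)) = 0"
      "uh a = 0" "uh b = 0"
      by (rule galerkin_orthogonality[OF mesh ab k gal u D(3) D_cont[of 0]]) auto
    interpret galerkin_error a b N x k \<mu> u uh D M \<delta> h P
    proof unfold_locales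
      show "\<delta> * h \<le> x (i + 1) - x i" if "i \<in> {1..N}" for i
        using \<sigma>(2)[OF Nx that] \<sigma>(1) by (simp add: \<delta>_def h field_simps)
    qed (fact mesh ab k \<mu> D(1) M u D(3) P \<delta> h)+
    have d0: "0 \<le> d" using Cs C0 h_pos by (simp add: d)
    hence "x0 \<in> {x0 - d..x0 + d}" by simp
    hence x0: "x0 \<in> {a<..<b}" using sub by blast
    obtain m where m: "m \<in> {1..N}" "x m \<le> x0" "x0 < x (m + 1)"
      by (rule mesh_elem_containing[OF mesh, of x0]) (use x0 in auto)
    have s': "x m < x0 \<and> s \<le> k \<or> x0 = x m \<and> s \<le> \<mu>"
    proof (cases "x m < x0")
      case True
      thus ?thesis using s \<mu> by auto
    next
      case False
      hence xm: "x0 = x m" using m by simp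
      have "x0 \<notin> (\<Union>i\<in>{1..N}. {x i<..<x (i + 1)})"
      proof
        assume "x0 \<in> (\<Union>i\<in>{1..N}. {x i<..<x (i + 1)})"
        then obtain i where i: "i \<in> {1..N}" "x i < x m" "x m < x (i + 1)" using xm by auto
        have "m \<le> i \<or> i + 1 \<le> m" by arith
        thus False using mesh_le[OF mesh, of m i] mesh_le[OF mesh, of "i + 1" m] i m(1) by auto
      qed
      thus ?thesis using s xm by auto
    qed
    have ax0: "a < x0" using x0 by simp
    have eq: "(deriv ^^ s) (\<lambda>y. u y - uh y) x0 = (deriv ^^ s) err x0" by (simp add: err_def[abs_def])
    show ?thesis
    proof (cases "h < h0")
      case True
      obtain J n where J_n: "real J * h \<le> Cstar * h * \<bar>ln h\<bar>" "k + n * k \<le> J"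
          "\<theta> ^ n \<le> (1 / \<theta>) ^ 3 * h ^ (2 * k + 3)"
        by (rule decay_rate[OF \<theta>(1,2) k h_pos, of Cstar]) (use True Cs in \<open>auto simp: h0_def C0_def\<close>)
      define c where "c = (if x m < x0 then 2 * m else 2 * m - 1)"
      have Jd: "real J * h \<le> d" using J_n(1) by (simp add: d)
      note idx = symmetric_patch_indices[OF mesh h sub sym Jd m, folded c_def]
      interpret symmetric_galerkin_error a b N x k \<mu> u uh D M \<delta> h P x0 m c J
        by unfold_locales (fact m ax0 c_def idx(1-3))+
      have "\<bar>(deriv ^^ s) err x0\<bar> \<le> C1 * h ^ (k + 2 - s)"
        unfolding C1_def B_def CE_def
        by (rule fine_bound[OF \<theta>(4) Ki(2) Kc(2) Ki(1) Kc(1) \<theta>(3,1) idx(4) J_n(2,3) s' even])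
      also have "\<dots> \<le> C * h ^ (k + 2 - s)" using C h_pos by (intro mult_right_mono) auto
      finally show ?thesis unfolding eq .
    next
      case False
      hence h0h: "h0 \<le> h" by simp
      have "\<bar>(deriv ^^ s) err x0\<bar> \<le> C2"
        unfolding C2_def by (rule crude_bound[OF Ki(2,1) h0 h0h m ax0 s'])
      also have "C2 = (C2 / h0 ^ (k + 2)) * h0 ^ (k + 2)" using h0 by simp
      also have "\<dots> \<le> (C2 / h0 ^ (k + 2)) * h ^ (k + 2 - s)"
      proof (rule mult_left_mono[OF _ C2'])
        have "h0 ^ (k + 2) \<le> h0 ^ (k + 2 - s)" using h0 by (intro power_decreasing) auto
        also have "\<dots> \<le> h ^ (k + 2 - s)" using h0 h0h by (intro power_mono) auto
        finally show "h0 ^ (k + 2) \<le> h ^ (k + 2 - s)" .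
      qed
      also have "\<dots> \<le> C * h ^ (k + 2 - s)" using C h_pos by (intro mult_right_mono) auto
      finally show ?thesis unfolding eq .
    qed
  qed
  show ?thesis
    by (rule exI[of _ C0], intro conjI allI impI C0, rule exI[of _ C], intro conjI ballI C(1),
        clarify, rule main) (assumption | rule refl)+
qed

end
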